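(* Consider the iteration $x_{t+1}=x_t+\varphi_t z_{t,\tau}$ (online Newton with Hessian averaging and $\tau$ steps of the accelerated sketch-and-project solver, described in the context) with stepsize $\varphi_t=C_\varphi/(t+1)^{\varphi}$, $C_\varphi>0$, $\varphi\in(0.5,1]$. Assume: (i) $f$ and all realizations $F(\cdot;\xi)$ are twice continuously differentiable, and there are constants $\Upsilon_H>\gamma_H>0$ with $\gamma_H\le\lambda_{\min}(\nabla^2F(x;\xi))\le\lambda_{\max}(\nabla^2F(x;\xi))\le\Upsilon_H$ for all $x$ and $\xi$; moreover $\|\nabla^2f(x)-\nabla^2f(x')\|\le\Upsilon_L\|x-x'\|$ for all $x,x'$, for some constant $\Upsilon_L>0$; (ii) for all $t\ge0$, $\mathbb{E}[g_t\mid\mathcal F_{t-1}]=\nabla f_t$ and $\mathbb{E}[\|g_t-\nabla f_t\|^2\mid\mathcal F_{t-1}]\le C_{g,1}\|x_t-x^\star\|^2+C_{g,2}$ for some constants $C_{g,1},C_{g,2}>0$; (iii) for all $t\ge0$, $\mathbb{E}[H_t\mid\mathcal F_{t-1}]=\nabla^2f_t$; (iv) there is a constant $\gamma_S>0$ such that $Z_t\succeq\gamma_SI$ for all $t\ge0$; (v) $\tau(1-\sqrt{\mu_t/\nu_t})^{\tau-2}\le\gamma_H/(4\Upsilon_H)$ for all $t\ge0$. Then $x_t\to x^\star$ almost surely as $t\to\infty$.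
   Context: Problem: $f(x)=\mathbb{E}_{\xi\sim\mathcal P}[F(x;\xi)]$ on $\mathbb{R}^d$, $x^\star=\arg\min f$; $f_t=f(x_t)$, $\nabla f_t=\nabla f(x_t)$, $\nabla^2f_t=\nabla^2f(x_t)$. $\|\cdot\|$ is the $\ell_2$/spectral norm, $^\dagger$ the Moore–Penrose pseudoinverse. Data and Hessian average: $x_0\in\mathbb{R}^d$ is fixed, $\xi_0,\xi_1,\ldots$ are i.i.d. $\sim\mathcal P$, $g_t=\nabla F(x_t;\xi_t)$, $H_t=\nabla^2F(x_t;\xi_t)$, $B_t=\frac1t\sum_{i=0}^{t-1}H_i$ for $t\ge1$, and $B_0$ is a fixed symmetric matrix with $\gamma_HI\preceq B_0\preceq\Upsilon_HI$. Sketches: $S$ is a random matrix in $\mathbb{R}^{d\times s}$; $\tau\ge1$ is a fixed integer; $\{S_{t,j}\}_{t\ge0,\,0\le j\le\tau-1}$ are i.i.d. copies of $S$, independent of all data $\{\xi_t\}$. Filtration: $\mathcal F_t=\sigma(\{\xi_i,\{S_{i,j}\}_j\}_{i=0}^t)$, $\mathcal F_{-1}$ trivial. Solver parameters: with $S$ independent of $\mathcal F_{t-1}$ let $\tilde Z_t=B_tS(S^\top B_t^2S)^\dagger S^\top B_t$, $Z_t=\mathbb{E}[\tilde Z_t\mid\mathcal F_{t-1}]$, and $\mu_t=\inf_{a\ne0}\frac{a^\top Z_ta}{a^\top a}$, $\nu_t=\sup_{a\ne0}\frac{a^\top\mathbb{E}[\tilde Z_tZ_t^{-1}\tilde Z_t\mid\mathcal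 F_{t-1}]a}{a^\top Z_ta}$, $\gamma_t=1/\sqrt{\mu_t\nu_t}$, $\alpha_t=1/(1+\gamma_t\nu_t)$, $\beta_t=1-\sqrt{\mu_t/\nu_t}$. Solver: $z_{t,0}=v_{t,0}=0$ and, for $0\le j\le\tau-1$: $y_{t,j}=\alpha_tv_{t,j}+(1-\alpha_t)z_{t,j}$, $\omega_{t,j}=B_tS_{t,j}(S_{t,j}^\top B_t^2S_{t,j})^\dagger S_{t,j}^\top(B_ty_{t,j}+g_t)$, $z_{t,j+1}=y_{t,j}-\omega_{t,j}$, $v_{t,j+1}=\beta_tv_{t,j}+(1-\beta_t)y_{t,j}-\gamma_t\omega_{t,j}$. Outer update: $x_{t+1}=x_t+\varphi_tz_{t,\tau}$. Convention in the condition on $\tau$: $0^0=1$, $0^{-1}=+\infty$. *)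

theory Defs
  imports "HOL-Probability.Probability"
begin

definition grad :: "('n::real_inner \<Rightarrow> real) \<Rightarrow> 'n \<Rightarrow> 'n" where
  "grad f x = (THE D. GDERIV f x :> D)"

definition hessian :: "(real^'n \<Rightarrow> real) \<Rightarrow> real^'n \<Rightarrow> real^'n^'n" where
  "hessian f x = jacobian (grad f) (at x)"

definition twice_continuously_differentiable :: "(real^'n \<Rightarrow> real) \<Rightarrow> bool" where
  "twice_continuously_differentiable f \<longleftrightarrow>
     f differentiable_on UNIV \<and> grad f differentiable_on UNIV \<and> continuous_on UNIV (hessian f)"

definition eigenvalues :: "real^'n^'n \<Rightarrow> real set" where
  "eigenvalues A = {c. \<exists>v. v \<noteq> 0 \<and> A *v v = c *\<^sub>R v}"

text \<open>Used for symmetric matrices only, so that the set of eigenvalues is nonempty.\<close>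

definition lambda_min :: "real^'n^'n \<Rightarrow> real" where
  "lambda_min A = Min (eigenvalues A)"

definition lambda_max :: "real^'n^'n \<Rightarrow> real" where
  "lambda_max A = Max (eigenvalues A)"

definition spectral_norm :: "real^'n^'m \<Rightarrow> real" where
  "spectral_norm A = onorm ((*v) A)"

definition psd :: "real^'n^'n \<Rightarrow> bool" where
  "psd A \<longleftrightarrow> transpose A = A \<and> (\<forall>a. 0 \<le> a \<bullet> (A *v a))"

definition loewner_le :: "real^'n^'n \<Rightarrow> real^'n^'n \<Rightarrow> bool"  (infix \<open>\<preceq>\<^sub>L\<close> 50) where
  "A \<preceq>\<^sub>L B \<longleftrightarrow> psd (B - A)"

text \<open>The Moore--Penrose pseudoinverse, characterised by the four Penrose equations.\<close>

definition pinv :: "real^'n^'m \<Rightarrow> real^'m^'n" where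
  "pinv A = (THE X. A ** X ** A = A \<and> X ** A ** X = X \<and>
                    transpose (A ** X) = A ** X \<and> transpose (X ** A) = X ** A)"

text \<open>A matrix in \<open>\<real>\<^bsup>d\<times>s\<^esup>\<close> has the type \<open>real^'s^'d\<close> (rows are indexed by \<open>'d\<close>).\<close>

definition sketch_step :: "real^'d^'d \<Rightarrow> real^'s^'d \<Rightarrow> real^'d^'d" where
  "sketch_step B S = B ** S ** pinv (transpose S ** (B ** B) ** S) ** transpose S"

definition sketch_proj :: "real^'d^'d \<Rightarrow> real^'s^'d \<Rightarrow> real^'d^'d" where
  "sketch_proj B S = sketch_step B S ** B"

definition sketch_mu :: "real^'n^'n \<Rightarrow> real" where
  "sketch_mu Z = (INF a\<in>-{0}. (a \<bullet> (Z *v a)) / (a \<bullet> a))"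

definition sketch_nu :: "real^'n^'n \<Rightarrow> real^'n^'n \<Rightarrow> real" where
  "sketch_nu Z Y = (SUP a\<in>-{0}. (a \<bullet> (Y *v a)) / (a \<bullet> (Z *v a)))"

text \<open>The sigma-algebra on the space of \<open>M\<close> generated by the family \<open>X i\<close>, \<open>i \<in> I\<close>, of
  \<open>N\<close>-valued random variables.\<close>

definition gen_sigma :: "'a measure \<Rightarrow> 'b measure \<Rightarrow> ('i \<Rightarrow> 'a \<Rightarrow> 'b) \<Rightarrow> 'i set \<Rightarrow> 'a measure" where
  "gen_sigma M N X I = sigma (space M) {X i -` A \<inter> space M | i A. i \<in> I \<and> A \<in> sets N}"

text \<open>The shifted filtration \<open>past M P \<xi> S \<tau> t = \<F>\<^bsub>t-1\<^esub>\<close>; it is trivial for \<open>t = 0\<close>.\<close>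

definition past :: "'a measure \<Rightarrow> 'b measure \<Rightarrow> (nat \<Rightarrow> 'a \<Rightarrow> 'b) \<Rightarrow>
    (nat \<Rightarrow> nat \<Rightarrow> 'a \<Rightarrow> real^'s^'d) \<Rightarrow> nat \<Rightarrow> nat \<Rightarrow> 'a measure" where
  "past M P \<xi> S \<tau> t = sigma (space M)
     (sets (gen_sigma M P \<xi> {..<t}) \<union> sets (gen_sigma M borel (\<lambda>(i, j). S i j) ({..<t} \<times> {..<\<tau>})))"

definition cond_exp_vec :: "'a measure \<Rightarrow> 'a measure \<Rightarrow> ('a \<Rightarrow> real^'n) \<Rightarrow> 'a \<Rightarrow> real^'n" where
  "cond_exp_vec M G X \<omega> = (\<chi> i. real_cond_exp M G (\<lambda>\<omega>'. X \<omega>' $ i) \<omega>)"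

definition cond_exp_mat :: "'a measure \<Rightarrow> 'a measure \<Rightarrow> ('a \<Rightarrow> real^'n^'m) \<Rightarrow> 'a \<Rightarrow> real^'n^'m" where
  "cond_exp_mat M G X \<omega> = (\<chi> i j. real_cond_exp M G (\<lambda>\<omega>'. X \<omega>' $ i $ j) \<omega>)"

text \<open>Integer powers with \<open>0\<^sup>0 = 1\<close> and, unlike \<open>(powi)\<close>, \<open>0\<^bsup>-1\<^esup> = \<infinity>\<close>.\<close>

definition epowi :: "real \<Rightarrow> int \<Rightarrow> ereal" where
  "epowi b k = (if b = 0 \<and> k < 0 then \<infinity> else ereal (b powi k))"

end

(*
  Conditionally on the past, the data enter the inner solver only through g_t and the sketches are
  fresh, so the mean of z_{t,tau} is (K_t - I) B_t^{-1} grad f(x_t), where K_t arises from the solver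
  recursion for the errors by replacing every sketched projection with its mean Z_t. On an eigenvector
  of Z_t this recursion is a 2x2 linear recurrence whose characteristic roots have modulus at most
  1 - sqrt(mu/nu); hence |K_t| <= 2 tau (1 - sqrt(mu/nu))^(tau-1) <= gamma_H / (2 Upsilon_H), and the
  mean direction is a descent direction no matter how well B_t approximates the true Hessian.

  As f inherits strong convexity and smoothness from the realizations, V_t = f(x_t) - f(xstar) satisfies
    E[V_{t+1} | past] <= (1 - c phi_t + C phi_t^2) V_t + C phi_t^2.
  Since sum phi_t diverges and sum phi_t^2 converges, E V_t tends to 0. After rescaling, adding the
  tail of the noise series makes V_t a nonnegative supermartingale with mean tending to 0, so it
  tends to 0 almost surely by the maximal inequality, without a martingale convergence theorem.
*)
theory Submission
  imports Defs
begin

section \<open>Quadratic forms, pseudoinverses and sketched projections\<close>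

text \<open>Averaging is possible because \<open>B t\<close> uses data before time \<open>t\<close>
  only: given the past it is fixed, so \<open>z + B^-1 g\<close> is linear in \<open>g\<close>. The
  sketches are averaged one at a time, latest first, and \<open>g\<close> last. This is done in
  integrated form, against square integrable weights that depend on the past, instead of with
  conditional expectations of vectors. A large share of the work is measurability. The solver
  parameters are an infimum and a supremum over all vectors, formed from conditional expectations,
  and the pseudoinverse is discontinuous; all must be Borel everywhere, also on the null sets where
  the definitions return unspecified values. The function \<open>F\<close> is only given as
  measurable in the sample for each fixed argument, whereas the iteration evaluates its derivatives
  at random points. Curvature passes from the realizations to \<open>f\<close> as a convexity
  inequality without derivatives, which avoids differentiating under the integral. The facts needed
  about symmetric matrices come from one tool, an eigenvector that maximises the quadratic form on
  an invariant subspace.\<close>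

lemma dot_matrix_vector: "(A *v a) \<bullet> b = a \<bullet> (transpose A *v b)" for A :: "real^'n^'m"
  using dot_lmul_matrix[of b A a] by (simp add: inner_commute)

lemma symmetric_dot: "transpose A = A \<Longrightarrow> (A *v a) \<bullet> b = a \<bullet> (A *v b)" for A :: "real^'n^'n"
  using dot_matrix_vector[of A a b] by simp

lemma uminus_matrix_vector: "(- A) *v a = - (A *v a)" for A :: "real^'n^'m"
  using scaleR_matrix_vector_assoc[of "-1" A a] by simp

lemma transpose_minus: "transpose (- A) = - transpose A" for A :: "real^'n^'m"
  by (simp add: transpose_def vec_eq_iff)

lemma transpose_add: "transpose (A + B) = transpose A + transpose B" for A :: "real^'n^'m"
  by (simp add: transpose_def vec_eq_iff)

lemma transpose_diff: "transpose (A - B) = transpose A - transpose B" for A :: "real^'n^'m"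
  by (simp add: transpose_def vec_eq_iff)

text \<open>A zero of a form that is nonnegative on \<open>U\<close> is a minimum there, so the
  derivative of the form at \<open>b\<close> vanishes in every direction \<open>c\<close> of
  \<open>U\<close>.\<close>

lemma psd_form_kernel:
  fixes A :: "real^'n^'n"
  assumes sym: "transpose A = A" and U: "subspace U" "b \<in> U" "c \<in> U"
    and psd: "\<And>a. a \<in> U \<Longrightarrow> 0 \<le> a \<bullet> (A *v a)" and z: "b \<bullet> (A *v b) = 0"
  shows "c \<bullet> (A *v b) = 0"
proof (rule ccontr)
  define p q where "p = c \<bullet> (A *v b)" and "q = c \<bullet> (A *v c)"
  assume "c \<bullet> (A *v b) \<noteq> 0"
  then have p: "p \<noteq> 0" by (simp add: p_def)
  have bc: "b \<bullet> (A *v c) = p"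
    using symmetric_dot[OF sym, of b c] by (simp add: p_def inner_commute)
  have ineq: "0 \<le> 2 * t * p + t\<^sup>2 * q" for t
  proof -
    have "b + t *\<^sub>R c \<in> U" using U by (simp add: subspace_add subspace_scale)
    then have "0 \<le> (b + t *\<^sub>R c) \<bullet> (A *v (b + t *\<^sub>R c))" by (rule psd)
    also have "\<dots> = 2 * t * p + t\<^sup>2 * q"
      using z bc by (simp add: matrix_vector_right_distrib matrix_vector_mult_scaleR inner_add_left
          inner_add_right p_def q_def power2_eq_square algebra_simps)
    finally show ?thesis .
  qed
  have q0: "0 \<le> q" using psd U by (simp add: q_def)
  \<comment> \<open>The minimiser of \<open>2 * t * p + t^2 * q\<close> would be
    \<open>- p / q\<close>; with \<open>1 + q\<close> in place of \<open>q\<close> the quotient is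
    defined also for \<open>q = 0\<close>, and the value is still negative.\<close>
  have "0 \<le> 2 * (- p / (1 + q)) * p + (- p / (1 + q))\<^sup>2 * q" by (rule ineq)
  also have "\<dots> = - (p\<^sup>2 / (1 + q)) * (2 - q / (1 + q))"
  proof -
    define s where "s = 1 + q"
    have "s \<noteq> 0" using q0 by (simp add: s_def)
    then show ?thesis unfolding s_def[symmetric] by (simp add: field_simps power2_eq_square)
  qed
  also have "\<dots> < 0"
  proof -
    have "q / (1 + q) < 1" using q0 by simp
    moreover have "0 < p\<^sup>2 / (1 + q)" using p q0 by simp
    ultimately have "0 < p\<^sup>2 / (1 + q) * (2 - q / (1 + q))" by (intro mult_pos_pos) auto
    then show ?thesis by (simp only: mult_minus_left neg_less_0_iff_less)
  qed
  finally show False by simp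
qed

text \<open>A maximiser of the quadratic form on the unit sphere of \<open>U\<close> is an
  eigenvector. The version relative to an invariant subspace is what later yields a common
  eigenvector of two commuting matrices, in \<open>mean_error_bound\<close>.\<close>

lemma symmetric_max_eigenvector:
  fixes A :: "real^'n^'n"
  assumes sym: "transpose A = A" and U: "subspace U" "U \<noteq> {0}" and inv: "\<And>a. a \<in> U \<Longrightarrow> A *v a \<in> U"
  obtains b m where "b \<in> U" "norm b = 1" "A *v b = m *\<^sub>R b" "\<And>a. a \<in> U \<Longrightarrow> a \<bullet> (A *v a) \<le> m * (a \<bullet> a)"
proof -
  let ?K = "sphere 0 1 \<inter> U"
  have "compact ?K" by (intro compact_Int_closed compact_sphere closed_subspace U)
  obtain a0 where a0: "a0 \<in> U" "a0 \<noteq> 0" using U subspace_0[OF U(1)] by blast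
  then have "inverse (norm a0) *\<^sub>R a0 \<in> ?K" using U by (simp add: subspace_scale)
  then have "?K \<noteq> {}" by blast
  have "continuous_on ?K (\<lambda>a. a \<bullet> (A *v a))"
    by (intro continuous_intros linear_continuous_on matrix_vector_mul_bounded_linear)
  then obtain b where b: "b \<in> ?K" and max: "\<And>a. a \<in> ?K \<Longrightarrow> a \<bullet> (A *v a) \<le> b \<bullet> (A *v b)"
    using continuous_attains_sup[OF \<open>compact ?K\<close> \<open>?K \<noteq> {}\<close>] by blast
  define m where "m = b \<bullet> (A *v b)"
  have le: "a \<bullet> (A *v a) \<le> m * (a \<bullet> a)" if "a \<in> U" for a
  proof (cases "a = 0")
    case False
    let ?u = "inverse (norm a) *\<^sub>R a"
    have "?u \<in> ?K" using that False U by (simp add: subspace_scale)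
    from max[OF this] have "(inverse (norm a))\<^sup>2 * (a \<bullet> (A *v a)) \<le> m"
      by (simp add: m_def matrix_vector_mult_scaleR power2_eq_square)
    then show ?thesis using False
      by (simp add: power_inverse power2_norm_eq_inner[symmetric] field_simps)
  qed simp
  let ?Q = "m *\<^sub>R mat 1 - A"
  have Q: "?Q *v a = m *\<^sub>R a - A *v a" for a
    by (simp add: matrix_vector_mult_diff_rdistrib flip: scaleR_matrix_vector_assoc)
  have bU: "b \<in> U" and nb: "norm b = 1" using b by auto
  \<comment> \<open>The form of \<open>m I - A\<close> is nonnegative on \<open>U\<close> and
    vanishes at \<open>b\<close>. Choosing the residual \<open>m b - A b\<close> itself as the
    direction, which lies in \<open>U\<close> by invariance, shows that the residual has norm
    zero.\<close>
  have "(m *\<^sub>R b - A *v b) \<bullet> (?Q *v b) = 0"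
  proof (rule psd_form_kernel[OF _ U(1) bU])
    show "transpose ?Q = ?Q" by (simp add: transpose_diff transpose_scalar sym)
    show "m *\<^sub>R b - A *v b \<in> U" using U inv bU by (simp add: subspace_diff subspace_scale)
    show "0 \<le> a \<bullet> (?Q *v a)" if "a \<in> U" for a using le[OF that] by (simp add: Q inner_diff_right)
    show "b \<bullet> (?Q *v b) = 0" using nb by (simp add: Q inner_diff_right norm_eq_1) (simp add: m_def)
  qed
  then have "A *v b = m *\<^sub>R b" by (simp add: Q)
  then show thesis using that bU nb le by blast
qed

text \<open>\<open>lambda_min\<close> and \<open>lambda_max\<close> are a \<open>Min\<close> and a
  \<open>Max\<close>, meaningful on finite sets only. Eigenvectors for distinct eigenvalues of a
  symmetric matrix are orthogonal, so one choice per eigenvalue gives an independent, hence finite,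
  set.\<close>

lemma finite_eigenvalues:
  fixes A :: "real^'n^'n"
  assumes sym: "transpose A = A"
  shows "finite (eigenvalues A)"
proof -
  have "\<forall>c\<in>eigenvalues A. \<exists>v. v \<noteq> 0 \<and> A *v v = c *\<^sub>R v" by (simp add: eigenvalues_def)
  from bchoice[OF this] obtain e where e: "\<And>c. c \<in> eigenvalues A \<Longrightarrow> e c \<noteq> 0 \<and> A *v e c = c *\<^sub>R e c"
    by blast
  have orth: "e c \<bullet> e c' = 0" if "c \<in> eigenvalues A" "c' \<in> eigenvalues A" "c \<noteq> c'" for c c'
    using symmetric_dot[OF sym, of "e c" "e c'"] e[OF that(1)] e[OF that(2)] that(3) by simp
  have "independent (e ` eigenvalues A)"
    by (rule pairwise_orthogonal_independent) (use e orth in \<open>auto simp: pairwise_def orthogonal_def\<close>)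
  then have "finite (e ` eigenvalues A)" by (rule independent_imp_finite)
  moreover have "inj_on e (eigenvalues A)"
    by (rule inj_onI) (metis e orth inner_eq_zero_iff)
  ultimately show ?thesis by (simp add: finite_image_iff)
qed

text \<open>The maximal Rayleigh quotient is itself an eigenvalue, hence at most
  \<open>lambda_max A\<close>.\<close>

lemma quadratic_form_le_lambda_max:
  fixes A :: "real^'n^'n"
  assumes sym: "transpose A = A"
  shows "a \<bullet> (A *v a) \<le> lambda_max A * (a \<bullet> a)"
proof -
  have "(UNIV :: (real^'n) set) \<noteq> {0}"
    by (metis UNIV_I norm_zero singletonD vector_choose_size zero_le_one zero_neq_one)
  then obtain b m where b: "norm b = 1" "A *v b = m *\<^sub>R b" and le: "\<And>a. a \<bullet> (A *v a) \<le> m * (a \<bullet> a)"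
    using symmetric_max_eigenvector[OF sym subspace_UNIV] by (metis UNIV_I)
  have "b \<noteq> 0" using b by auto
  then have "m \<in> eigenvalues A" using b unfolding eigenvalues_def by blast
  then have "m \<le> lambda_max A"
    unfolding lambda_max_def using finite_eigenvalues[OF sym] by simp
  then show ?thesis by (meson le inner_ge_zero mult_right_mono order_trans)
qed

lemma lambda_min_le_quadratic_form:
  fixes A :: "real^'n^'n"
  assumes sym: "transpose A = A"
  shows "lambda_min A * (a \<bullet> a) \<le> a \<bullet> (A *v a)"
proof -
  note neg = uminus_matrix_vector[of A]
  have sym': "transpose (- A) = - A" using sym by (simp add: transpose_minus)
  have "(UNIV :: (real^'n) set) \<noteq> {0}"
    by (metis UNIV_I norm_zero singletonD vector_choose_size zero_le_one zero_neq_one)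
  then obtain b m where b: "norm b = 1" "(- A) *v b = m *\<^sub>R b"
    and le: "\<And>a. a \<bullet> ((- A) *v a) \<le> m * (a \<bullet> a)"
    using symmetric_max_eigenvector[OF sym' subspace_UNIV] by (metis UNIV_I)
  have "b \<noteq> 0" using b by auto
  moreover have "A *v b = (- m) *\<^sub>R b" using b(2) neg by (metis minus_equation_iff scaleR_minus_left)
  ultimately have "- m \<in> eigenvalues A" unfolding eigenvalues_def by blast
  then have "lambda_min A \<le> - m"
    unfolding lambda_min_def using finite_eigenvalues[OF sym] by simp
  then have "lambda_min A * (a \<bullet> a) \<le> (- m) * (a \<bullet> a)" by (intro mult_right_mono) auto
  then show ?thesis using le[of a] by (simp add: neg)
qed

lemma loewner_le_form: "A \<preceq>\<^sub>L B \<Longrightarrow> a \<bullet> (A *v a) \<le> a \<bullet> (B *v a)" for A :: "real^'n^'n"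
  unfolding loewner_le_def psd_def by (simp add: matrix_vector_mult_diff_rdistrib inner_diff_right)

lemma scaleR_mat_form: "a \<bullet> ((c *\<^sub>R mat 1) *v a) = c * (a \<bullet> a)" for a :: "real^'n"
  by (simp flip: scaleR_matrix_vector_assoc)

section \<open>Moore-Penrose pseudoinverses, sketched projections and inverses of coercive
  matrices\<close>

definition is_pinv :: "real^'n^'m \<Rightarrow> real^'m^'n \<Rightarrow> bool" where
  "is_pinv A X \<longleftrightarrow> A ** X ** A = A \<and> X ** A ** X = X \<and>
     transpose (A ** X) = A ** X \<and> transpose (X ** A) = X ** A"

text \<open>Transposing \<open>A X = (A Y) (A X)\<close> exchanges the two symmetric factors and
  yields \<open>A X = A Y\<close>; likewise \<open>X A = Y A\<close>. These two products determine
  the pseudoinverse.\<close>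

lemma is_pinv_unique:
  assumes "is_pinv A X" "is_pinv A Y"
  shows "X = Y"
proof -
  note X = assms(1)[unfolded is_pinv_def] and Y = assms(2)[unfolded is_pinv_def]
  have "A ** X = (A ** Y) ** (A ** X)" using Y by (metis matrix_mul_assoc)
  then have "A ** X = (A ** X) ** (A ** Y)" using X Y by (metis matrix_transpose_mul)
  then have AX: "A ** X = A ** Y" using X by (metis matrix_mul_assoc)
  have "X ** A = (X ** A) ** (Y ** A)" using Y by (metis matrix_mul_assoc)
  then have "X ** A = (Y ** A) ** (X ** A)" using X Y by (metis matrix_transpose_mul)
  then have XA: "X ** A = Y ** A" using X by (metis matrix_mul_assoc)
  have "X = X ** (A ** X)" using X by (metis matrix_mul_assoc)
  also have "\<dots> = Y ** (A ** Y)" using AX XA by (metis matrix_mul_assoc)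
  also have "\<dots> = Y" using Y by (metis matrix_mul_assoc)
  finally show ?thesis .
qed

lemma pinv_eqI: "is_pinv A X \<Longrightarrow> pinv A = X"
  unfolding pinv_def is_pinv_def[symmetric] using is_pinv_unique by blast

text \<open>No spectral decomposition is used: \<open>A\<close> and \<open>A ** A\<close> have the
  same range, so \<open>A ** A ** W = A\<close> can be solved. Then \<open>Q = A ** W\<close> is the
  orthogonal projection onto the range of \<open>A\<close>, and \<open>Q ** W\<close>, which equals
  \<open>W^T A W\<close>, is the pseudoinverse.\<close>

lemma symmetric_is_pinv_exists:
  fixes A :: "real^'n^'n"
  assumes sym: "transpose A = A"
  shows "\<exists>X. is_pinv A X \<and> transpose X = X"
proof -
  \<comment> \<open>Split \<open>A b\<close> into a part in the range of \<open>A ** A\<close> and a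
    remainder \<open>r\<close> orthogonal to it. Then \<open>A r = 0\<close>, while \<open>r\<close>
    also lies in the range of the symmetric matrix \<open>A\<close>; so \<open>r\<close> is
    orthogonal to itself.\<close>
  have "\<exists>w. A ** A *v w = A *v b" for b
  proof -
    let ?S = "range ((*v) (A ** A))"
    have sub: "subspace ?S" using linear_subspace_image[OF matrix_vector_mul_linear subspace_UNIV] by auto
    obtain y r where y: "y \<in> ?S" and r: "\<And>w. w \<in> ?S \<Longrightarrow> r \<bullet> w = 0" and yr: "A *v b = y + r"
      using orthogonal_subspace_decomp_exists[of ?S "A *v b"] sub
      by (metis orthogonal_def span_eq_iff)
    have "(A *v r) \<bullet> (A *v r) = r \<bullet> (A ** A *v r)"
      by (simp add: symmetric_dot[OF sym] matrix_vector_mul_assoc)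
    then have Ar: "A *v r = 0" using r[of "A ** A *v r"] by simp
    obtain w where w: "y = A ** A *v w" using y by auto
    have "r = A *v (b - A *v w)"
      using yr w by (simp add: matrix_vector_mult_diff_distrib matrix_vector_mul_assoc)
    then have "r \<bullet> r = (A *v r) \<bullet> (b - A *v w)" by (metis symmetric_dot[OF sym])
    then have "r = 0" using Ar by simp
    then show ?thesis using yr w by auto
  qed
  then obtain h where h: "\<And>b. A ** A *v h b = A *v b" by metis
  define W where "W = transpose (\<chi> j. h (axis j 1))"
  have "A ** A ** W = A"
  proof -
    have "column j (A ** A ** W) = A ** A *v h (axis j 1)" for j
      by (simp add: W_def column_def matrix_matrix_mult_def matrix_vector_mult_def transpose_def vec_eq_iff)
    also have "\<dots> j = column j A" for j by (simp add: h matrix_vector_mult_basis)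
    finally show ?thesis by (simp add: column_def vec_eq_iff)
  qed
  then have AAW: "A ** (A ** W) = A" by (simp add: matrix_mul_assoc)
  let ?T = "transpose W"
  define Q where "Q = A ** W"
  have AQ: "A ** Q = A" using AAW by (simp add: Q_def)
  have tQ: "transpose Q = ?T ** A" by (simp add: Q_def matrix_transpose_mul sym)
  have tQA: "transpose Q ** A = A" using arg_cong[OF AQ, of transpose] by (simp add: matrix_transpose_mul sym)
  have "transpose Q ** Q = Q" by (metis Q_def tQA matrix_mul_assoc)
  then have sQ: "transpose Q = Q" by (metis matrix_transpose_mul transpose_transpose)
  have QQ: "Q ** Q = Q" using \<open>transpose Q ** Q = Q\<close> sQ by simp
  have QA: "Q ** A = A" using tQA sQ by simp
  have TA: "?T ** A = Q" using tQ sQ by simp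
  define X where "X = Q ** W"
  have AX: "A ** X = Q" using AQ by (simp add: X_def matrix_mul_assoc flip: Q_def)
  have X2: "X = ?T ** Q" by (metis X_def Q_def TA matrix_mul_assoc)
  have XA: "X ** A = Q" by (metis X2 QA TA matrix_mul_assoc)
  have tX: "transpose X = X" using X2 sQ by (metis X_def matrix_transpose_mul)
  have "X ** A ** X = X" by (simp add: XA) (simp add: X_def matrix_mul_assoc QQ)
  then have "is_pinv A X" unfolding is_pinv_def by (simp add: AX XA sQ QA)
  then show ?thesis using tX by blast
qed

lemma pinv_symmetric:
  assumes "transpose A = A"
  shows "is_pinv A (pinv A)" "transpose (pinv A) = pinv A"
  using symmetric_is_pinv_exists[OF assms] pinv_eqI by metis+

lemma transpose_gram: "transpose (transpose A ** A) = transpose A ** A" for A :: "real^'n^'m"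
  by (simp add: matrix_transpose_mul)

lemma gram_eq_0: "transpose A ** A = 0 \<Longrightarrow> A = 0" for A :: "real^'n^'m"
proof -
  assume a: "transpose A ** A = 0"
  have "(A *v v) \<bullet> (A *v v) = 0" for v
    using dot_matrix_vector[of A v "A *v v"] a
    by (metis inner_zero_right matrix_vector_mul_assoc matrix_vector_mult_0)
  then show "A = 0" by (simp add: matrix_eq)
qed

lemma matrix_diff_ldistrib: "A ** (B - C) = A ** B - A ** C" for A :: "real^'n^'m"
  by (simp add: matrix_matrix_mult_def vec_eq_iff right_diff_distrib sum_subtractf)

lemma matrix_diff_rdistrib: "(A - B) ** C = A ** C - B ** C" for A :: "real^'n^'m"
  by (simp add: matrix_matrix_mult_def vec_eq_iff left_diff_distrib sum_subtractf)

text \<open>Reduces a rectangular pseudoinverse to that of the symmetric Gram matrix. The first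
  identity holds because the difference \<open>N\<close> of its sides satisfies
  \<open>N^T N = 0\<close>, by \<open>M ** pinv M ** M = M\<close>.\<close>

lemma pinv_gram:
  fixes A :: "real^'n^'m"
  defines "M \<equiv> transpose A ** A"
  shows "A ** pinv M ** M = A" and "pinv A = pinv M ** transpose A"
proof -
  let ?G = "pinv M"
  have sM: "transpose M = M" by (simp add: M_def transpose_gram)
  note P = pinv_symmetric(1)[OF sM, unfolded is_pinv_def]
  have sG: "transpose ?G = ?G" by (rule pinv_symmetric(2)[OF sM])
  have MGM: "M ** ?G ** M = M" using P by blast
  have TA: "X ** transpose A ** A = X ** M" for X :: "real^'n^'n" by (simp add: M_def matrix_mul_assoc)
  let ?N = "A ** ?G ** M - A"
  have "transpose ?N ** ?N = M ** ?G ** M ** ?G ** M - M ** ?G ** M - M ** ?G ** M + M"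
    by (simp add: transpose_diff matrix_transpose_mul sM sG matrix_diff_ldistrib matrix_diff_rdistrib
        matrix_mul_assoc TA flip: M_def)
  also have "\<dots> = 0" by (simp add: MGM)
  finally have "?N = 0" by (rule gram_eq_0)
  then show 1: "A ** ?G ** M = A" by simp
  have "is_pinv A (?G ** transpose A)"
    unfolding is_pinv_def
  proof (intro conjI)
    show "A ** (?G ** transpose A) ** A = A" using 1 by (simp add: M_def matrix_mul_assoc)
    have "?G ** transpose A ** A ** (?G ** transpose A) = (?G ** M ** ?G) ** transpose A"
      by (simp add: M_def matrix_mul_assoc)
    then show "?G ** transpose A ** A ** (?G ** transpose A) = ?G ** transpose A" using P by simp
    show "transpose (A ** (?G ** transpose A)) = A ** (?G ** transpose A)"
      by (simp add: matrix_transpose_mul sG matrix_mul_assoc)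
    have "?G ** transpose A ** A = ?G ** M" by (simp add: M_def matrix_mul_assoc)
    then show "transpose (?G ** transpose A ** A) = ?G ** transpose A ** A" using P by simp
  qed
  then show "pinv A = ?G ** transpose A" by (rule pinv_eqI)
qed

text \<open>With \<open>A = B ** S\<close> this matrix is \<open>A (A^T A)^+ A^T\<close>, the
  orthogonal projection onto the range of \<open>B ** S\<close>, also when \<open>S\<close> is rank
  deficient.\<close>

lemma sketch_proj_symmetric:
  fixes B :: "real^'d^'d" and S :: "real^'s^'d"
  assumes sym: "transpose B = B"
  shows "transpose (sketch_proj B S) = sketch_proj B S"
    and "sketch_proj B S ** sketch_proj B S = sketch_proj B S"
proof -
  let ?A = "B ** S"
  let ?M = "transpose S ** (B ** B) ** S"
  have M: "?M = transpose ?A ** ?A" by (simp add: matrix_transpose_mul sym matrix_mul_assoc)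
  have sM: "transpose ?M = ?M" unfolding M by (rule transpose_gram)
  note P = pinv_symmetric(1)[OF sM, unfolded is_pinv_def]
  have eq: "sketch_proj B S = ?A ** pinv ?M ** transpose ?A"
    by (simp add: sketch_proj_def sketch_step_def matrix_transpose_mul sym matrix_mul_assoc)
  show "transpose (sketch_proj B S) = sketch_proj B S"
    unfolding eq using pinv_symmetric(2)[OF sM] by (simp add: matrix_transpose_mul matrix_mul_assoc)
  have "sketch_proj B S ** sketch_proj B S = ?A ** (pinv ?M ** (transpose ?A ** ?A) ** pinv ?M) ** transpose ?A"
    unfolding eq by (simp add: matrix_mul_assoc)
  also have "\<dots> = sketch_proj B S" using P by (simp add: eq flip: M)
  finally show "sketch_proj B S ** sketch_proj B S = sketch_proj B S" .
qed

lemma orthogonal_projection_bounds: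
  fixes Q :: "real^'n^'n"
  assumes "transpose Q = Q" "Q ** Q = Q"
  shows "a \<bullet> (Q *v a) = (norm (Q *v a))\<^sup>2" "norm (Q *v a) \<le> norm a" "norm (a - Q *v a) \<le> norm a"
proof -
  show 1: "a \<bullet> (Q *v a) = (norm (Q *v a))\<^sup>2"
    using symmetric_dot[OF assms(1), of a "Q *v a"] assms(2)
    by (simp add: power2_norm_eq_inner matrix_vector_mul_assoc)
  have "(norm (a - Q *v a))\<^sup>2 + (norm (Q *v a))\<^sup>2 = (norm a)\<^sup>2"
    using 1 by (simp add: power2_norm_eq_inner inner_diff_left inner_diff_right inner_commute)
  then show "norm (Q *v a) \<le> norm a" "norm (a - Q *v a) \<le> norm a"
    by (smt (verit) norm_ge_zero power2_le_imp_le zero_le_power2)+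
qed

lemma form_bounds_matrix_inv:
  fixes B :: "real^'n^'n"
  assumes lo: "\<And>a. c * (a \<bullet> a) \<le> a \<bullet> (B *v a)" and c: "0 < c"
  shows "B ** matrix_inv B = mat 1" "matrix_inv B ** B = mat 1" "norm (matrix_inv B *v a) \<le> norm a / c"
proof -
  have nb: "c * norm b \<le> norm (B *v b)" for b
  proof (cases "b = 0")
    case False
    have "c * norm b * norm b \<le> norm b * norm (B *v b)"
      using lo[of b] norm_cauchy_schwarz[of b "B *v b"]
      by (simp add: power2_norm_eq_inner[symmetric] power2_eq_square mult.assoc)
    then show ?thesis using False by (simp add: mult.commute)
  qed simp
  have "\<forall>x. B *v x = 0 \<longrightarrow> x = 0"
    using nb c by (metis mult_pos_pos norm_eq_zero norm_le_zero_iff not_le zero_less_norm_iff)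
  then obtain B' where "B' ** B = mat 1" using matrix_left_invertible_ker by blast
  then have "invertible B" unfolding invertible_def using matrix_left_right_inverse by blast
  then show 1: "B ** matrix_inv B = mat 1" "matrix_inv B ** B = mat 1"
    unfolding invertible_def matrix_inv_def by (metis (mono_tags, lifting) someI_ex)+
  show "norm (matrix_inv B *v a) \<le> norm a / c"
    using nb[of "matrix_inv B *v a"] c 1 by (simp add: matrix_vector_mul_assoc field_simps)
qed

text \<open>This is \<open>B^-1 >= I / C\<close> in the Loewner order, obtained without square roots
  or eigenvalues of \<open>B\<close>.\<close>

lemma matrix_inv_form_lower:
  fixes B :: "real^'n^'n"
  assumes sym: "transpose B = B" and lo: "\<And>a. c * (a \<bullet> a) \<le> a \<bullet> (B *v a)" and c: "0 < c"
    and up: "\<And>a. a \<bullet> (B *v a) \<le> C * (a \<bullet> a)"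
  shows "(norm a)\<^sup>2 \<le> C * (a \<bullet> (matrix_inv B *v a))"
proof -
  define b where "b = matrix_inv B *v a"
  have a: "a = B *v b"
    using form_bounds_matrix_inv(1)[OF lo c] by (simp add: b_def matrix_vector_mul_assoc)
  have C: "0 < C"
  proof -
    obtain u :: "real^'n" where u: "norm u = 1" using vector_choose_size[of 1] by auto
    then have "u \<bullet> u = 1" by (simp add: norm_eq_1)
    then show ?thesis using lo[of u] up[of u] c by simp
  qed
  have pos: "0 \<le> v \<bullet> (B *v v)" for v using lo[of v] c by (meson inner_ge_zero less_imp_le mult_nonneg_nonneg order_trans)
  \<comment> \<open>Positivity of \<open>B\<close> at \<open>C b - B b\<close> amounts to
    \<open>(C - B) B (C - B) >= 0\<close>. Bounding the cubic term \<open><B b, B B b>\<close> by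
    \<open>C |B b|^2\<close> leaves exactly \<open>C |B b|^2 <= C^2 <b, B b>\<close>.\<close>
  let ?w = "C *\<^sub>R b - B *v b"
  have "0 \<le> ?w \<bullet> (B *v ?w)" by (rule pos)
  also have "?w \<bullet> (B *v ?w) = C\<^sup>2 * (b \<bullet> (B *v b)) - 2 * C * ((B *v b) \<bullet> (B *v b)) + (B *v b) \<bullet> (B *v (B *v b))"
    using symmetric_dot[OF sym, of b "B *v b"]
    by (simp add: matrix_vector_mult_diff_distrib matrix_vector_mult_scaleR inner_diff_left inner_diff_right
        power2_eq_square algebra_simps)
  also have "(B *v b) \<bullet> (B *v (B *v b)) \<le> C * ((B *v b) \<bullet> (B *v b))" by (rule up)
  finally have "C * ((B *v b) \<bullet> (B *v b)) \<le> C * (C * (b \<bullet> (B *v b)))"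
    by (simp add: power2_eq_square algebra_simps)
  then have "(B *v b) \<bullet> (B *v b) \<le> C * (b \<bullet> (B *v b))" using C by simp
  then show ?thesis by (simp add: a[symmetric] power2_norm_eq_inner inner_commute flip: b_def)
qed

section \<open>The mean error recursion of the accelerated solver\<close>

text \<open>A criterion of Schur-Cohn type for the roots of \<open>X^2 - t X + d\<close>. Nonreal
  roots have modulus \<open>sqrt d\<close>. Real roots lie in \<open>[-b, b]\<close> because by
  \<open>chi\<close> the polynomial is nonnegative at both ends and its vertex \<open>t / 2\<close>
  lies between them.\<close>

lemma quadratic_roots_norm_le:
  fixes t d b :: real
  assumes d: "d \<le> b\<^sup>2" and t: "\<bar>t\<bar> \<le> 2 * b" and chi: "0 \<le> b\<^sup>2 - \<bar>t\<bar> * b + d"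
  obtains u w :: complex where "u + w = of_real t" "u * w = of_real d" "norm u \<le> b" "norm w \<le> b"
proof (cases "4 * d \<le> t\<^sup>2")
  case True
  define s where "s = sqrt (t\<^sup>2 - 4 * d)"
  have s2: "s\<^sup>2 = t\<^sup>2 - 4 * d" and s0: "0 \<le> s" using True by (simp_all add: s_def)
  have "s\<^sup>2 \<le> (2 * b - \<bar>t\<bar>)\<^sup>2" using chi by (simp add: s2 power2_diff algebra_simps)
  then have "s \<le> 2 * b - \<bar>t\<bar>" using t by (simp add: power2_le_iff_abs_le)
  then have "\<bar>(t + s) / 2\<bar> \<le> b" "\<bar>(t - s) / 2\<bar> \<le> b" using s0 by auto
  moreover have "(t + s) / 2 * ((t - s) / 2) = d" using s2 by (simp add: power2_eq_square algebra_simps)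
  moreover have "(t + s) / 2 + (t - s) / 2 = t" by (simp add: field_simps)
  ultimately show thesis
    by (intro that[of "of_real ((t + s) / 2)" "of_real ((t - s) / 2)"])
      (simp_all only: norm_of_real flip: of_real_add of_real_mult)
next
  case False
  define s where "s = sqrt (4 * d - t\<^sup>2)"
  have s2: "s\<^sup>2 = 4 * d - t\<^sup>2" using False by (simp add: s_def)
  have b: "0 \<le> b" using t by linarith
  have "(t / 2)\<^sup>2 + (s / 2)\<^sup>2 = d" using s2 by (simp add: power_divide field_simps)
  then have n: "norm (Complex (t / 2) (s / 2)) \<le> b" "norm (Complex (t / 2) (- (s / 2))) \<le> b"
    using d b by (simp_all add: complex_norm real_le_lsqrt)
  show thesis
    by (rule that[OF _ _ n])
      (use \<open>(t / 2)\<^sup>2 + (s / 2)\<^sup>2 = d\<close> in \<open>simp_all add: complex_eq_iff power2_eq_square\<close>)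
qed

text \<open>Factoring the recurrence through its roots makes \<open>p (n + 1) - u p n\<close>
  geometric with ratio \<open>w\<close>. The roots are never separated, so a double root is covered;
  the linear factor in the bound is the price.\<close>

lemma recurrence_bound:
  fixes p :: "nat \<Rightarrow> real" and t d b :: real
  assumes rec: "\<And>n. p (Suc (Suc n)) = t * p (Suc n) - d * p n"
    and d: "d \<le> b\<^sup>2" and t: "\<bar>t\<bar> \<le> 2 * b" and chi: "0 \<le> b\<^sup>2 - \<bar>t\<bar> * b + d"
    and p: "p 0 = 1" "\<bar>p 1\<bar> \<le> 1" and b: "b \<le> 1"
  shows "\<bar>p (Suc n)\<bar> \<le> 2 * real (Suc n) * b ^ n"
proof -
  obtain u w :: complex where uw: "u + w = of_real t" "u * w = of_real d" "norm u \<le> b" "norm w \<le> b"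
    using quadratic_roots_norm_le[OF d t chi] .
  have b0: "0 \<le> b" using t by linarith
  have *: "of_real (p (Suc n)) - u * of_real (p n) = w ^ n * (of_real (p 1) - u)" for n
  proof (induction n)
    case (Suc n)
    have "of_real (p (Suc (Suc n))) - u * of_real (p (Suc n)) = w * (of_real (p (Suc n)) - u * of_real (p n))"
      by (simp add: rec uw(1)[symmetric] uw(2)[symmetric] algebra_simps)
    then show ?case by (simp add: Suc.IH)
  qed (simp add: p)
  have step: "\<bar>p (Suc n)\<bar> \<le> b * \<bar>p n\<bar> + 2 * b ^ n" for n
  proof -
    have "complex_of_real (p (Suc n)) = u * of_real (p n) + w ^ n * (of_real (p 1) - u)"
      using *[of n] by (simp add: algebra_simps)
    then have "\<bar>p (Suc n)\<bar> = norm (u * of_real (p n) + w ^ n * (of_real (p 1) - u))"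
      by (metis norm_of_real)
    also have "\<dots> \<le> norm u * \<bar>p n\<bar> + norm w ^ n * norm (of_real (p 1) - u)"
      by (rule norm_triangle_le) (simp add: norm_mult norm_power)
    also have "\<dots> \<le> b * \<bar>p n\<bar> + b ^ n * 2"
    proof (intro add_mono mult_mono power_mono uw)
      show "norm (of_real (p 1) - u) \<le> 2"
        using norm_triangle_ineq4[of "of_real (p 1)" u] p(2) uw(3) b by simp
    qed (use b0 in auto)
    finally show ?thesis by simp
  qed
  show ?thesis
  proof (induction n)
    case 0 then show ?case using p by simp
  next
    case (Suc n)
    have "\<bar>p (Suc (Suc n))\<bar> \<le> b * \<bar>p (Suc n)\<bar> + 2 * b ^ Suc n" by (rule step)
    also have "b * \<bar>p (Suc n)\<bar> \<le> b * (2 * real (Suc n) * b ^ n)" by (intro mult_left_mono Suc b0)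
    finally show ?case by (simp add: algebra_simps)
  qed
qed

text \<open>The components are the matrices that take the Newton vector to the mean errors of
  \<open>z\<close> and of \<open>v\<close>. Both start at the identity because the solver starts at
  zero, which makes both initial errors equal to the Newton vector.\<close>

primrec mean_error :: "real \<Rightarrow> real \<Rightarrow> real \<Rightarrow> real^'n^'n \<Rightarrow> nat \<Rightarrow> (real^'n^'n) \<times> (real^'n^'n)" where
  "mean_error a b c Z 0 = (mat 1, mat 1)"
| "mean_error a b c Z (Suc j) =
     (let E = fst (mean_error a b c Z j); V = snd (mean_error a b c Z j); W = a *\<^sub>R V + (1 - a) *\<^sub>R E
      in (W - Z ** W, b *\<^sub>R V + (1 - b) *\<^sub>R W - c *\<^sub>R (Z ** W)))"

primrec scalar_error :: "real \<Rightarrow> real \<Rightarrow> real \<Rightarrow> real \<Rightarrow> nat \<Rightarrow> real \<times> real" where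
  "scalar_error a b c l 0 = (1, 1)"
| "scalar_error a b c l (Suc j) =
     (let p = fst (scalar_error a b c l j); q = snd (scalar_error a b c l j); y = a * q + (1 - a) * p
      in ((1 - l) * y, b * q + (1 - b) * y - c * (l * y)))"

text \<open>Cayley-Hamilton for the 2x2 matrix that advances the pair: the coefficients are its
  trace and its determinant.\<close>

lemma scalar_error_recurrence:
  defines "p \<equiv> \<lambda>a b c l j. fst (scalar_error a b c l j)"
  shows "p a b c l (Suc (Suc j)) =
    ((1 - l) * (1 - a) + (b + (1 - b - c * l) * a)) * p a b c l (Suc j) -
    ((1 - l) * (1 - a) * (b + (1 - b - c * l) * a) - (1 - l) * a * ((1 - b - c * l) * (1 - a))) * p a b c l j"
  by (simp add: p_def Let_def algebra_simps)

text \<open>In terms of \<open>r = sqrt (\<mu> / \<nu>)\<close> all parameters are rational: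
  \<open>c = r / \<mu>\<close>, \<open>a = r / (1 + r)\<close>, \<open>b = 1 - r\<close>. The
  conditions of \<open>recurrence_bound\<close> on trace and determinant then reduce to
  \<open>r^2 <= k <= l <= 1\<close> for \<open>k = l / \<nu>\<close>.\<close>

lemma scalar_error_bound:
  fixes \<mu> \<nu> l :: real
  assumes mu: "0 < \<mu>" "\<mu> \<le> l" "l \<le> 1" and nu: "1 \<le> \<nu>"
  defines "c \<equiv> 1 / sqrt (\<mu> * \<nu>)"
  defines "a \<equiv> 1 / (1 + c * \<nu>)" and "b \<equiv> 1 - sqrt (\<mu> / \<nu>)"
  shows "\<bar>fst (scalar_error a b c l (Suc n))\<bar> \<le> 2 * real (Suc n) * b ^ n"
proof -
  define r where "r = sqrt (\<mu> / \<nu>)"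
  have r2: "r\<^sup>2 = \<mu> / \<nu>" using mu nu by (simp add: r_def)
  have r0: "0 < r" using mu nu by (simp add: r_def)
  have "\<mu> / \<nu> \<le> 1" using mu nu by (simp add: field_simps)
  then have r1: "r \<le> 1" by (simp add: r_def)
  have nu': "\<nu> = \<mu> / r\<^sup>2" using r2 mu nu r0 by (simp add: field_simps)
  have c: "c = r / \<mu>"
  proof -
    have "sqrt (\<mu> * \<nu>) = \<mu> / r"
      by (rule real_sqrt_unique) (use mu r0 in \<open>simp_all add: nu' power2_eq_square\<close>)
    then show ?thesis by (simp add: c_def)
  qed
  have a: "a = r / (1 + r)" using r0 mu by (simp add: a_def c nu' field_simps power2_eq_square)
  have b: "b = 1 - r" by (simp add: b_def r_def)
  define k where "k = l / \<nu>"
  have k: "k = l * r\<^sup>2 / \<mu>" by (simp add: k_def nu')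
  have k1: "r\<^sup>2 \<le> k" using mu nu by (simp add: k_def r2 divide_right_mono)
  have "l * 1 \<le> l * \<nu>" using mu nu by (intro mult_left_mono) auto
  then have k2: "k \<le> l" using nu by (simp add: k_def field_simps)
  have s: "1 - b - c * l = r - k / r" using r0 mu by (simp add: b c k power2_eq_square field_simps)
  define t where "t = (1 - l) * (1 - a) + (b + (1 - b - c * l) * a)"
  define d where "d = (1 - l) * (1 - a) * (b + (1 - b - c * l) * a) - (1 - l) * a * ((1 - b - c * l) * (1 - a))"
  have a1: "1 - a = 1 / (1 + r)" using r0 by (simp add: a field_simps)
  have t': "t = (2 - l - k) / (1 + r)"
  proof -
    have "(r - k / r) * r = r * r - k" using r0 by (simp add: left_diff_distrib)
    then have "(r - k / r) * (r / (1 + r)) = (r * r - k) / (1 + r)" by simp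
    moreover have "1 - r = (1 - r * r) / (1 + r)" using r0 by (simp add: field_simps)
    ultimately show ?thesis
      unfolding t_def s a1 unfolding a b by (simp add: add_divide_distrib diff_divide_distrib)
  qed
  have d': "d = (1 - l) * (1 - r) / (1 + r)"
  proof -
    have "d = (1 - l) * (1 - a) * b" by (simp add: d_def algebra_simps)
    then show ?thesis by (simp add: a1 b)
  qed
  have t0: "0 \<le> t" using mu k2 r0 by (simp add: t')
  show ?thesis
  proof (rule recurrence_bound[where t = t and d = d])
    show "fst (scalar_error a b c l (Suc (Suc n))) =
        t * fst (scalar_error a b c l (Suc n)) - d * fst (scalar_error a b c l n)" for n
      unfolding t_def d_def by (rule scalar_error_recurrence)
    have "r * r \<le> l" using k1 k2 by (simp add: power2_eq_square)
    then have "(1 - l) * (1 - r) \<le> (1 - r * r) * (1 - r)" using r1 by (intro mult_right_mono) auto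
    then show "d \<le> b\<^sup>2" using r0 by (simp add: d' b power2_eq_square field_simps)
    have "2 - l - k \<le> 2 * (1 - r) * (1 + r)" using k1 k2 by (simp add: power2_eq_square algebra_simps)
    then have "t \<le> 2 * b" using r0 by (simp add: t' b pos_divide_le_eq)
    then show "\<bar>t\<bar> \<le> 2 * b" using t0 by simp
    have tm: "t * (1 + r) = 2 - l - k" and dm: "d * (1 + r) = (1 - l) * (1 - r)"
      using r0 by (simp_all add: t' d')
    \<comment> \<open>The characteristic polynomial at \<open>b\<close>, times \<open>1 + r\<close>.
      It vanishes for \<open>l = \<mu>\<close>, so the rate \<open>1 - r\<close> is dictated by the
      smallest admissible eigenvalue.\<close>
    have "(b\<^sup>2 - t * b + d) * (1 + r) = b\<^sup>2 * (1 + r) - t * (1 + r) * b + d * (1 + r)"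
      by (simp add: algebra_simps)
    also have "\<dots> = (1 - r) * (k - r\<^sup>2)" unfolding tm dm by (simp add: b power2_eq_square algebra_simps)
    also have "\<dots> \<ge> 0" using r1 k1 by simp
    finally have "0 \<le> b\<^sup>2 - t * b + d" using r0 by (simp add: zero_le_mult_iff)
    then show "0 \<le> b\<^sup>2 - \<bar>t\<bar> * b + d" using t0 by simp
    show "\<bar>fst (scalar_error a b c l 1)\<bar> \<le> 1" using mu by simp
    show "b \<le> 1" using r0 by (simp add: b)
  qed simp
qed

lemma matrix_add_rdistrib: "(A + B) ** C = A ** C + B ** C" for A :: "real^'n^'m"
  by (simp add: matrix_matrix_mult_def vec_eq_iff distrib_right sum.distrib)

lemma matrix_scaleR_right: "A ** (c *\<^sub>R B) = c *\<^sub>R (A ** B)" for A :: "real^'n^'m"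
  by (simp add: matrix_matrix_mult_def vec_eq_iff sum_distrib_left mult.left_commute)

lemma matrix_scaleR_left: "(c *\<^sub>R A) ** B = c *\<^sub>R (A ** B)" for A :: "real^'n^'m"
  by (simp add: matrix_matrix_mult_def vec_eq_iff sum_distrib_left mult.assoc)

text \<open>Both components are polynomials in \<open>Z\<close> with real coefficients.\<close>

lemma mean_error_symmetric_commute:
  fixes Z :: "real^'n^'n"
  assumes sym: "transpose Z = Z"
  shows "transpose (fst (mean_error a b c Z j)) = fst (mean_error a b c Z j) \<and>
    transpose (snd (mean_error a b c Z j)) = snd (mean_error a b c Z j) \<and>
    Z ** fst (mean_error a b c Z j) = fst (mean_error a b c Z j) ** Z \<and>
    Z ** snd (mean_error a b c Z j) = snd (mean_error a b c Z j) ** Z"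
proof (induction j)
  case (Suc j)
  define E V W where "E = fst (mean_error a b c Z j)" and "V = snd (mean_error a b c Z j)"
    and "W = a *\<^sub>R V + (1 - a) *\<^sub>R E"
  note IH = Suc.IH[folded E_def V_def]
  have W: "transpose W = W" "Z ** W = W ** Z"
    using IH by (simp_all add: W_def transpose_add transpose_scalar matrix_add_ldistrib matrix_add_rdistrib
        matrix_scaleR_left matrix_scaleR_right)
  have ZW: "transpose (Z ** W) = Z ** W" "Z ** (Z ** W) = (Z ** W) ** Z"
    using W sym by (simp_all add: matrix_transpose_mul) (metis matrix_mul_assoc)
  have eq: "mean_error a b c Z (Suc j) = (W - Z ** W, b *\<^sub>R V + (1 - b) *\<^sub>R W - c *\<^sub>R (Z ** W))"
    by (simp add: Let_def E_def V_def W_def)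
  show ?case
    unfolding eq fst_conv snd_conv using IH W ZW
    by (simp add: transpose_add transpose_diff transpose_scalar matrix_add_ldistrib
        matrix_add_rdistrib matrix_diff_ldistrib matrix_diff_rdistrib matrix_scaleR_left matrix_scaleR_right)
qed simp

lemma mean_error_eigenvector:
  fixes Z :: "real^'n^'n"
  assumes "Z *v u = l *\<^sub>R u"
  shows "fst (mean_error a b c Z j) *v u = fst (scalar_error a b c l j) *\<^sub>R u \<and>
    snd (mean_error a b c Z j) *v u = snd (scalar_error a b c l j) *\<^sub>R u"
proof (induction j)
  case (Suc j)
  define E V W where "E = fst (mean_error a b c Z j)" and "V = snd (mean_error a b c Z j)"
    and "W = a *\<^sub>R V + (1 - a) *\<^sub>R E"
  define p q y where "p = fst (scalar_error a b c l j)" and "q = snd (scalar_error a b c l j)"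
    and "y = a * q + (1 - a) * p"
  note IH = Suc.IH[folded E_def V_def p_def q_def]
  have W: "W *v u = y *\<^sub>R u"
    using IH by (simp add: W_def y_def matrix_vector_mult_add_rdistrib algebra_simps flip: scaleR_matrix_vector_assoc)
  have ZW: "(Z ** W) *v u = (l * y) *\<^sub>R u"
    by (simp add: W assms matrix_vector_mult_scaleR flip: matrix_vector_mul_assoc)
  have eq: "mean_error a b c Z (Suc j) = (W - Z ** W, b *\<^sub>R V + (1 - b) *\<^sub>R W - c *\<^sub>R (Z ** W))"
    by (simp add: Let_def E_def V_def W_def)
  have eq': "scalar_error a b c l (Suc j) = ((1 - l) * y, b * q + (1 - b) * y - c * (l * y))"
    by (simp add: Let_def p_def q_def y_def)
  show ?case
    unfolding eq eq' fst_conv snd_conv using IH W ZW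
    by (simp add: matrix_vector_mult_add_rdistrib matrix_vector_mult_diff_rdistrib scaleR_left_diff_distrib
        scaleR_left_distrib left_diff_distrib flip: scaleR_matrix_vector_assoc)
qed simp

text \<open>\<open>Z\<close> is not diagonalised. The squared norm of \<open>E\<close> is the top
  eigenvalue \<open>m\<close> of \<open>E ** E\<close>, and \<open>Z\<close> preserves the
  eigenspace of \<open>m\<close> because it commutes with \<open>E\<close>. An eigenvector of
  \<open>Z\<close> inside that space identifies \<open>m\<close> with the square of a scalar error,
  to which \<open>scalar_error_bound\<close> applies.\<close>

lemma mean_error_bound:
  fixes Z :: "real^'n^'n"
  assumes sym: "transpose Z = Z" and lo: "\<And>u. \<mu> * (u \<bullet> u) \<le> u \<bullet> (Z *v u)" and up: "\<And>u. u \<bullet> (Z *v u) \<le> u \<bullet> u"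
    and mu: "0 < \<mu>" and nu: "1 \<le> \<nu>"
  defines "c \<equiv> 1 / sqrt (\<mu> * \<nu>)"
  defines "a \<equiv> 1 / (1 + c * \<nu>)" and "b \<equiv> 1 - sqrt (\<mu> / \<nu>)"
  shows "norm (fst (mean_error a b c Z (Suc n)) *v e) \<le> 2 * real (Suc n) * b ^ n * norm e"
proof -
  define E where "E = fst (mean_error a b c Z (Suc n))"
  define \<kappa> where "\<kappa> = 2 * real (Suc n) * b ^ n"
  have E: "transpose E = E" "Z ** E = E ** Z"
    unfolding E_def using mean_error_symmetric_commute[OF sym] by blast+
  have ZEE: "Z ** (E ** E) = (E ** E) ** Z" by (metis E(2) matrix_mul_assoc)
  have symEE: "transpose (E ** E) = E ** E" by (simp add: matrix_transpose_mul E)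
  have ne: "(UNIV :: (real^'n) set) \<noteq> {0}"
    by (metis UNIV_I norm_zero singletonD vector_choose_size zero_le_one zero_neq_one)
  obtain u m where u: "norm u = 1" "(E ** E) *v u = m *\<^sub>R u" and max: "\<And>v. v \<bullet> ((E ** E) *v v) \<le> m * (v \<bullet> v)"
    using symmetric_max_eigenvector[OF symEE subspace_UNIV ne] by (metis UNIV_I)
  let ?U = "{v. (E ** E) *v v = m *\<^sub>R v}"
  have U: "subspace ?U"
    by (auto simp: subspace_def matrix_vector_right_distrib scaleR_right_distrib matrix_vector_mult_scaleR)
  have neU: "?U \<noteq> {0}"
  proof -
    have "u \<in> ?U" "u \<noteq> 0" using u by auto
    then show ?thesis by blast
  qed
  have invU: "Z *v v \<in> ?U" if "v \<in> ?U" for v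
  proof -
    have "(E ** E) *v (Z *v v) = Z *v ((E ** E) *v v)"
      by (simp only: matrix_vector_mul_assoc ZEE)
    also have "\<dots> = m *\<^sub>R (Z *v v)" using that by (simp add: matrix_vector_mult_scaleR)
    finally show ?thesis by simp
  qed
  obtain v l where v: "v \<in> ?U" "norm v = 1" "Z *v v = l *\<^sub>R v"
    by (rule symmetric_max_eigenvector[OF sym U neU invU])
  have vv: "v \<bullet> v = 1" using v(2) by (simp add: norm_eq_1)
  have l: "\<mu> \<le> l" "l \<le> 1" using lo[of v] up[of v] v vv by simp_all
  define k where "k = fst (scalar_error a b c l (Suc n))"
  have "E *v v = k *\<^sub>R v" unfolding E_def k_def using mean_error_eigenvector[OF v(3)] by blast
  then have "(E ** E) *v v = k\<^sup>2 *\<^sub>R v"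
    by (simp add: matrix_vector_mult_scaleR power2_eq_square flip: matrix_vector_mul_assoc)
  then have "m = k\<^sup>2" using v by auto
  moreover have "\<bar>k\<bar> \<le> \<kappa>"
    unfolding k_def \<kappa>_def a_def b_def c_def by (rule scalar_error_bound[OF mu l nu])
  ultimately have "m \<le> \<kappa>\<^sup>2" by (metis abs_ge_zero power2_abs power_mono)
  have "(norm (E *v e))\<^sup>2 = e \<bullet> ((E ** E) *v e)"
    by (simp add: power2_norm_eq_inner symmetric_dot[OF E(1)] flip: matrix_vector_mul_assoc)
  also have "\<dots> \<le> m * (e \<bullet> e)" by (rule max)
  also have "\<dots> \<le> \<kappa>\<^sup>2 * (e \<bullet> e)" using \<open>m \<le> \<kappa>\<^sup>2\<close> by (intro mult_right_mono) auto
  also have "\<dots> = (\<kappa> * norm e)\<^sup>2" by (simp add: power_mult_distrib power2_norm_eq_inner)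
  finally have "norm (E *v e) \<le> \<kappa> * norm e"
    by (rule power2_le_imp_le) (use \<open>\<bar>k\<bar> \<le> \<kappa>\<close> in auto)
  then show ?thesis by (simp add: E_def \<kappa>_def)
qed

section \<open>Measurability of matrix operations\<close>

lemma borel_measurable_vec_nth [measurable (raw)]:
  fixes f :: "'a \<Rightarrow> 'b::euclidean_space^'n"
  assumes "f \<in> borel_measurable M"
  shows "(\<lambda>x. f x $ i) \<in> borel_measurable M"
  by (rule borel_measurable_continuous_on[OF _ assms]) (intro continuous_intros)

lemma borel_measurable_vecI:
  fixes f :: "'a \<Rightarrow> 'b::euclidean_space^'n"
  assumes "\<And>i. (\<lambda>x. f x $ i) \<in> borel_measurable M"
  shows "f \<in> borel_measurable M"
proof (subst borel_measurable_euclidean_space, rule ballI)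
  fix b :: "'b^'n" assume "b \<in> Basis"
  then obtain i u where "b = axis i u" by (auto simp: Basis_vec_def)
  then show "(\<lambda>x. f x \<bullet> b) \<in> borel_measurable M" using assms by (simp add: inner_axis)
qed

lemma borel_measurable_matrix_mult [measurable (raw)]:
  fixes f :: "'a \<Rightarrow> real^'n^'m" and g :: "'a \<Rightarrow> real^'k^'n"
  assumes [measurable]: "f \<in> borel_measurable M" "g \<in> borel_measurable M"
  shows "(\<lambda>x. f x ** g x) \<in> borel_measurable M"
  by (intro borel_measurable_vecI) (simp add: matrix_matrix_mult_def)

lemma borel_measurable_matrix_vector_mult [measurable (raw)]:
  fixes f :: "'a \<Rightarrow> real^'n^'m" and g :: "'a \<Rightarrow> real^'n"
  assumes [measurable]: "f \<in> borel_measurable M" "g \<in> borel_measurable M"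
  shows "(\<lambda>x. f x *v g x) \<in> borel_measurable M"
  by (intro borel_measurable_vecI) (simp add: matrix_vector_mult_def)

lemma borel_measurable_transpose [measurable (raw)]:
  fixes f :: "'a \<Rightarrow> real^'n^'m"
  assumes [measurable]: "f \<in> borel_measurable M"
  shows "(\<lambda>x. transpose (f x)) \<in> borel_measurable M"
  by (intro borel_measurable_vecI) (simp add: transpose_def)

lemma borel_measurable_det [measurable (raw)]:
  fixes f :: "'a \<Rightarrow> real^'n^'n"
  assumes [measurable]: "f \<in> borel_measurable M"
  shows "(\<lambda>x. det (f x)) \<in> borel_measurable M"
  unfolding det_def by measurable

text \<open>\<open>matrix_inv\<close> is a choice. At a singular matrix the predicate is
  unsatisfiable, so the value is the one fixed matrix \<open>SOME X. False\<close>; hence the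
  inverse is Borel on all matrices and not only on the invertible ones.\<close>

lemma matrix_inv_cramer:
  fixes A :: "real^'n^'n"
  shows "matrix_inv A = (if det A = 0 then (SOME X. False) else
    (\<chi> i j. det (\<chi> a b. if b = i then axis j 1 $ a else A $ a $ b) / det A))"
proof (cases "det A = 0")
  case True
  then have "(\<lambda>X. A ** X = mat 1 \<and> X ** A = mat 1) = (\<lambda>X. False)"
    using invertible_det_nz[of A] unfolding invertible_def by blast
  then have "matrix_inv A = (SOME X. False)" by (simp only: matrix_inv_def)
  then show ?thesis using True by simp
next
  case False
  then have "invertible A" by (simp add: invertible_det_nz)
  then have "A ** matrix_inv A = mat 1"
    unfolding invertible_def matrix_inv_def by (metis (mono_tags, lifting) someI_ex)
  then have "A *v column j (matrix_inv A) = axis j 1" for j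
    by (metis matrix_vector_mul_assoc matrix_vector_mul_lid matrix_vector_mult_basis)
  then have "column j (matrix_inv A) = (\<chi> k. det (\<chi> a b. if b = k then axis j 1 $ a else A $ a $ b) / det A)" for j
    by (simp add: cramer[OF False])
  then show ?thesis using False by (simp add: vec_eq_iff column_def)
qed

lemma borel_measurable_matrix_inv [measurable (raw)]:
  fixes f :: "'a \<Rightarrow> real^'n^'n"
  assumes [measurable]: "f \<in> borel_measurable M"
  shows "(\<lambda>x. matrix_inv (f x)) \<in> borel_measurable M"
proof -
  have [measurable]: "(\<lambda>x. \<chi> a b. if b = i then axis j 1 $ a else f x $ a $ b) \<in> borel_measurable M" for i j :: 'n
    by (intro borel_measurable_vecI) simp
  have [measurable]: "(\<lambda>x. (\<chi> i j. det (\<chi> a b. if b = i then axis j 1 $ a else f x $ a $ b) / det (f x)) :: real^'n^'n)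
      \<in> borel_measurable M"
    by (intro borel_measurable_vecI) simp
  show ?thesis by (subst matrix_inv_cramer) measurable
qed

lemma tendsto_matrixI:
  fixes f :: "'a \<Rightarrow> real^'n^'m"
  assumes "\<And>v. ((\<lambda>x. f x *v v) \<longlongrightarrow> L *v v) F"
  shows "(f \<longlongrightarrow> L) F"
proof (intro vec_tendstoI)
  fix i j
  have "((\<lambda>x. (f x *v axis j 1) $ i) \<longlongrightarrow> (L *v axis j 1) $ i) F" by (intro tendsto_vec_nth assms)
  then show "((\<lambda>x. f x $ i $ j) \<longlongrightarrow> L $ i $ j) F" by (simp add: matrix_vector_mult_basis column_def)
qed

text \<open>Tikhonov regularisation. The pseudoinverse is discontinuous, but as a pointwise limit of
  these regularised inverses it is Borel.\<close>

lemma pinv_tendsto: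
  fixes A :: "real^'n^'m"
  shows "(\<lambda>n. matrix_inv (transpose A ** A + (1 / real (Suc n)) *\<^sub>R mat 1) ** transpose A) \<longlonglongrightarrow> pinv A"
proof (rule tendsto_matrixI)
  fix v :: "real^'m"
  define M where "M = transpose A ** A"
  let ?G = "pinv M"
  have sM: "transpose M = M" by (simp add: M_def transpose_gram)
  note P = pinv_symmetric(1)[OF sM, unfolded is_pinv_def]
  have sG: "transpose ?G = ?G" by (rule pinv_symmetric(2)[OF sM])
  have GM: "?G ** M = M ** ?G" using P sM sG by (metis matrix_transpose_mul)
  define x where "x = pinv A *v v"
  \<comment> \<open>A vector with \<open>x = M w\<close>. For \<open>N = M + e I\<close>, writing
    \<open>x\<close> and then \<open>w\<close> through \<open>N\<close> turns the error into
    \<open>e (w - e N^-1 w)\<close> up to sign, where the bound \<open>1 / e\<close> on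
    \<open>N^-1\<close> is compensated.\<close>
  define w where "w = ?G *v (?G *v (transpose A *v v))"
  have X: "pinv A = ?G ** transpose A" unfolding M_def by (rule pinv_gram(2))
  have x_eq: "x = ?G *v (transpose A *v v)" unfolding x_def X by (simp only: matrix_vector_mul_assoc)
  have "M *v w = (M ** ?G ** ?G) *v (transpose A *v v)" by (simp only: w_def matrix_vector_mul_assoc matrix_mul_assoc)
  also have "M ** ?G ** ?G = ?G" using P GM by (metis matrix_mul_assoc)
  finally have xw: "x = M *v w" by (simp only: x_eq)
  have Ax: "transpose A *v v = M *v x"
  proof -
    have "transpose (A ** ?G ** M) = transpose A" using pinv_gram(1)[of A] by (simp add: M_def)
    then have "M ** ?G ** transpose A = transpose A" by (simp add: matrix_transpose_mul sM sG matrix_mul_assoc)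
    then show ?thesis unfolding x_eq by (simp only: matrix_vector_mul_assoc matrix_mul_assoc)
  qed
  have psd: "0 \<le> a \<bullet> (M *v a)" for a
    using dot_matrix_vector[of A a "A *v a"] by (simp only: M_def matrix_vector_mul_assoc[symmetric]) (metis inner_ge_zero)
  have bound: "norm (matrix_inv (M + e *\<^sub>R mat 1) *v (transpose A *v v) - x) \<le> e * (2 * norm w)" if e: "0 < e" for e
  proof -
    let ?N = "M + e *\<^sub>R mat 1"
    have N: "?N *v a = M *v a + e *\<^sub>R a" for a
      by (simp add: matrix_vector_mult_add_rdistrib flip: scaleR_matrix_vector_assoc)
    have lo: "e * (a \<bullet> a) \<le> a \<bullet> (?N *v a)" for a using psd[of a] by (simp add: N inner_add_right)
    note inv = form_bounds_matrix_inv[OF lo e]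
    have iN: "matrix_inv ?N *v (?N *v a) = a" for a using inv(2) by (simp add: matrix_vector_mul_assoc)
    have "matrix_inv ?N *v (transpose A *v v) = matrix_inv ?N *v (?N *v x - e *\<^sub>R x)" by (simp only: Ax N add_diff_cancel_right')
    also have "\<dots> = x - e *\<^sub>R (matrix_inv ?N *v x)" by (simp only: matrix_vector_mult_diff_distrib matrix_vector_mult_scaleR iN)
    also have "matrix_inv ?N *v x = matrix_inv ?N *v (?N *v w - e *\<^sub>R w)" by (simp only: xw N add_diff_cancel_right')
    also have "\<dots> = w - e *\<^sub>R (matrix_inv ?N *v w)" by (simp only: matrix_vector_mult_diff_distrib matrix_vector_mult_scaleR iN)
    finally have "norm (matrix_inv ?N *v (transpose A *v v) - x) = e * norm (w - e *\<^sub>R (matrix_inv ?N *v w))"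
      using e by simp
    also have "\<dots> \<le> e * (norm w + e * norm (matrix_inv ?N *v w))"
      using e norm_triangle_ineq4[of w "e *\<^sub>R (matrix_inv ?N *v w)"] by simp
    also have "\<dots> \<le> e * (2 * norm w)"
      using inv(3)[of w] e by (simp add: field_simps)
    finally show ?thesis .
  qed
  have "(\<lambda>n. matrix_inv (M + (1 / real (Suc n)) *\<^sub>R mat 1) *v (transpose A *v v) - x) \<longlonglongrightarrow> 0"
  proof (rule Lim_null_comparison)
    show "\<forall>\<^sub>F n in sequentially. norm (matrix_inv (M + (1 / real (Suc n)) *\<^sub>R mat 1) *v (transpose A *v v) - x)
        \<le> (1 / real (Suc n)) * (2 * norm w)"
      by (intro always_eventually allI bound) simp
    show "(\<lambda>n. (1 / real (Suc n)) * (2 * norm w)) \<longlonglongrightarrow> 0"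
      by (intro tendsto_mult_left_zero) (rule LIMSEQ_Suc[OF lim_1_over_n])
  qed
  then have "(\<lambda>n. matrix_inv (M + (1 / real (Suc n)) *\<^sub>R mat 1) *v (transpose A *v v)) \<longlonglongrightarrow> x"
    by (simp only: LIM_zero_iff)
  then show "(\<lambda>n. (matrix_inv (transpose A ** A + (1 / real (Suc n)) *\<^sub>R mat 1) ** transpose A) *v v) \<longlonglongrightarrow> pinv A *v v"
    by (simp only: x_def M_def matrix_vector_mul_assoc)
qed

lemma borel_measurable_pinv [measurable (raw)]:
  fixes f :: "'a \<Rightarrow> real^'n^'m"
  assumes [measurable]: "f \<in> borel_measurable M"
  shows "(\<lambda>x. pinv (f x)) \<in> borel_measurable M"
  by (rule borel_measurable_LIMSEQ_metric[OF _ pinv_tendsto]) measurable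

lemma borel_measurable_sketch_step [measurable (raw)]:
  fixes f :: "'a \<Rightarrow> real^'d^'d" and g :: "'a \<Rightarrow> real^'s^'d"
  assumes [measurable]: "f \<in> borel_measurable M" "g \<in> borel_measurable M"
  shows "(\<lambda>x. sketch_step (f x) (g x)) \<in> borel_measurable M"
  unfolding sketch_step_def by measurable

lemma borel_measurable_sketch_proj [measurable (raw)]:
  fixes f :: "'a \<Rightarrow> real^'d^'d" and g :: "'a \<Rightarrow> real^'s^'d"
  assumes [measurable]: "f \<in> borel_measurable M" "g \<in> borel_measurable M"
  shows "(\<lambda>x. sketch_proj (f x) (g x)) \<in> borel_measurable M"
  unfolding sketch_proj_def by measurable

text \<open>By continuity the vectors that qualify form an open set, so there is one exactly if
  there is one in the dense set \<open>C\<close>. With \<open>C\<close> countable, exceeding a level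
  becomes a countable condition.\<close>

lemma ex_gt_iff_countable_dense:
  fixes p q :: "'a::topological_space \<Rightarrow> real"
  assumes "continuous_on U p" "continuous_on U q" "open U"
    and dense: "\<And>X. open X \<Longrightarrow> X \<noteq> {} \<Longrightarrow> \<exists>d\<in>C. d \<in> X"
  shows "(\<exists>a\<in>U. q a \<noteq> 0 \<and> c < p a / q a) \<longleftrightarrow> (\<exists>a\<in>C \<inter> U. q a \<noteq> 0 \<and> c < p a / q a)"
proof
  assume "\<exists>a\<in>U. q a \<noteq> 0 \<and> c < p a / q a"
  then obtain a where a: "a \<in> U" "q a \<noteq> 0" "c < p a / q a" by blast
  let ?V = "U \<inter> q -` (- {0})"
  have V: "open ?V" by (rule continuous_open_preimage[OF assms(2,3)]) auto
  have "continuous_on ?V (\<lambda>a. p a / q a)"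
    using assms by (intro continuous_intros continuous_on_subset[OF assms(1)] continuous_on_subset[OF assms(2)]) auto
  then have "open (?V \<inter> (\<lambda>a. p a / q a) -` {c<..})" using V
    by (rule continuous_open_preimage) auto
  moreover have "a \<in> ?V \<inter> (\<lambda>a. p a / q a) -` {c<..}" using a by auto
  ultimately obtain d where "d \<in> C" "d \<in> ?V \<inter> (\<lambda>a. p a / q a) -` {c<..}" using dense by blast
  then show "\<exists>a\<in>C \<inter> U. q a \<noteq> 0 \<and> c < p a / q a" by auto
qed blast

lemma quadratic_form_continuous [continuous_intros]:
  "continuous_on U (\<lambda>a. a \<bullet> (A *v a))" for A :: "real^'n^'n"
  by (intro continuous_intros linear_continuous_on matrix_vector_mul_bounded_linear)

text \<open>Vanishing is not an open condition, so density is applied to the strict inequalities on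
  the right; compactness of the unit sphere recovers an exact zero from the approximate
  ones.\<close>

lemma ex_isotropic_iff:
  fixes A :: "real^'n^'n"
  assumes dense: "\<And>X. open X \<Longrightarrow> X \<noteq> {} \<Longrightarrow> \<exists>d\<in>C. d \<in> X"
  shows "(\<exists>a\<in>-{0}. a \<bullet> (A *v a) = 0) \<longleftrightarrow> (\<forall>n. \<exists>a\<in>C \<inter> -{0}. \<bar>a \<bullet> (A *v a)\<bar> < (a \<bullet> a) / real (Suc n))"
    (is "?L \<longleftrightarrow> ?R")
proof
  assume ?L
  then obtain a where a: "a \<noteq> 0" "a \<bullet> (A *v a) = 0" by auto
  show ?R
  proof
    fix n
    let ?V = "- {0} \<inter> {b. \<bar>b \<bullet> (A *v b)\<bar> < (b \<bullet> b) / real (Suc n)}"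
    have "open ?V"
      by (intro open_Int open_Collect_less continuous_intros) auto
    moreover have "a \<in> ?V" using a by simp
    ultimately obtain d where "d \<in> C" "d \<in> ?V" using dense by blast
    then show "\<exists>a\<in>C \<inter> -{0}. \<bar>a \<bullet> (A *v a)\<bar> < (a \<bullet> a) / real (Suc n)" by auto
  qed
next
  assume R: ?R
  have "continuous_on (sphere 0 1) (\<lambda>a. \<bar>a \<bullet> (A *v a)\<bar>)" by (intro continuous_intros)
  moreover have "sphere (0::real^'n) 1 \<noteq> {}" by simp
  ultimately obtain b where b: "b \<in> sphere 0 1" and min: "\<And>a. a \<in> sphere 0 1 \<Longrightarrow> \<bar>b \<bullet> (A *v b)\<bar> \<le> \<bar>a \<bullet> (A *v a)\<bar>"
    using continuous_attains_inf[OF compact_sphere] by blast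
  have "\<bar>b \<bullet> (A *v b)\<bar> \<le> 0"
  proof (rule LIMSEQ_le_const[OF LIMSEQ_Suc[OF lim_1_over_n]], intro exI allI impI)
    fix n :: nat
    obtain a where a: "a \<noteq> 0" "\<bar>a \<bullet> (A *v a)\<bar> < (a \<bullet> a) / real (Suc n)" using R by blast
    let ?u = "inverse (norm a) *\<^sub>R a"
    have "\<bar>b \<bullet> (A *v b)\<bar> \<le> \<bar>?u \<bullet> (A *v ?u)\<bar>" using a by (intro min) simp
    also have "\<dots> = \<bar>a \<bullet> (A *v a)\<bar> / (a \<bullet> a)"
      by (simp add: matrix_vector_mult_scaleR abs_mult flip: power2_norm_eq_inner)
        (simp add: power2_eq_square divide_simps)
    also have "\<dots> \<le> 1 / real (Suc n)"
      using a by (simp add: divide_simps)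
    finally show "\<bar>b \<bullet> (A *v b)\<bar> \<le> 1 / real (Suc n)" .
  qed
  then show ?L using b by (intro bexI[of _ b]) auto
qed

text \<open>Where \<open>Z\<close> is not definite the quotients with vanishing denominator contribute \<open>0\<close>, and an
  unbounded set of quotients has a fixed unspecified supremum; both are Borel conditions.\<close>

lemma borel_measurable_sketch_nu [measurable (raw)]:
  fixes f g :: "'a \<Rightarrow> real^'n^'n"
  assumes [measurable]: "f \<in> borel_measurable M" "g \<in> borel_measurable M"
  shows "(\<lambda>x. sketch_nu (f x) (g x)) \<in> borel_measurable M"
proof -
  obtain C :: "(real^'n) set" where C: "countable C" and dense: "\<And>X. open X \<Longrightarrow> X \<noteq> {} \<Longrightarrow> \<exists>d\<in>C. d \<in> X"
    using countable_dense_setE by blast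
  have [simp]: "countable (C \<inter> - {0})" using C by auto
  let ?q = "\<lambda>x a. (a \<bullet> (g x *v a)) / (a \<bullet> (f x *v a))"
  define G where "G x c \<longleftrightarrow> (\<exists>a\<in>-{0}. c < ?q x a)" for x c
  have G_iff: "G x c \<longleftrightarrow> (\<exists>a\<in>C \<inter> -{0}. a \<bullet> (f x *v a) \<noteq> 0 \<and> c < ?q x a) \<or>
      c < 0 \<and> (\<forall>n. \<exists>a\<in>C \<inter> -{0}. \<bar>a \<bullet> (f x *v a)\<bar> < (a \<bullet> a) / real (Suc n))" for x c
  proof -
    have "G x c \<longleftrightarrow> (\<exists>a\<in>-{0}. a \<bullet> (f x *v a) \<noteq> 0 \<and> c < ?q x a) \<or> c < 0 \<and> (\<exists>a\<in>-{0}. a \<bullet> (f x *v a) = 0)"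
      unfolding G_def by (metis div_by_0)
    also have "(\<exists>a\<in>-{0}. a \<bullet> (f x *v a) \<noteq> 0 \<and> c < ?q x a) \<longleftrightarrow> (\<exists>a\<in>C \<inter> -{0}. a \<bullet> (f x *v a) \<noteq> 0 \<and> c < ?q x a)"
      by (rule ex_gt_iff_countable_dense) (auto intro!: continuous_intros dense)
    also have "(\<exists>a\<in>-{0}. a \<bullet> (f x *v a) = 0) \<longleftrightarrow> (\<forall>n. \<exists>a\<in>C \<inter> -{0}. \<bar>a \<bullet> (f x *v a)\<bar> < (a \<bullet> a) / real (Suc n))"
      by (rule ex_isotropic_iff[OF dense])
    finally show ?thesis .
  qed
  have [measurable]: "Measurable.pred M (\<lambda>x. G x c)" for c
    unfolding G_iff using C by (intro pred_intros_logic pred_intros_countable_bounded pred_intros_countable) measurable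
  have ne: "?q x ` (- {0}) \<noteq> {}" for x
  proof -
    obtain u :: "real^'n" where "norm u = 1" using vector_choose_size[of 1] by auto
    then have "u \<in> - {0}" by auto
    then show ?thesis by blast
  qed
  define k where "k = (THE z::real. False)"
  \<comment> \<open>Boundedness is tested against natural numbers only, which keeps the case
    distinction countable.\<close>
  have nu: "sketch_nu (f x) (g x) \<le> c \<longleftrightarrow> (if \<exists>n::nat. \<not> G x (real n) then \<not> G x c else k \<le> c)" for x c
  proof (cases "\<exists>n::nat. \<not> G x (real n)")
    case True
    then obtain n :: nat where "\<And>a. a \<in> - {0} \<Longrightarrow> ?q x a \<le> real n" unfolding G_def by (meson not_less)
    then have "bdd_above (?q x ` (- {0}))" by (intro bdd_aboveI2[of _ _ "real n"])
    then show ?thesis using True ne[of x] unfolding sketch_nu_def G_def by (auto simp: cSup_le_iff not_less)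
  next
    case False
    have nb: "\<not> (\<forall>y\<in>?q x ` (- {0}). y \<le> z)" for z
    proof -
      obtain n :: nat where "z \<le> real n" using real_arch_simple by blast
      then show ?thesis using False unfolding G_def by (meson imageI less_le_trans not_le order.strict_trans1)
    qed
    then have "sketch_nu (f x) (g x) = k"
      unfolding sketch_nu_def Sup_real_def Least_def k_def by (simp only: nb simp_thms)
    then show ?thesis using False by simp
  qed
  have "{x \<in> space M. sketch_nu (f x) (g x) \<le> c} \<in> sets M" for c
    unfolding nu by measurable
  then show ?thesis by (simp add: borel_measurable_iff_le)
qed

text \<open>An infimum is minus the supremum of the negated quotients, and \<open>mat 1\<close>
  supplies their denominator; so the measurability of \<open>sketch_nu\<close> covers
  \<open>sketch_mu\<close> as well.\<close>

lemma sketch_mu_eq_nu: "sketch_mu Z = - sketch_nu (mat 1) (- Z)"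
  unfolding sketch_mu_def sketch_nu_def Inf_real_def image_image
  by (simp add: uminus_matrix_vector)

lemma borel_measurable_sketch_mu [measurable (raw)]:
  fixes f :: "'a \<Rightarrow> real^'n^'n"
  assumes [measurable]: "f \<in> borel_measurable M"
  shows "(\<lambda>x. sketch_mu (f x)) \<in> borel_measurable M"
  unfolding sketch_mu_eq_nu by measurable

section \<open>Curvature bounds\<close>

text \<open>\<open>grad\<close> is a definite description, so the vector representing the derivative
  has to be shown to exist, by expansion in the standard basis, and to be unique.\<close>

lemma has_derivative_grad:
  fixes f :: "'a::euclidean_space \<Rightarrow> real"
  assumes "f differentiable (at x)"
  shows "(f has_derivative (\<lambda>h. h \<bullet> grad f x)) (at x)"
proof -
  obtain L where L: "(f has_derivative L) (at x)" using assms unfolding differentiable_def by blast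
  interpret bounded_linear L using L by (rule has_derivative_bounded_linear)
  define D where "D = (\<Sum>b\<in>Basis. L b *\<^sub>R b)"
  have "L h = h \<bullet> D" for h
  proof -
    have "L h = L (\<Sum>b\<in>Basis. (h \<bullet> b) *\<^sub>R b)" by (simp add: euclidean_representation)
    also have "\<dots> = h \<bullet> D" by (simp add: sum scaleR D_def inner_sum_right mult.commute)
    finally show ?thesis .
  qed
  then have "L = (\<lambda>h. h \<bullet> D)" by blast
  then have D: "GDERIV f x :> D" using L by (simp add: gderiv_def)
  have "D' = D" if "GDERIV f x :> D'" for D'
  proof -
    have "(\<lambda>h. h \<bullet> D') = (\<lambda>h. h \<bullet> D)" using that D unfolding gderiv_def by (rule has_derivative_unique)
    then have "(D' - D) \<bullet> D' = (D' - D) \<bullet> D" by meson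
    then have "(D' - D) \<bullet> (D' - D) = 0" by (simp only: inner_diff_right)
    then show ?thesis by simp
  qed
  then have "grad f x = D" unfolding grad_def using D by blast
  then show ?thesis using D by (simp add: gderiv_def)
qed

lemma twice_continuously_differentiableD:
  assumes "twice_continuously_differentiable f"
  shows "(f has_derivative (\<lambda>h. h \<bullet> grad f x)) (at x)"
    and "(grad f has_derivative (\<lambda>h. hessian f x *v h)) (at x)"
proof -
  show "(f has_derivative (\<lambda>h. h \<bullet> grad f x)) (at x)"
    using assms by (intro has_derivative_grad) (simp add: twice_continuously_differentiable_def differentiable_on_def)
  show "(grad f has_derivative (\<lambda>h. hessian f x *v h)) (at x)"
    using assms jacobian_works[of "grad f" "at x"]
    by (simp add: twice_continuously_differentiable_def differentiable_on_def hessian_def)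
qed

lemma has_real_derivative_along_line:
  fixes f :: "'a::real_inner \<Rightarrow> real"
  assumes "(f has_derivative (\<lambda>h. h \<bullet> g)) (at (x + r *\<^sub>R u))"
  shows "((\<lambda>r. f (x + r *\<^sub>R u)) has_real_derivative u \<bullet> g) (at r)"
proof -
  have "((\<lambda>r. x + r *\<^sub>R u) has_derivative (\<lambda>h. h *\<^sub>R u)) (at r)"
    by (auto intro!: derivative_eq_intros)
  from has_derivative_compose[OF this assms] show ?thesis
    by (simp add: has_field_derivative_def mult.commute[of _ "u \<bullet> g"])
qed

text \<open>The mean value theorem in direction \<open>u\<close>, applied to the increment of
  \<open>f\<close> in direction \<open>v\<close>, leaves a difference of two gradients, which is
  expanded to first order at \<open>x\<close>.\<close>

lemma second_difference_bound:
  fixes f :: "'a::real_inner \<Rightarrow> real" and G H :: "'a \<Rightarrow> 'a"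
  assumes G: "\<And>y. (f has_derivative (\<lambda>h. h \<bullet> G y)) (at y)" and H: "(G has_derivative H) (at x)" and e: "0 < e"
  shows "\<exists>d>0. \<forall>s. 0 < s \<and> s < d \<longrightarrow>
    \<bar>f (x + s *\<^sub>R u + s *\<^sub>R v) - f (x + s *\<^sub>R u) - f (x + s *\<^sub>R v) + f x - s\<^sup>2 * (u \<bullet> H v)\<bar>
      \<le> s\<^sup>2 * (2 * e * (norm u + norm v)\<^sup>2)"
proof -
  interpret bounded_linear H using H by (rule has_derivative_bounded_linear)
  obtain d where d: "d > 0" and dH: "\<And>h. norm h < d \<Longrightarrow> norm (G (x + h) - G x - H h) \<le> e * norm h"
  proof -
    from H e obtain d where "d > 0" "\<And>y. norm (y - x) < d \<Longrightarrow> norm (G y - G x - H (y - x)) \<le> e * norm (y - x)"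
      unfolding has_derivative_at_alt by blast
    then show thesis using that[of d] by (metis add_diff_cancel_left')
  qed
  let ?n = "norm u + norm v"
  define d' where "d' = d / (?n + 1)"
  have n0: "0 < ?n + 1" by (simp add: add_nonneg_pos)
  have "0 < d'" using d n0 by (simp add: d'_def)
  moreover have "\<bar>f (x + s *\<^sub>R u + s *\<^sub>R v) - f (x + s *\<^sub>R u) - f (x + s *\<^sub>R v) + f x - s\<^sup>2 * (u \<bullet> H v)\<bar>
      \<le> s\<^sup>2 * (2 * e * ?n\<^sup>2)" if s: "0 < s" "s < d'" for s
  proof -
    have sn: "s * ?n < d"
    proof -
      have "s * ?n \<le> s * (?n + 1)" using s by simp
      also have "\<dots> < d" using s n0 by (simp add: d'_def pos_less_divide_eq)
      finally show ?thesis .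
    qed
    let ?\<phi> = "\<lambda>r. f ((x + s *\<^sub>R v) + r *\<^sub>R u) - f (x + r *\<^sub>R u)"
    let ?\<phi>' = "\<lambda>r. u \<bullet> G ((x + s *\<^sub>R v) + r *\<^sub>R u) - u \<bullet> G (x + r *\<^sub>R u)"
    have "(?\<phi> has_real_derivative ?\<phi>' r) (at r)" for r
      by (intro DERIV_diff has_real_derivative_along_line G)
    then obtain r where r: "0 < r" "r < s" "?\<phi> s - ?\<phi> 0 = (s - 0) * ?\<phi>' r"
      using MVT2[OF s(1), of ?\<phi> ?\<phi>'] by blast
    define a where "a = G (x + (s *\<^sub>R v + r *\<^sub>R u)) - G x - H (s *\<^sub>R v + r *\<^sub>R u)"
    define b where "b = G (x + r *\<^sub>R u) - G x - H (r *\<^sub>R u)"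
    have n1: "norm (s *\<^sub>R v + r *\<^sub>R u) \<le> s * ?n"
    proof -
      have "norm (s *\<^sub>R v + r *\<^sub>R u) \<le> s * norm v + r * norm u"
        using norm_triangle_ineq[of "s *\<^sub>R v" "r *\<^sub>R u"] s r by simp
      also have "\<dots> \<le> s * norm v + s * norm u" using r by (intro add_left_mono mult_right_mono) auto
      finally show ?thesis by (simp add: algebra_simps)
    qed
    have n2: "norm (r *\<^sub>R u) \<le> s * ?n"
    proof -
      have "norm (r *\<^sub>R u) \<le> s * norm u" using r by (simp add: mult_right_mono)
      also have "\<dots> \<le> s * ?n" using s by (intro mult_left_mono) auto
      finally show ?thesis .
    qed
    have na: "norm a \<le> e * (s * ?n)"
      unfolding a_def using n1 sn e by (intro order_trans[OF dH] mult_left_mono) auto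
    have nb: "norm b \<le> e * (s * ?n)"
      unfolding b_def using n2 sn e by (intro order_trans[OF dH] mult_left_mono) auto
    have \<phi>': "?\<phi>' r = u \<bullet> (a - b) + s * (u \<bullet> H v)"
      by (simp add: a_def b_def add scaleR inner_diff_right inner_add_right algebra_simps)
    have "?\<phi> s - ?\<phi> 0 - s\<^sup>2 * (u \<bullet> H v) = s * (u \<bullet> (a - b))"
      unfolding r(3) \<phi>' by (simp add: power2_eq_square algebra_simps)
    also have "\<bar>\<dots>\<bar> \<le> s * (?n * (2 * (e * (s * ?n))))"
    proof -
      have "\<bar>u \<bullet> (a - b)\<bar> \<le> norm u * norm (a - b)" by (rule Cauchy_Schwarz_ineq2)
      also have "\<dots> \<le> ?n * (2 * (e * (s * ?n)))"
        using na nb norm_triangle_ineq4[of a b] by (intro mult_mono) auto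
      finally show ?thesis using s by (simp add: abs_mult)
    qed
    finally show ?thesis by (simp add: power2_eq_square algebra_simps)
  qed
  ultimately show ?thesis by blast
qed

text \<open>The second difference is symmetric in \<open>u\<close> and \<open>v\<close>, so after
  division by \<open>s^2\<close> both orders approximate the same number.\<close>

lemma second_derivative_symmetric:
  fixes f :: "'a::real_inner \<Rightarrow> real" and G H :: "'a \<Rightarrow> 'a"
  assumes G: "\<And>y. (f has_derivative (\<lambda>h. h \<bullet> G y)) (at y)" and H: "(G has_derivative H) (at x)"
  shows "u \<bullet> H v = v \<bullet> H u"
proof -
  let ?n = "(norm u + norm v)\<^sup>2"
  have "\<bar>u \<bullet> H v - v \<bullet> H u\<bar> \<le> e" if e: "0 < e" for e
  proof -
    \<comment> \<open>\<open>q\<close> is four times \<open>e'\<close> because two errors of size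
      \<open>2 * e'\<close> add up; the summand 1 avoids a vanishing denominator when
      \<open>u\<close> and \<open>v\<close> are zero.\<close>
    define q where "q = e / (?n + 1)"
    define e' where "e' = q / 4"
    have n0: "0 < ?n + 1" by (simp add: add_nonneg_pos)
    have e': "0 < e'" using e n0 by (simp add: e'_def q_def)
    let ?D = "\<lambda>s. f (x + s *\<^sub>R u + s *\<^sub>R v) - f (x + s *\<^sub>R u) - f (x + s *\<^sub>R v) + f x"
    obtain d where d: "d > 0" "\<And>s. 0 < s \<and> s < d \<Longrightarrow> \<bar>?D s - s\<^sup>2 * (u \<bullet> H v)\<bar> \<le> s\<^sup>2 * (2 * e' * ?n)"
      using second_difference_bound[OF G H e', of u v] by blast
    obtain c where c: "c > 0" "\<And>s. 0 < s \<and> s < c \<Longrightarrow>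
        \<bar>f (x + s *\<^sub>R v + s *\<^sub>R u) - f (x + s *\<^sub>R v) - f (x + s *\<^sub>R u) + f x - s\<^sup>2 * (v \<bullet> H u)\<bar> \<le> s\<^sup>2 * (2 * e' * (norm v + norm u)\<^sup>2)"
      using second_difference_bound[OF G H e', of v u] by blast
    define s where "s = min c d / 2"
    have s: "0 < s" "s < d" "s < c" using d c by (auto simp: s_def)
    have 1: "\<bar>?D s - s\<^sup>2 * (v \<bullet> H u)\<bar> \<le> s\<^sup>2 * (2 * e' * ?n)"
      using c(2)[of s] s by (simp add: add.commute[of "norm v"] algebra_simps)
    have 2: "\<bar>?D s - s\<^sup>2 * (u \<bullet> H v)\<bar> \<le> s\<^sup>2 * (2 * e' * ?n)" using d(2)[of s] s by simp
    have "s\<^sup>2 * \<bar>u \<bullet> H v - v \<bullet> H u\<bar> = \<bar>s\<^sup>2 * (u \<bullet> H v) - s\<^sup>2 * (v \<bullet> H u)\<bar>"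
      by (simp add: abs_mult flip: right_diff_distrib)
    also have "\<dots> \<le> s\<^sup>2 * (4 * e' * ?n)" using 1 2 by linarith
    finally have "\<bar>u \<bullet> H v - v \<bullet> H u\<bar> \<le> q * ?n" using s by (simp add: e'_def)
    also have "\<dots> = e * (?n / (?n + 1))" by (simp add: e'_def q_def)
    also have "\<dots> \<le> e" using n0 e by (simp add: pos_divide_le_eq distrib_left)
    finally show ?thesis .
  qed
  then have "\<bar>u \<bullet> H v - v \<bullet> H u\<bar> \<le> 0" by (rule field_le_epsilon[of _ 0, simplified])
  then show ?thesis by simp
qed

lemma hessian_symmetric:
  assumes "twice_continuously_differentiable f"
  shows "transpose (hessian f x) = hessian f x"
proof -
  let ?H = "hessian f x"
  have "u \<bullet> (transpose ?H *v v) = u \<bullet> (?H *v v)" for u v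
    using second_derivative_symmetric[OF twice_continuously_differentiableD(1)[OF assms]
        twice_continuously_differentiableD(2)[OF assms, of x], of u v]
      dot_matrix_vector[of ?H u v] by (simp add: inner_commute)
  then have "transpose ?H *v v = ?H *v v" for v using vector_eq_ldot by blast
  then show ?thesis by (simp add: matrix_eq)
qed

text \<open>The mean value theorem is used twice along the segment. The sign of
  \<open>\<kappa>\<close> is free: the lower curvature bound of a realization and, through its
  negative, the upper bound both come from here.\<close>

lemma gradient_inequality:
  fixes f :: "real^'n \<Rightarrow> real"
  assumes G: "\<And>y. (f has_derivative (\<lambda>h. h \<bullet> G y)) (at y)"
    and H: "\<And>y. (G has_derivative (\<lambda>h. H y *v h)) (at y)"
    and curv: "\<And>y h. \<kappa> * (h \<bullet> h) \<le> h \<bullet> (H y *v h)"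
  shows "f u + (w - u) \<bullet> G u + \<kappa> / 2 * (norm (w - u))\<^sup>2 \<le> f w"
proof -
  define d where "d = w - u"
  define k where "k = \<kappa> * (d \<bullet> d)"
  have slope: "k * r \<le> d \<bullet> G (u + r *\<^sub>R d) - d \<bullet> G u" if "0 \<le> r" for r
  proof (cases "r = 0")
    case False
    have deriv: "((\<lambda>r. d \<bullet> G (u + r *\<^sub>R d)) has_real_derivative d \<bullet> (H (u + s *\<^sub>R d) *v d)) (at s)" for s
    proof -
      have "((\<lambda>r. u + r *\<^sub>R d) has_derivative (\<lambda>h. h *\<^sub>R d)) (at s)"
        by (auto intro!: derivative_eq_intros)
      from has_derivative_inner_right[OF has_derivative_compose[OF this H], of d] show ?thesis
        by (simp add: has_field_derivative_def matrix_vector_mult_scaleR mult.commute[of _ "d \<bullet> _"])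
    qed
    have "0 < r" using that False by simp
    then obtain s where "d \<bullet> G (u + r *\<^sub>R d) - d \<bullet> G (u + 0 *\<^sub>R d) = (r - 0) * (d \<bullet> (H (u + s *\<^sub>R d) *v d))"
      using MVT2[of 0 r "\<lambda>r. d \<bullet> G (u + r *\<^sub>R d)" "\<lambda>s. d \<bullet> (H (u + s *\<^sub>R d) *v d)"] deriv by auto
    then show ?thesis using curv[of d "u + s *\<^sub>R d"] that by (simp add: k_def mult.commute mult_left_mono)
  qed simp
  let ?\<psi> = "\<lambda>r. f (u + r *\<^sub>R d) - r * (d \<bullet> G u) - k / 2 * r\<^sup>2"
  have "(?\<psi> has_real_derivative (d \<bullet> G (u + r *\<^sub>R d) - d \<bullet> G u - k * r)) (at r)" for r
    by (auto intro!: derivative_eq_intros has_real_derivative_along_line G)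
  from MVT2[of 0 1 ?\<psi>, OF _ this] obtain r where "0 < r" "?\<psi> 1 - ?\<psi> 0 = d \<bullet> G (u + r *\<^sub>R d) - d \<bullet> G u - k * r" by auto
  then have "0 \<le> ?\<psi> 1 - ?\<psi> 0" using slope[of r] by simp
  then show ?thesis by (simp add: d_def k_def power2_norm_eq_inner)
qed

text \<open>The derivative-free form of a lower bound \<open>\<kappa>\<close> on the curvature: unlike the Hessian bound it
  passes to integrals over a parameter without differentiation under the integral sign.\<close>

definition curvature_ge :: "real \<Rightarrow> ('a::real_normed_vector \<Rightarrow> real) \<Rightarrow> bool" where
  "curvature_ge \<kappa> f \<longleftrightarrow> (\<forall>u w \<theta>. 0 \<le> \<theta> \<and> \<theta> \<le> 1 \<longrightarrow>
     f ((1 - \<theta>) *\<^sub>R u + \<theta> *\<^sub>R w) \<le> (1 - \<theta>) * f u + \<theta> * f w - \<kappa> / 2 * (\<theta> * (1 - \<theta>)) * (norm (u - w))\<^sup>2)"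

text \<open>Expand around the intermediate point \<open>m\<close> towards both ends and average with
  weights \<open>1 - \<theta>\<close> and \<open>\<theta>\<close>: the gradient terms
  cancel.\<close>

lemma curvature_geI:
  fixes f :: "'a::real_inner \<Rightarrow> real"
  assumes "\<And>u w. f u + (w - u) \<bullet> G u + \<kappa> / 2 * (norm (w - u))\<^sup>2 \<le> f w"
  shows "curvature_ge \<kappa> f"
  unfolding curvature_ge_def
proof (intro allI impI)
  fix u w :: 'a and \<theta> :: real assume \<theta>: "0 \<le> \<theta> \<and> \<theta> \<le> 1"
  define m where "m = (1 - \<theta>) *\<^sub>R u + \<theta> *\<^sub>R w"
  let ?n = "(norm (u - w))\<^sup>2" and ?p = "(u - w) \<bullet> G m"
  have um: "u - m = \<theta> *\<^sub>R (u - w)" and wm: "w - m = - ((1 - \<theta>) *\<^sub>R (u - w))"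
    by (simp_all add: m_def algebra_simps)
  have "f m + \<theta> * ?p + \<kappa> / 2 * (\<theta>\<^sup>2 * ?n) \<le> f u"
    using assms[of m u] \<theta> by (simp add: um power_mult_distrib)
  then have "(1 - \<theta>) * (f m + \<theta> * ?p + \<kappa> / 2 * (\<theta>\<^sup>2 * ?n)) \<le> (1 - \<theta>) * f u"
    using \<theta> by (intro mult_left_mono) auto
  moreover have "f m - (1 - \<theta>) * ?p + \<kappa> / 2 * ((1 - \<theta>)\<^sup>2 * ?n) \<le> f w"
    using assms[of m w] \<theta> unfolding wm by (simp only: norm_minus_cancel inner_minus_left inner_scaleR_left norm_scaleR
        power_mult_distrib power2_abs)
  then have "\<theta> * (f m - (1 - \<theta>) * ?p + \<kappa> / 2 * ((1 - \<theta>)\<^sup>2 * ?n)) \<le> \<theta> * f w"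
    using \<theta> by (intro mult_left_mono) auto
  ultimately have "(1 - \<theta>) * (f m + \<theta> * ?p + \<kappa> / 2 * (\<theta>\<^sup>2 * ?n)) +
      \<theta> * (f m - (1 - \<theta>) * ?p + \<kappa> / 2 * ((1 - \<theta>)\<^sup>2 * ?n)) \<le> (1 - \<theta>) * f u + \<theta> * f w" by linarith
  also have "(1 - \<theta>) * (f m + \<theta> * ?p + \<kappa> / 2 * (\<theta>\<^sup>2 * ?n)) +
      \<theta> * (f m - (1 - \<theta>) * ?p + \<kappa> / 2 * ((1 - \<theta>)\<^sup>2 * ?n)) = f m + \<kappa> / 2 * (\<theta> * (1 - \<theta>)) * ?n"
    by (simp add: power2_eq_square field_simps)
  finally show "f ((1 - \<theta>) *\<^sub>R u + \<theta> *\<^sub>R w) \<le>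
      (1 - \<theta>) * f u + \<theta> * f w - \<kappa> / 2 * (\<theta> * (1 - \<theta>)) * ?n"
    by (simp add: m_def)
qed

text \<open>Divide the convexity inequality by the weight \<open>r\<close> of \<open>w\<close> and
  let \<open>r\<close> tend to zero. For an expectation, the gradient first enters here, so it never
  has to be written as a mean of gradients.\<close>

lemma curvature_ge_gradient:
  fixes f :: "'a::real_inner \<Rightarrow> real"
  assumes "curvature_ge \<kappa> f" and G: "(f has_derivative (\<lambda>h. h \<bullet> g)) (at u)"
  shows "f u + (w - u) \<bullet> g + \<kappa> / 2 * (norm (w - u))\<^sup>2 \<le> f w"
proof -
  let ?d = "w - u"
  have "((\<lambda>r. f (u + r *\<^sub>R ?d)) has_real_derivative ?d \<bullet> g) (at 0)"
    using has_real_derivative_along_line[of f g u 0 ?d] G by simp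
  then have lim: "((\<lambda>r. (f (u + r *\<^sub>R ?d) - f u) / r) \<longlongrightarrow> ?d \<bullet> g) (at_right 0)"
    unfolding has_field_derivative_iff by (simp add: filterlim_at_split)
  have "?d \<bullet> g \<le> f w - f u - \<kappa> / 2 * (1 - 0) * (norm ?d)\<^sup>2"
  proof (rule tendsto_le[OF _ _ lim])
    show "((\<lambda>r. f w - f u - \<kappa> / 2 * (1 - r) * (norm ?d)\<^sup>2) \<longlongrightarrow> f w - f u - \<kappa> / 2 * (1 - 0) * (norm ?d)\<^sup>2) (at_right 0)"
      by (intro tendsto_intros)
    show "\<forall>\<^sub>F r in at_right 0. (f (u + r *\<^sub>R ?d) - f u) / r \<le> f w - f u - \<kappa> / 2 * (1 - r) * (norm ?d)\<^sup>2"
      using eventually_at_right_real[of 0 1, OF zero_less_one]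
    proof eventually_elim
      case (elim r)
      have "f ((1 - r) *\<^sub>R u + r *\<^sub>R w) \<le> (1 - r) * f u + r * f w - \<kappa> / 2 * (r * (1 - r)) * (norm (u - w))\<^sup>2"
        using assms(1) elim unfolding curvature_ge_def by auto
      moreover have "(1 - r) *\<^sub>R u + r *\<^sub>R w = u + r *\<^sub>R ?d" by (simp add: algebra_simps)
      ultimately have "f (u + r *\<^sub>R ?d) - f u \<le> (f w - f u - \<kappa> / 2 * (1 - r) * (norm ?d)\<^sup>2) * r"
        by (simp add: norm_minus_commute algebra_simps)
      then show ?case using elim by (simp add: pos_divide_le_eq)
    qed
  qed simp
  then show ?thesis by simp
qed

lemma curvature_ge_integral:
  fixes F :: "'a::real_normed_vector \<Rightarrow> 'b \<Rightarrow> real"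
  assumes "prob_space P" and int: "\<And>u. integrable P (F u)"
    and c: "\<And>s. s \<in> space P \<Longrightarrow> curvature_ge \<kappa> (\<lambda>u. F u s)"
  shows "curvature_ge \<kappa> (\<lambda>u. \<integral>s. F u s \<partial>P)"
  unfolding curvature_ge_def
proof (intro allI impI)
  interpret prob_space P by fact
  fix u w :: 'a and \<theta> :: real assume \<theta>: "0 \<le> \<theta> \<and> \<theta> \<le> 1"
  let ?c = "\<kappa> / 2 * (\<theta> * (1 - \<theta>)) * (norm (u - w))\<^sup>2"
  have "(\<integral>s. F ((1 - \<theta>) *\<^sub>R u + \<theta> *\<^sub>R w) s \<partial>P) \<le> (\<integral>s. (1 - \<theta>) * F u s + \<theta> * F w s - ?c \<partial>P)"
    using c \<theta> unfolding curvature_ge_def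
    by (intro integral_mono int Bochner_Integration.integrable_diff Bochner_Integration.integrable_add
        integrable_mult_right integrable_const) blast
  also have "\<dots> = (1 - \<theta>) * (\<integral>s. F u s \<partial>P) + \<theta> * (\<integral>s. F w s \<partial>P) - ?c"
    using int by (simp add: prob_space)
  finally show "(\<integral>s. F ((1 - \<theta>) *\<^sub>R u + \<theta> *\<^sub>R w) s \<partial>P) \<le>
      (1 - \<theta>) * (\<integral>s. F u s \<partial>P) + \<theta> * (\<integral>s. F w s \<partial>P) - ?c" .
qed

text \<open>The first bound compares the minimum with a gradient step of length
  \<open>1 / C\<close>, and at \<open>u = x\<close> it yields \<open>G x = 0\<close>. The second,
  the Polyak-Lojasiewicz inequality, comes from expanding
  \<open>|G u + c (x - u)|^2 >= 0\<close>.\<close>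

lemma minimizer_bounds:
  fixes f :: "'a::real_inner \<Rightarrow> real"
  assumes lo: "\<And>u w. f u + (w - u) \<bullet> G u + c / 2 * (norm (w - u))\<^sup>2 \<le> f w"
    and up: "\<And>u w. f w \<le> f u + (w - u) \<bullet> G u + C / 2 * (norm (w - u))\<^sup>2"
    and c: "0 < c" and C: "0 < C" and min: "\<And>u. f x \<le> f u"
  shows "(norm (G u))\<^sup>2 \<le> 2 * C * (f u - f x)"
    and "2 * c * (f u - f x) \<le> (norm (G u))\<^sup>2"
    and "c / 2 * (norm (u - x))\<^sup>2 \<le> f u - f x"
    and "f u - f x \<le> C / 2 * (norm (u - x))\<^sup>2"
proof -
  show 1: "(norm (G u))\<^sup>2 \<le> 2 * C * (f u - f x)" for u
  proof -
    have "f x \<le> f (u - (1 / C) *\<^sub>R G u)" by (rule min)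
    also have "\<dots> \<le> f u - (norm (G u))\<^sup>2 / (2 * C)"
      using up[of "u - (1 / C) *\<^sub>R G u" u] C
      by (simp add: power2_norm_eq_inner[symmetric] power_divide) (simp add: power2_eq_square field_simps)
    finally show ?thesis using C by (simp add: field_simps)
  qed
  then have Gx: "G x = 0" using C 1[of x] by simp
  show "c / 2 * (norm (u - x))\<^sup>2 \<le> f u - f x" using lo[of x u] by (simp add: Gx)
  show "f u - f x \<le> C / 2 * (norm (u - x))\<^sup>2" using up[of u x] by (simp add: Gx)
  have sq: "(norm (p + c *\<^sub>R q))\<^sup>2 = (norm p)\<^sup>2 + 2 * c * (q \<bullet> p) + c\<^sup>2 * (norm q)\<^sup>2" for p q :: 'a
    unfolding power2_norm_eq_inner
    by (simp add: inner_add_left inner_add_right inner_commute power2_eq_square algebra_simps)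
  have "0 \<le> (norm (G u + c *\<^sub>R (x - u)))\<^sup>2" by simp
  also have "\<dots> = (norm (G u))\<^sup>2 + 2 * c * ((x - u) \<bullet> G u) + c\<^sup>2 * (norm (x - u))\<^sup>2"
    by (rule sq)
  also have "\<dots> = (norm (G u))\<^sup>2 + 2 * c * ((x - u) \<bullet> G u + c / 2 * (norm (x - u))\<^sup>2)"
    by (simp add: power2_eq_square algebra_simps)
  also have "\<dots> \<le> (norm (G u))\<^sup>2 + 2 * c * (f x - f u)"
    using lo[of u x] c by (intro add_left_mono mult_left_mono) auto
  finally show "2 * c * (f u - f x) \<le> (norm (G u))\<^sup>2" by (simp add: algebra_simps)
qed

section \<open>Joint measurability and solver parameters\<close>

text \<open>With the first argument approximated by simple functions \<open>e i\<close>, only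
  finitely many sections \<open>F u\<close> occur at a time; continuity in \<open>u\<close> passes
  to the limit.\<close>

lemma borel_measurable_Caratheodory:
  fixes F :: "'a::{metric_space, second_countable_topology} \<Rightarrow> 'b \<Rightarrow> real"
  assumes meas: "\<And>u. F u \<in> borel_measurable P" and cont: "\<And>s. s \<in> space P \<Longrightarrow> continuous_on UNIV (\<lambda>u. F u s)"
  shows "(\<lambda>p. F (fst p) (snd p)) \<in> borel_measurable (borel \<Otimes>\<^sub>M P)"
proof -
  have "(\<lambda>u::'a. u) \<in> borel_measurable borel" by simp
  from borel_measurable_implies_sequence_metric[OF this, of undefined] obtain e
    where e: "\<And>i. simple_function borel (e i)" "\<And>u. (\<lambda>i. e i u) \<longlonglongrightarrow> (u :: 'a)" by auto
  show ?thesis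
  proof (rule borel_measurable_LIMSEQ_metric)
    fix i
    show "(\<lambda>p. F (e i (fst p)) (snd p)) \<in> borel_measurable (borel \<Otimes>\<^sub>M P)"
    proof (rule measurable_compose_countable'[where f = "\<lambda>u p. F u (snd p)" and g = "\<lambda>p. e i (fst p)"])
      show "countable (range (e i))" using simple_functionD(1)[OF e(1), of i] by (simp add: countable_finite)
      have "e i \<in> borel \<rightarrow>\<^sub>M count_space (range (e i))"
        using measurable_simple_function[OF e(1)] by (rule measurable_count_space_extend[rotated 2]) auto
      then show "(\<lambda>p. e i (fst p)) \<in> borel \<Otimes>\<^sub>M P \<rightarrow>\<^sub>M count_space (range (e i))"
        by (rule measurable_compose[OF measurable_fst])
    qed (use meas in measurable)
  next
    fix p assume "p \<in> space (borel \<Otimes>\<^sub>M P :: ('a \<times> 'b) measure)"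
    then have "snd p \<in> space P" by (auto simp: space_pair_measure)
    then have "isCont (\<lambda>u. F u (snd p)) (fst p)" using cont by (simp add: continuous_on_eq_continuous_at)
    then show "(\<lambda>i. F (e i (fst p)) (snd p)) \<longlonglongrightarrow> F (fst p) (snd p)"
      by (rule isCont_tendsto_compose[OF _ e(2)])
  qed
qed

lemma borel_measurable_line_derivative:
  fixes h D :: "'a::euclidean_space \<Rightarrow> 'b \<Rightarrow> real"
  assumes meas: "(\<lambda>p. h (fst p) (snd p)) \<in> borel_measurable (borel \<Otimes>\<^sub>M P)"
    and deriv: "\<And>u s. s \<in> space P \<Longrightarrow> ((\<lambda>r. h (u + r *\<^sub>R e) s) has_real_derivative D u s) (at 0)"
  shows "(\<lambda>p. D (fst p) (snd p)) \<in> borel_measurable (borel \<Otimes>\<^sub>M P)"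
proof (rule borel_measurable_LIMSEQ_metric)
  let ?r = "\<lambda>n. 1 / real (Suc n)"
  show "(\<lambda>p. (h (fst p + ?r n *\<^sub>R e) (snd p) - h (fst p) (snd p)) / ?r n) \<in> borel_measurable (borel \<Otimes>\<^sub>M P)" for n
  proof -
    have "(\<lambda>p. (fst p + ?r n *\<^sub>R e, snd p)) \<in> borel \<Otimes>\<^sub>M P \<rightarrow>\<^sub>M borel \<Otimes>\<^sub>M P" by measurable
    from measurable_compose[OF this meas] have "(\<lambda>p. h (fst p + ?r n *\<^sub>R e) (snd p)) \<in> borel_measurable (borel \<Otimes>\<^sub>M P)" by simp
    then show ?thesis using meas by measurable
  qed
  fix p assume "p \<in> space (borel \<Otimes>\<^sub>M P :: ('a \<times> 'b) measure)"
  then have "snd p \<in> space P" by (auto simp: space_pair_measure)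
  from deriv[OF this, of "fst p"]
  have "((\<lambda>r. (h (fst p + r *\<^sub>R e) (snd p) - h (fst p) (snd p)) / r) \<longlongrightarrow> D (fst p) (snd p)) (at 0)"
    by (simp add: has_field_derivative_iff)
  moreover have "filterlim ?r (at 0) sequentially"
    unfolding filterlim_at using LIMSEQ_Suc[OF lim_1_over_n] by simp
  ultimately show "(\<lambda>n. (h (fst p + ?r n *\<^sub>R e) (snd p) - h (fst p) (snd p)) / ?r n) \<longlonglongrightarrow> D (fst p) (snd p)"
    by (rule filterlim_compose)
qed

text \<open>Needed because \<open>g t\<close> and \<open>H t\<close> evaluate derivatives at the
  random point \<open>x t\<close>. Gradient coordinates are limits of difference quotients of
  \<open>F\<close>, and Hessian entries are limits of difference quotients of the gradient.\<close>

lemma borel_measurable_grad_hessian: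
  fixes F :: "real^'n \<Rightarrow> 'b \<Rightarrow> real"
  assumes meas: "\<And>u. F u \<in> borel_measurable P"
    and C2: "\<And>s. s \<in> space P \<Longrightarrow> twice_continuously_differentiable (\<lambda>u. F u s)"
  shows "(\<lambda>p. grad (\<lambda>u. F u (snd p)) (fst p)) \<in> borel_measurable (borel \<Otimes>\<^sub>M P)"
    and "(\<lambda>p. hessian (\<lambda>u. F u (snd p)) (fst p)) \<in> borel_measurable (borel \<Otimes>\<^sub>M P)"
proof -
  note D = twice_continuously_differentiableD[OF C2]
  have "(\<lambda>p. F (fst p) (snd p)) \<in> borel_measurable (borel \<Otimes>\<^sub>M P)"
  proof (rule borel_measurable_Caratheodory[OF meas])
    show "continuous_on UNIV (\<lambda>u. F u s)" if "s \<in> space P" for s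
      using D(1)[OF that] by (meson continuous_at_imp_continuous_on has_derivative_continuous)
  qed
  then have g: "(\<lambda>p. grad (\<lambda>u. F u (snd p)) (fst p) $ i) \<in> borel_measurable (borel \<Otimes>\<^sub>M P)" for i
  proof (rule borel_measurable_line_derivative[where e = "axis i 1" and D = "\<lambda>u s. grad (\<lambda>u. F u s) u $ i"])
    fix u :: "real^'n" and s assume s: "s \<in> space P"
    show "((\<lambda>r. F (u + r *\<^sub>R axis i 1) s) has_real_derivative grad (\<lambda>u. F u s) u $ i) (at 0)"
      using has_real_derivative_along_line[of "\<lambda>u. F u s" "grad (\<lambda>u. F u s) u" u 0 "axis i 1"] D(1)[OF s, of u]
      by (simp add: inner_axis')
  qed
  then show "(\<lambda>p. grad (\<lambda>u. F u (snd p)) (fst p)) \<in> borel_measurable (borel \<Otimes>\<^sub>M P)"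
    by (rule borel_measurable_vecI)
  have "(\<lambda>p. hessian (\<lambda>u. F u (snd p)) (fst p) $ i $ j) \<in> borel_measurable (borel \<Otimes>\<^sub>M P)" for i j
  proof (rule borel_measurable_line_derivative[where e = "axis j 1" and D = "\<lambda>u s. hessian (\<lambda>u. F u s) u $ i $ j", OF g[of i]])
    fix u :: "real^'n" and s assume s: "s \<in> space P"
    have "((\<lambda>r. u + r *\<^sub>R axis j 1) has_derivative (\<lambda>h. h *\<^sub>R axis j 1)) (at 0)"
      by (auto intro!: derivative_eq_intros)
    moreover have "((\<lambda>u. grad (\<lambda>u. F u s) u $ i) has_derivative (\<lambda>h. (hessian (\<lambda>u. F u s) u *v h) $ i)) (at (u + 0 *\<^sub>R axis j 1))"
      using bounded_linear.has_derivative[OF bounded_linear_vec_nth D(2)[OF s, of u]] by simp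
    ultimately have "((\<lambda>r. grad (\<lambda>u. F u s) (u + r *\<^sub>R axis j 1) $ i) has_derivative
        (\<lambda>h. (hessian (\<lambda>u. F u s) u *v (h *\<^sub>R axis j 1)) $ i)) (at 0)"
      by (rule has_derivative_compose)
    then show "((\<lambda>r. grad (\<lambda>u. F u s) (u + r *\<^sub>R axis j 1) $ i) has_real_derivative hessian (\<lambda>u. F u s) u $ i $ j) (at 0)"
      by (simp add: has_field_derivative_def matrix_vector_mult_scaleR matrix_vector_mult_basis column_def mult.commute[of _ "_ $ _ $ _"])
  qed
  then show "(\<lambda>p. hessian (\<lambda>u. F u (snd p)) (fst p)) \<in> borel_measurable (borel \<Otimes>\<^sub>M P)"
    by (intro borel_measurable_vecI)
qed

section \<open>Means of random projections and bounds on the solver parameters\<close>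

lemma bilinear_form_integral:
  fixes Q :: "'s \<Rightarrow> real^'n^'m"
  assumes int: "\<And>i j. integrable D (\<lambda>s. Q s $ i $ j)"
  shows "integrable D (\<lambda>s. a \<bullet> (Q s *v b))"
    and "a \<bullet> ((\<chi> i j. \<integral>s. Q s $ i $ j \<partial>D) *v b) = (\<integral>s. a \<bullet> (Q s *v b) \<partial>D)"
proof -
  show "integrable D (\<lambda>s. a \<bullet> (Q s *v b))"
    using int by (simp add: inner_vec_def matrix_vector_mult_def)
  show "a \<bullet> ((\<chi> i j. \<integral>s. Q s $ i $ j \<partial>D) *v b) = (\<integral>s. a \<bullet> (Q s *v b) \<partial>D)"
    using int by (simp add: inner_vec_def matrix_vector_mult_def)
qed

lemma matrix_entry: "A $ i $ j = axis i 1 \<bullet> (A *v axis j 1)" for A :: "real^'n^'m"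
  by (simp add: matrix_vector_mult_basis column_def inner_axis')

lemma matrix_entry_bound:
  fixes A :: "real^'n^'m"
  assumes "\<And>a. norm (A *v a) \<le> C * norm a"
  shows "\<bar>A $ i $ j\<bar> \<le> C"
proof -
  have "\<bar>A $ i $ j\<bar> \<le> norm (axis i 1 :: real^'m) * norm (A *v axis j 1)"
    unfolding matrix_entry by (rule Cauchy_Schwarz_ineq2)
  also have "\<dots> \<le> C" using assms[of "axis j 1"] by simp
  finally show ?thesis .
qed

lemma projection_sandwich_bound:
  fixes Q Z :: "real^'n^'n"
  assumes Q: "transpose Q = Q" "Q ** Q = Q" and Z: "\<And>a. c * (a \<bullet> a) \<le> a \<bullet> (Z *v a)" and c: "0 < c"
  shows "norm ((Q ** matrix_inv Z ** Q) *v a) \<le> 1 / c * norm a"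
proof -
  have "norm ((Q ** matrix_inv Z ** Q) *v a) = norm (Q *v (matrix_inv Z *v (Q *v a)))"
    by (simp add: matrix_vector_mul_assoc matrix_mul_assoc)
  also have "\<dots> \<le> norm (matrix_inv Z *v (Q *v a))" by (rule orthogonal_projection_bounds[OF Q])
  also have "\<dots> \<le> norm (Q *v a) / c" by (rule form_bounds_matrix_inv[OF Z c])
  also have "\<dots> \<le> norm a / c" using c orthogonal_projection_bounds(2)[OF Q, of a] by (simp add: divide_right_mono)
  finally show ?thesis by simp
qed

text \<open>To be read with \<open>Q s\<close> the sketched projection for a frozen matrix
  \<open>B t\<close> and \<open>D\<close> the law of one sketch, so that \<open>Z\<close> and
  \<open>Y\<close> are ordinary means of matrices.\<close>

lemma sketch_parameter_bounds:
  fixes Q :: "'s \<Rightarrow> real^'n^'n" and Z Y :: "real^'n^'n"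
  assumes D: "prob_space D" and Qm [measurable]: "Q \<in> borel_measurable D"
    and Q: "\<And>s. s \<in> space D \<Longrightarrow> transpose (Q s) = Q s \<and> Q s ** Q s = Q s"
    and Z: "Z = (\<chi> i j. \<integral>s. Q s $ i $ j \<partial>D)"
    and Y: "Y = (\<chi> i j. \<integral>s. (Q s ** matrix_inv Z ** Q s) $ i $ j \<partial>D)"
    and lo: "c *\<^sub>R mat 1 \<preceq>\<^sub>L Z" and c: "0 < c"
  shows "transpose Z = Z" "sketch_mu Z * (a \<bullet> a) \<le> a \<bullet> (Z *v a)" "a \<bullet> (Z *v a) \<le> a \<bullet> a"
    and "c \<le> sketch_mu Z" "sketch_mu Z \<le> 1" "1 \<le> sketch_nu Z Y"
proof -
  interpret D: prob_space D by fact
  have loZ: "c * (a \<bullet> a) \<le> a \<bullet> (Z *v a)" for a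
    using loewner_le_form[OF lo, of a] by (simp add: scaleR_mat_form)
  have int: "integrable D (\<lambda>s. Q s $ i $ j)" for i j
    by (rule D.integrable_const_bound[where B = 1])
      (use Q in \<open>auto intro!: AE_I2 matrix_entry_bound orthogonal_projection_bounds\<close>)
  have intY: "integrable D (\<lambda>s. (Q s ** matrix_inv Z ** Q s) $ i $ j)" for i j
    by (rule D.integrable_const_bound[where B = "1 / c"])
      (use Q loZ c in \<open>auto intro!: AE_I2 matrix_entry_bound projection_sandwich_bound\<close>)
  note Zf = bilinear_form_integral[OF int, folded Z] and Yf = bilinear_form_integral[OF intY, folded Y]
  show sym: "transpose Z = Z"
  proof -
    have "(\<integral>s. Q s $ j $ i \<partial>D) = (\<integral>s. Q s $ i $ j \<partial>D)" for i j
    proof (rule Bochner_Integration.integral_cong[OF refl])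
      fix s assume "s \<in> space D"
      then have "transpose (Q s) $ i $ j = Q s $ i $ j" using Q by simp
      then show "Q s $ j $ i = Q s $ i $ j" by (simp add: transpose_def)
    qed
    then show ?thesis by (simp add: Z transpose_def vec_eq_iff)
  qed
  have up: "a \<bullet> (Z *v a) \<le> a \<bullet> a" for a
  proof -
    have "(\<integral>s. a \<bullet> (Q s *v a) \<partial>D) \<le> (\<integral>s. a \<bullet> a \<partial>D)"
    proof (intro integral_mono Zf)
      fix s assume "s \<in> space D"
      note B = orthogonal_projection_bounds[of "Q s" a] Q[OF this]
      have "(norm (Q s *v a))\<^sup>2 \<le> (norm a)\<^sup>2" using B by (intro power_mono) auto
      then show "a \<bullet> (Q s *v a) \<le> a \<bullet> a" using B by (simp add: power2_norm_eq_inner)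
    qed simp
    then show ?thesis by (simp add: Zf D.prob_space)
  qed
  then show "a \<bullet> (Z *v a) \<le> a \<bullet> a" .
  have pos: "0 < a \<bullet> (Z *v a)" if "a \<noteq> 0" for a using loZ[of a] c that by (smt (verit) inner_gt_zero_iff mult_pos_pos)
  obtain u :: "real^'n" where u: "norm u = 1" using vector_choose_size[of 1] by auto
  then have u0: "u \<in> - {0}" by auto
  let ?q = "\<lambda>a. (a \<bullet> (Z *v a)) / (a \<bullet> a)"
  have q: "c \<le> ?q a" if "a \<in> - {0}" for a using loZ[of a] that by (simp add: pos_le_divide_eq)
  then have bdd: "bdd_below (?q ` (- {0}))" by (rule bdd_belowI2)
  show "c \<le> sketch_mu Z" unfolding sketch_mu_def by (rule cINF_greatest) (use u0 q in auto)
  have mu_le: "sketch_mu Z \<le> ?q a" if "a \<in> - {0}" for a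
    unfolding sketch_mu_def by (rule cINF_lower[OF bdd that])
  show "sketch_mu Z * (a \<bullet> a) \<le> a \<bullet> (Z *v a)"
    using mu_le[of a] by (cases "a = 0") (auto simp: pos_le_divide_eq)
  show "sketch_mu Z \<le> 1" using mu_le[OF u0] up[of u] u by (simp add: norm_eq_1)
  note inv = form_bounds_matrix_inv[OF loZ c]
  have ZiZ: "matrix_inv Z *v (Z *v a) = a" and iZZ: "Z *v (matrix_inv Z *v a) = a" for a
    using inv(1,2) by (simp_all add: matrix_vector_mul_assoc)
  have sandwich: "a \<bullet> ((Q s ** matrix_inv Z ** Q s) *v a) = (Q s *v a) \<bullet> (matrix_inv Z *v (Q s *v a))"
    if "s \<in> space D" for a s
    using symmetric_dot[of "Q s" a] Q[OF that] by (simp add: matrix_vector_mul_assoc matrix_mul_assoc)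
  let ?r = "\<lambda>a. (a \<bullet> (Y *v a)) / (a \<bullet> (Z *v a))"
  \<comment> \<open>\<open>Y <= Z / c\<close> bounds the quotients that define
    \<open>sketch_nu\<close>; the \<open>SUP\<close> of an unbounded set would be an unspecified
    number.\<close>
  have "a \<bullet> (Y *v a) \<le> (a \<bullet> (Z *v a)) / c" for a
  proof -
    have "(\<integral>s. a \<bullet> ((Q s ** matrix_inv Z ** Q s) *v a) \<partial>D) \<le> (\<integral>s. (a \<bullet> (Q s *v a)) / c \<partial>D)"
    proof (intro integral_mono Yf Bochner_Integration.integrable_divide Zf)
      fix s assume s: "s \<in> space D"
      have "(Q s *v a) \<bullet> (matrix_inv Z *v (Q s *v a)) \<le> norm (Q s *v a) * norm (matrix_inv Z *v (Q s *v a))"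
        by (rule norm_cauchy_schwarz)
      also have "\<dots> \<le> norm (Q s *v a) * (norm (Q s *v a) / c)" by (intro mult_left_mono inv) simp
      also have "\<dots> = (a \<bullet> (Q s *v a)) / c"
        using orthogonal_projection_bounds(1)[of "Q s" a] Q[OF s] by (simp add: power2_eq_square)
      finally show "a \<bullet> ((Q s ** matrix_inv Z ** Q s) *v a) \<le> (a \<bullet> (Q s *v a)) / c" by (simp add: sandwich s)
    qed
    then show ?thesis by (simp add: Zf Yf)
  qed
  then have "?r a \<le> 1 / c" if "a \<in> - {0}" for a using pos[of a] that c by (simp add: pos_divide_le_eq)
  then have bddr: "bdd_above (?r ` (- {0}))" by (rule bdd_aboveI2)
  \<comment> \<open>Integrating \<open>(Q - Z) Z^-1 (Q - Z) >= 0\<close>, that is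
    \<open>Q Z^-1 Q >= 2 Q - Z\<close>, gives \<open>Y >= Z\<close> and hence
    \<open>1 <= sketch_nu Z Y\<close>.\<close>
  have "u \<bullet> (Z *v u) \<le> u \<bullet> (Y *v u)"
  proof -
    have "(\<integral>s. 2 * (u \<bullet> (Q s *v u)) - u \<bullet> (Z *v u) \<partial>D) \<le> (\<integral>s. u \<bullet> ((Q s ** matrix_inv Z ** Q s) *v u) \<partial>D)"
    proof (intro integral_mono Yf Bochner_Integration.integrable_diff integrable_mult_right Zf)
      fix s assume s: "s \<in> space D"
      let ?p = "Q s *v u"
      have "0 \<le> (?p - Z *v u) \<bullet> (matrix_inv Z *v (?p - Z *v u))"
        using matrix_inv_form_lower[OF sym loZ c, of 1 "?p - Z *v u"] up by (smt (verit) mult_1 zero_le_power2)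
      also have "\<dots> = ?p \<bullet> (matrix_inv Z *v ?p) - ?p \<bullet> u - (Z *v u) \<bullet> (matrix_inv Z *v ?p) + (Z *v u) \<bullet> u"
        by (simp add: matrix_vector_mult_diff_distrib inner_diff_left inner_diff_right ZiZ)
      also have "(Z *v u) \<bullet> (matrix_inv Z *v ?p) = u \<bullet> ?p" by (simp add: symmetric_dot[OF sym] iZZ)
      finally show "2 * (u \<bullet> (Q s *v u)) - u \<bullet> (Z *v u) \<le> u \<bullet> ((Q s ** matrix_inv Z ** Q s) *v u)"
        by (simp add: sandwich s inner_commute)
    qed simp
    then show ?thesis by (simp add: Zf Yf D.prob_space)
  qed
  then have "1 \<le> ?r u" using pos[of u] u0 by (simp add: pos_le_divide_eq)
  also have "\<dots> \<le> sketch_nu Z Y" unfolding sketch_nu_def by (rule cSUP_upper[OF u0 bddr])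
  finally show "1 \<le> sketch_nu Z Y" .
qed

section \<open>Almost supermartingales\<close>

lemma (in prob_space) integral_add_const_indicator:
  fixes f :: "'a \<Rightarrow> real"
  assumes "integrable M f" "A \<in> sets M"
  shows "integrable M (\<lambda>\<omega>. c * indicator A \<omega> + f \<omega>)"
    and "(\<integral>\<omega>. c * indicator A \<omega> + f \<omega> \<partial>M) = c * prob A + (\<integral>\<omega>. f \<omega> \<partial>M)"
proof -
  have 1: "integrable M (\<lambda>\<omega>. c * indicator A \<omega>)"
    using assms by (intro integrable_mult_right integrable_real_indicator) (auto simp: emeasure_eq_measure)
  show "integrable M (\<lambda>\<omega>. c * indicator A \<omega> + f \<omega>)" using 1 assms by simp
  show "(\<integral>\<omega>. c * indicator A \<omega> + f \<omega> \<partial>M) = c * prob A + (\<integral>\<omega>. f \<omega> \<partial>M)"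
    using 1 assms by (subst Bochner_Integration.integral_add) auto
qed

text \<open>The first-passage decomposition, with the supermartingale property used in integrated form
  on the events that the level has not been reached so far.\<close>

lemma (in prob_space) supermartingale_maximal_inequality:
  fixes W :: "nat \<Rightarrow> 'a \<Rightarrow> real"
  assumes sub: "\<And>n. subalgebra M (G n)" and mono: "\<And>n. sets (G n) \<subseteq> sets (G (Suc n))"
    and meas: "\<And>n. W n \<in> borel_measurable (G n)" and int: "\<And>n. integrable M (W n)"
    and nonneg: "\<And>n \<omega>. 0 \<le> W n \<omega>"
    and super: "\<And>n A. A \<in> sets (G n) \<Longrightarrow> (\<integral>\<omega>. indicator A \<omega> * W (Suc n) \<omega> \<partial>M) \<le> (\<integral>\<omega>. indicator A \<omega> * W n \<omega> \<partial>M)"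
  shows "c * prob {\<omega> \<in> space M. \<exists>k\<le>n. c \<le> W (m + k) \<omega>} \<le> (\<integral>\<omega>. W m \<omega> \<partial>M)"
proof -
  define B where "B n = {\<omega> \<in> space M. \<forall>k\<le>n. W (m + k) \<omega> < c}" for n
  have space: "space (G n) = space M" and sets: "sets (G n) \<subseteq> sets M" for n using sub by (auto simp: subalgebra_def)
  have WM [measurable]: "W n \<in> borel_measurable M" for n by (rule measurable_from_subalg[OF sub meas])
  have BG: "B n \<in> sets (G (m + n))" for n
  proof (induction n)
    case 0
    have "{\<omega> \<in> space (G m). W m \<omega> < c} \<in> sets (G m)" using meas[of m] by measurable
    then show ?case by (simp add: B_def space)
  next
    case (Suc n)
    have 1: "{\<omega> \<in> space (G (m + Suc n)). W (m + Suc n) \<omega> < c} \<in> sets (G (m + Suc n))"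
      using meas[of "m + Suc n"] by measurable
    have 2: "B n \<in> sets (G (m + Suc n))" using Suc mono[of "m + n"] by auto
    have "B (Suc n) = B n \<inter> {\<omega> \<in> space (G (m + Suc n)). W (m + Suc n) \<omega> < c}"
      by (auto simp: B_def space le_Suc_eq)
    then show ?case using 1 2 by (metis sets.Int)
  qed
  then have BM [measurable]: "B n \<in> sets M" for n using sets by blast
  have intB: "integrable M (\<lambda>\<omega>. indicator (B n) \<omega> * W k \<omega>)" for n k
    using integrable_mult_indicator[OF BM int, of n k] by simp
  \<comment> \<open>The invariant splits the paths by whether the level has been reached by time
    \<open>m + n\<close>: those that have are charged \<open>c\<close>, the others the current value
    of \<open>W\<close>.\<close>
  have "c * prob (space M - B n) + (\<integral>\<omega>. indicator (B n) \<omega> * W (m + n) \<omega> \<partial>M) \<le> (\<integral>\<omega>. W m \<omega> \<partial>M)"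
  proof (induction n)
    case 0
    have "c * prob (space M - B 0) + (\<integral>\<omega>. indicator (B 0) \<omega> * W m \<omega> \<partial>M) =
        (\<integral>\<omega>. c * indicator (space M - B 0) \<omega> + indicator (B 0) \<omega> * W m \<omega> \<partial>M)"
      by (rule integral_add_const_indicator(2)[OF intB, symmetric]) auto
    also have "\<dots> \<le> (\<integral>\<omega>. W m \<omega> \<partial>M)"
    proof (intro integral_mono int integral_add_const_indicator intB)
      show "c * indicator (space M - B 0) \<omega> + indicator (B 0) \<omega> * W m \<omega> \<le> W m \<omega>" if "\<omega> \<in> space M" for \<omega>
        using that nonneg[of m \<omega>] by (auto simp: B_def indicator_def)
    qed (auto intro: BM)
    finally show ?case by simp
  next
    case (Suc n)
    \<comment> \<open>The event of reaching the level for the first time at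
      \<open>m + Suc n\<close>, where \<open>W\<close> is at least \<open>c\<close>.\<close>
    let ?A = "B n - B (Suc n)"
    have sub': "B (Suc n) \<subseteq> B n" by (auto simp: B_def)
    have "space M - B (Suc n) = (space M - B n) \<union> ?A" using sub' by (auto simp: B_def)
    then have "prob (space M - B (Suc n)) = prob (space M - B n) + prob ?A"
      by (simp add: finite_measure_Union Int_Diff disjoint_iff)
    moreover have "c * prob ?A + (\<integral>\<omega>. indicator (B (Suc n)) \<omega> * W (m + Suc n) \<omega> \<partial>M) \<le> (\<integral>\<omega>. indicator (B n) \<omega> * W (m + Suc n) \<omega> \<partial>M)"
    proof -
      have "c * prob ?A + (\<integral>\<omega>. indicator (B (Suc n)) \<omega> * W (m + Suc n) \<omega> \<partial>M) =
          (\<integral>\<omega>. c * indicator ?A \<omega> + indicator (B (Suc n)) \<omega> * W (m + Suc n) \<omega> \<partial>M)"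
        by (rule integral_add_const_indicator(2)[OF intB, symmetric]) auto
      also have "\<dots> \<le> (\<integral>\<omega>. indicator (B n) \<omega> * W (m + Suc n) \<omega> \<partial>M)"
      proof (intro integral_mono integral_add_const_indicator intB)
        show "c * indicator ?A \<omega> + indicator (B (Suc n)) \<omega> * W (m + Suc n) \<omega> \<le> indicator (B n) \<omega> * W (m + Suc n) \<omega>"
          if "\<omega> \<in> space M" for \<omega>
          using that sub' by (auto simp: B_def indicator_def le_Suc_eq)
      qed (auto intro: BM)
      finally show ?thesis .
    qed
    moreover have "(\<integral>\<omega>. indicator (B n) \<omega> * W (m + Suc n) \<omega> \<partial>M) \<le> (\<integral>\<omega>. indicator (B n) \<omega> * W (m + n) \<omega> \<partial>M)"
      using super[OF BG, of n] by simp
    ultimately show ?case using Suc by (simp add: distrib_left)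
  qed
  moreover have "0 \<le> (\<integral>\<omega>. indicator (B n) \<omega> * W (m + n) \<omega> \<partial>M)" using nonneg by simp
  moreover have "{\<omega> \<in> space M. \<exists>k\<le>n. c \<le> W (m + k) \<omega>} = space M - B n" by (auto simp: B_def not_less)
  ultimately show ?thesis by simp
qed

lemma (in prob_space) supermartingale_tendsto_0:
  fixes W :: "nat \<Rightarrow> 'a \<Rightarrow> real"
  assumes sub: "\<And>n. subalgebra M (G n)" and mono: "\<And>n. sets (G n) \<subseteq> sets (G (Suc n))"
    and meas: "\<And>n. W n \<in> borel_measurable (G n)" and int: "\<And>n. integrable M (W n)"
    and nonneg: "\<And>n \<omega>. 0 \<le> W n \<omega>"
    and super: "\<And>n A. A \<in> sets (G n) \<Longrightarrow> (\<integral>\<omega>. indicator A \<omega> * W (Suc n) \<omega> \<partial>M) \<le> (\<integral>\<omega>. indicator A \<omega> * W n \<omega> \<partial>M)"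
    and lim: "(\<lambda>n. \<integral>\<omega>. W n \<omega> \<partial>M) \<longlonglongrightarrow> 0"
  shows "AE \<omega> in M. (\<lambda>n. W n \<omega>) \<longlonglongrightarrow> 0"
proof -
  have WM [measurable]: "W n \<in> borel_measurable M" for n by (rule measurable_from_subalg[OF sub meas])
  have ev: "AE \<omega> in M. \<exists>m. \<forall>k. W (m + k) \<omega> < c" if c: "0 < c" for c
  proof -
    let ?A = "\<lambda>m n. {\<omega> \<in> space M. \<exists>k\<le>n. c \<le> W (m + k) \<omega>}"
    let ?U = "\<lambda>m. {\<omega> \<in> space M. \<exists>k. c \<le> W (m + k) \<omega>}"
    let ?N = "{\<omega> \<in> space M. \<forall>m. \<exists>k. c \<le> W (m + k) \<omega>}"
    have U: "prob (?U m) \<le> (\<integral>\<omega>. W m \<omega> \<partial>M) / c" for m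
    proof -
      have "(\<Union>n. ?A m n) = ?U m" by auto
      moreover have "(\<lambda>n. prob (?A m n)) \<longlonglongrightarrow> prob (\<Union>n. ?A m n)"
        by (rule finite_Lim_measure_incseq) (auto simp: incseq_def intro: order_trans)
      ultimately have "(\<lambda>n. prob (?A m n)) \<longlonglongrightarrow> prob (?U m)" by simp
      moreover have "prob (?A m n) \<le> (\<integral>\<omega>. W m \<omega> \<partial>M) / c" for n
        using supermartingale_maximal_inequality[where G = G and W = W, OF sub mono meas int nonneg super, of c n m] c
        by (simp add: pos_le_divide_eq mult.commute)
      ultimately show ?thesis by (intro LIMSEQ_le_const2[of _ "prob (?U m)"]) auto
    qed
    have "prob ?N \<le> 0"
    proof (rule LIMSEQ_le_const)
      show "(\<lambda>m. (\<integral>\<omega>. W m \<omega> \<partial>M) / c) \<longlonglongrightarrow> 0" using tendsto_divide[OF lim tendsto_const[of c]] c by simp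
      have "prob ?N \<le> prob (?U m)" for m by (rule finite_measure_mono) auto
      then show "\<exists>N. \<forall>m\<ge>N. prob ?N \<le> (\<integral>\<omega>. W m \<omega> \<partial>M) / c" using U order_trans by blast
    qed
    then have "prob ?N = 0" by (simp add: measure_le_0_iff)
    then have "AE \<omega> in M. \<omega> \<notin> ?N" by (subst (asm) prob_eq_0) auto
    then show ?thesis by (rule AE_mp) (auto intro!: AE_I2 simp: not_le)
  qed
  have "AE \<omega> in M. \<forall>i. \<exists>m. \<forall>k. W (m + k) \<omega> < 1 / real (Suc i)"
    unfolding AE_all_countable using ev by simp
  then show ?thesis
  proof eventually_elim
    case (elim \<omega>)
    show ?case
    proof (rule LIMSEQ_I)
      fix r :: real assume "0 < r"
      then obtain i where i: "1 / real (Suc i) < r" using nat_approx_posE by blast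
      obtain m where m: "\<And>k. W (m + k) \<omega> < 1 / real (Suc i)" using elim by blast
      have "norm (W n \<omega> - 0) < r" if "m \<le> n" for n
        using m[of "n - m"] i nonneg[of n \<omega>] that by simp
      then show "\<exists>m. \<forall>n\<ge>m. norm (W n \<omega> - 0) < r" by blast
    qed
  qed
qed

text \<open>Deterministic counterpart for the means. The quantity \<open>u n\<close> drops by at
  least \<open>c / K * (a n * e n)\<close> in each step. Were its limit positive, \<open>e\<close>
  would stay away from zero, and telescoping would make \<open>a\<close> summable.\<close>

lemma perturbed_contraction_tendsto_0:
  fixes e a p :: "nat \<Rightarrow> real"
  assumes e: "\<And>n. 0 \<le> e n" and a: "\<And>n. 0 \<le> a n" and c: "0 < c" and C: "0 \<le> C"
    and sum2: "summable (\<lambda>n. (a n)\<^sup>2)" and sum1: "\<not> summable a"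
    and p: "\<And>n. p (Suc n) = p n * (1 + C * (a n)\<^sup>2)" and p1: "\<And>n. 1 \<le> p n" and pK: "\<And>n. p n \<le> K"
    and step: "\<And>n. e (Suc n) \<le> (1 - c * a n + C * (a n)\<^sup>2) * e n + C * (a n)\<^sup>2"
  shows "(\<lambda>n. e n / p n + C * (\<Sum>k. (a (n + k))\<^sup>2)) \<longlonglongrightarrow> 0"
proof -
  define T where "T n = (\<Sum>k. (a (n + k))\<^sup>2)" for n
  have sumk: "summable (\<lambda>k. (a (n + k))\<^sup>2)" for n using summable_ignore_initial_segment[OF sum2, of n] by (simp add: add.commute)
  have T_Suc: "T n = (a n)\<^sup>2 + T (Suc n)" for n
    using suminf_split_head[OF sumk[of n]] by (simp add: T_def)
  have T0: "0 \<le> T n" for n unfolding T_def by (intro suminf_nonneg sumk) simp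
  have T_lim: "T \<longlonglongrightarrow> 0"
    using suminf_exist_split2[OF sum2] by (simp add: T_def[abs_def] add.commute)
  define u where "u n = e n / p n + C * T n" for n
  have u0: "0 \<le> u n" for n using e p1[of n] T0 C by (simp add: u_def)
  have K: "0 < K" using p1[of 0] pK[of 0] by linarith
  have dec: "u (Suc n) \<le> u n - c / K * (a n * e n)" for n
  proof -
    have pp: "0 < p (Suc n)" "0 < p n" using p1[of n] p1[of "Suc n"] by linarith+
    have "e (Suc n) / p (Suc n) \<le> ((1 - c * a n + C * (a n)\<^sup>2) * e n + C * (a n)\<^sup>2) / p (Suc n)"
      using step pp by (simp add: divide_right_mono)
    also have "\<dots> = ((1 + C * (a n)\<^sup>2) * e n) / p (Suc n) - c * (a n * e n) / p (Suc n) + C * (a n)\<^sup>2 / p (Suc n)"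
      by (simp add: algebra_simps add_divide_distrib diff_divide_distrib)
    also have "((1 + C * (a n)\<^sup>2) * e n) / p (Suc n) = e n / p n"
    proof -
      have "1 + C * (a n)\<^sup>2 \<noteq> 0" using C by (smt (verit) mult_nonneg_nonneg zero_le_power2)
      then show ?thesis by (simp add: p)
    qed
    also have "C * (a n)\<^sup>2 / p (Suc n) \<le> C * (a n)\<^sup>2"
      using divide_left_mono[OF p1[of "Suc n"], of "C * (a n)\<^sup>2"] C pp by simp
    finally have "e (Suc n) / p (Suc n) \<le> e n / p n - c * (a n * e n) / p (Suc n) + C * (a n)\<^sup>2" by simp
    moreover have "c * (a n * e n) / K \<le> c * (a n * e n) / p (Suc n)"
      using c a e pK pp K by (intro divide_left_mono) auto
    ultimately show ?thesis by (simp add: u_def T_Suc[of n] algebra_simps)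
  qed
  have ae: "0 \<le> c / K * (a n * e n)" for n using c K a e by simp
  have "decseq u" unfolding decseq_Suc_iff using dec ae by (smt (verit))
  then obtain l where l: "u \<longlonglongrightarrow> l" using decseq_convergent[of u 0 thesis] u0 by blast
  have l0: "0 \<le> l" by (rule LIMSEQ_le_const[OF l]) (use u0 in auto)
  have "l = 0"
  proof (rule ccontr)
    assume "l \<noteq> 0"
    then have lp: "0 < l" using l0 by simp
    have "(\<lambda>n. u n - C * T n) \<longlonglongrightarrow> l - C * 0" by (intro tendsto_intros l T_lim)
    then have "eventually (\<lambda>n. l / 2 < u n - C * T n) sequentially"
      by (rule order_tendstoD) (use lp in simp)
    then obtain N where N: "\<And>n. N \<le> n \<Longrightarrow> l / 2 < e n / p n" by (auto simp: u_def eventually_sequentially)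
    have big: "l / 2 \<le> e n" if "N \<le> n" for n
    proof -
      have "e n / p n \<le> e n / 1" by (rule divide_left_mono) (use e p1[of n] in auto)
      then show ?thesis using N[OF that] by linarith
    qed
    have "(\<Sum>k<n. c / K * (a k * e k)) \<le> u 0 - u n" for n
    proof (induction n)
      case (Suc n) then show ?case using dec[of n] by simp
    qed simp
    then have "(\<Sum>k<n. c / K * (a k * e k)) \<le> u 0" for n using u0[of n] by (smt (verit))
    then have "summable (\<lambda>n. c / K * (a n * e n))" by (intro summableI_nonneg_bounded ae)
    then have "summable (\<lambda>n. (K / c * (2 / l)) * (c / K * (a n * e n)))" by (rule summable_mult)
    then have "summable a"
    proof (rule summable_comparison_test_ev[rotated])
      show "\<forall>\<^sub>F n in sequentially. norm (a n) \<le> (K / c * (2 / l)) * (c / K * (a n * e n))"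
        unfolding eventually_sequentially
      proof (intro exI allI impI)
        fix n assume "N \<le> n"
        then have "a n * (l / 2) \<le> a n * e n" using big a by (intro mult_left_mono) auto
        then show "norm (a n) \<le> (K / c * (2 / l)) * (c / K * (a n * e n))" using c K lp a by (simp add: field_simps)
      qed
    qed
    then show False using sum1 by blast
  qed
  then show ?thesis using l by (simp add: u_def[abs_def] T_def)
qed

text \<open>A Robbins--Siegmund theorem for a nonsummable drift. Rescaling by the product \<open>p\<close> and adding
  the tail of the noise series turns \<open>V\<close> into a nonnegative supermartingale whose mean tends to \<open>0\<close>.\<close>

lemma (in prob_space) almost_supermartingale_tendsto_0:
  fixes V :: "nat \<Rightarrow> 'a \<Rightarrow> real" and a :: "nat \<Rightarrow> real"
  assumes sub: "\<And>n. subalgebra M (G n)" and mono: "\<And>n. sets (G n) \<subseteq> sets (G (Suc n))"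
    and meas: "\<And>n. V n \<in> borel_measurable (G n)" and int: "\<And>n. integrable M (V n)"
    and nonneg: "\<And>n \<omega>. 0 \<le> V n \<omega>"
    and step: "\<And>n A. A \<in> sets (G n) \<Longrightarrow> (\<integral>\<omega>. indicator A \<omega> * V (Suc n) \<omega> \<partial>M) \<le>
      (1 - c * a n + C * (a n)\<^sup>2) * (\<integral>\<omega>. indicator A \<omega> * V n \<omega> \<partial>M) + C * (a n)\<^sup>2 * prob A"
    and a: "\<And>n. 0 \<le> a n" and c: "0 < c" and C: "0 \<le> C"
    and sum2: "summable (\<lambda>n. (a n)\<^sup>2)" and sum1: "\<not> summable a"
  shows "AE \<omega> in M. (\<lambda>n. V n \<omega>) \<longlonglongrightarrow> 0"
proof -
  define p where "p n = (\<Prod>k<n. 1 + C * (a k)\<^sup>2)" for n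
  define T where "T n = (\<Sum>k. (a (n + k))\<^sup>2)" for n
  \<comment> \<open>Bound on all products \<open>p n\<close>, from
    \<open>1 + s <= exp s\<close>.\<close>
  define K where "K = exp (C * (\<Sum>k. (a k)\<^sup>2))"
  have p_Suc: "p (Suc n) = p n * (1 + C * (a n)\<^sup>2)" for n by (simp add: p_def)
  have p1: "1 \<le> p n" for n unfolding p_def using C by (intro prod_ge_1) simp
  have pK: "p n \<le> K" for n
  proof -
    have "p n \<le> (\<Prod>k<n. exp (C * (a k)\<^sup>2))"
      unfolding p_def using C by (intro prod_mono) (simp add: exp_ge_add_one_self)
    also have "\<dots> = exp (C * (\<Sum>k<n. (a k)\<^sup>2))" by (simp add: exp_sum sum_distrib_left)
    also have "\<dots> \<le> K"
      unfolding K_def using C by (simp add: mult_left_mono sum_le_suminf sum2)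
    finally show ?thesis .
  qed
  have sumk: "summable (\<lambda>k. (a (n + k))\<^sup>2)" for n using summable_ignore_initial_segment[OF sum2, of n] by (simp add: add.commute)
  have T_Suc: "T n = (a n)\<^sup>2 + T (Suc n)" for n
    using suminf_split_head[OF sumk[of n]] by (simp add: T_def)
  have T0: "0 \<le> T n" for n unfolding T_def by (intro suminf_nonneg sumk) simp
  define W where "W n \<omega> = V n \<omega> / p n + C * T n" for n \<omega>
  have intA: "integrable M (\<lambda>\<omega>. indicator A \<omega> * V n \<omega>)" if "A \<in> sets M" for A n
    using integrable_mult_indicator[OF that int, of n] by simp
  have WA: "(\<integral>\<omega>. indicator A \<omega> * W n \<omega> \<partial>M) = (\<integral>\<omega>. indicator A \<omega> * V n \<omega> \<partial>M) / p n + C * T n * prob A" if A: "A \<in> sets M" for A n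
  proof -
    have "(\<integral>\<omega>. indicator A \<omega> * W n \<omega> \<partial>M) = (\<integral>\<omega>. (indicator A \<omega> * V n \<omega>) / p n + C * T n * indicator A \<omega> \<partial>M)"
      by (intro arg_cong[of _ _ "lebesgue_integral M"]) (simp add: W_def algebra_simps)
    also have "\<dots> = (\<integral>\<omega>. C * T n * indicator A \<omega> + (indicator A \<omega> * V n \<omega>) / p n \<partial>M)" by (simp only: add.commute)
    also have "\<dots> = C * T n * prob A + (\<integral>\<omega>. (indicator A \<omega> * V n \<omega>) / p n \<partial>M)"
      by (rule integral_add_const_indicator(2)[OF _ A]) (use intA[OF A] in simp)
    finally show ?thesis by simp
  qed
  have "AE \<omega> in M. (\<lambda>n. W n \<omega>) \<longlonglongrightarrow> 0"
  proof (rule supermartingale_tendsto_0[where G = G and W = W, OF sub mono])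
    show "W n \<in> borel_measurable (G n)" for n unfolding W_def using meas by measurable
    show "integrable M (W n)" for n unfolding W_def using int by simp
    show "0 \<le> W n \<omega>" for n \<omega> using nonneg p1[of n] C T0 by (simp add: W_def)
    show "(\<integral>\<omega>. indicator A \<omega> * W (Suc n) \<omega> \<partial>M) \<le> (\<integral>\<omega>. indicator A \<omega> * W n \<omega> \<partial>M)" if AG: "A \<in> sets (G n)" for n A
    proof -
      have A: "A \<in> sets M" using AG sub by (auto simp: subalgebra_def)
      let ?I = "\<lambda>n. \<integral>\<omega>. indicator A \<omega> * V n \<omega> \<partial>M"
      have I0: "0 \<le> ?I n" using nonneg by simp
      have pp: "0 < p (Suc n)" using p1[of "Suc n"] by linarith
      have q: "0 < 1 + C * (a n)\<^sup>2" using C by (smt (verit) mult_nonneg_nonneg zero_le_power2)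
      \<comment> \<open>For the supermartingale property the drift \<open>- c * a n\<close> is
        merely discarded; it acts below, where the means are shown to tend to zero.\<close>
      have "?I (Suc n) \<le> (1 + C * (a n)\<^sup>2) * ?I n + C * (a n)\<^sup>2 * prob A"
        using step[OF AG] c a[of n] I0 by (smt (verit) mult_nonneg_nonneg mult_right_mono)
      then have "?I (Suc n) / p (Suc n) \<le> ((1 + C * (a n)\<^sup>2) * ?I n) / p (Suc n) + C * (a n)\<^sup>2 * prob A / p (Suc n)"
        using pp by (simp add: divide_right_mono flip: add_divide_distrib)
      also have "((1 + C * (a n)\<^sup>2) * ?I n) / p (Suc n) = ?I n / p n" using q by (simp add: p_Suc)
      also have "C * (a n)\<^sup>2 * prob A / p (Suc n) \<le> C * (a n)\<^sup>2 * prob A / 1"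
        using C p1[of "Suc n"] by (intro divide_left_mono) auto
      finally show ?thesis by (simp add: WA A T_Suc[of n] algebra_simps)
    qed
    let ?e = "\<lambda>n. \<integral>\<omega>. V n \<omega> \<partial>M"
    have "(\<lambda>n. ?e n / p n + C * (\<Sum>k. (a (n + k))\<^sup>2)) \<longlonglongrightarrow> 0"
    proof (rule perturbed_contraction_tendsto_0[OF _ a c C sum2 sum1 p_Suc p1 pK])
      show "0 \<le> ?e n" for n using nonneg by simp
      show "?e (Suc n) \<le> (1 - c * a n + C * (a n)\<^sup>2) * ?e n + C * (a n)\<^sup>2" for n
      proof -
        have "(\<integral>\<omega>. indicator (space M) \<omega> * V k \<omega> \<partial>M) = ?e k" for k
          by (rule Bochner_Integration.integral_cong) auto
        moreover have "space M \<in> sets (G n)" using sub[of n] by (metis subalgebra_def sets.top)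
        ultimately show ?thesis using step[of "space M" n] by (simp add: prob_space)
      qed
    qed
    then show "(\<lambda>n. \<integral>\<omega>. W n \<omega> \<partial>M) \<longlonglongrightarrow> 0" using int by (simp add: W_def T_def prob_space)
  qed
  then show ?thesis
  proof eventually_elim
    case (elim \<omega>)
    show ?case
    proof (rule tendsto_sandwich[OF _ _ tendsto_const tendsto_mult_right_zero[OF elim, of K]])
      show "\<forall>\<^sub>F n in sequentially. V n \<omega> \<le> K * W n \<omega>"
      proof (intro always_eventually allI)
        fix n
        have "V n \<omega> = p n * (V n \<omega> / p n)" using p1[of n] by simp
        also have "\<dots> \<le> K * (V n \<omega> / p n)" using pK nonneg[of n \<omega>] p1[of n] by (intro mult_right_mono) auto
        also have "\<dots> \<le> K * W n \<omega>" using C T0 by (intro mult_left_mono) (auto simp: W_def K_def)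
        finally show "V n \<omega> \<le> K * W n \<omega>" .
      qed
    qed (use nonneg in auto)
  qed
qed

section \<open>Square integrable vectors\<close>

definition square_integrable :: "'a measure \<Rightarrow> ('a \<Rightarrow> 'b::euclidean_space) \<Rightarrow> bool" where
  "square_integrable M X \<longleftrightarrow> X \<in> borel_measurable M \<and> integrable M (\<lambda>\<omega>. (norm (X \<omega>))\<^sup>2)"

lemma square_integrable_measurable: "square_integrable M X \<Longrightarrow> X \<in> borel_measurable M"
  by (simp add: square_integrable_def)

lemma square_integrable_bound:
  assumes X: "square_integrable M X" and Y: "Y \<in> borel_measurable M"
    and le: "AE \<omega> in M. norm (Y \<omega>) \<le> C * norm (X \<omega>)"
  shows "square_integrable M Y"
  unfolding square_integrable_def
proof
  show "integrable M (\<lambda>\<omega>. (norm (Y \<omega>))\<^sup>2)"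
  proof (rule Bochner_Integration.integrable_bound)
    show "integrable M (\<lambda>\<omega>. C\<^sup>2 * (norm (X \<omega>))\<^sup>2)" using X by (simp add: square_integrable_def)
    show "AE \<omega> in M. norm ((norm (Y \<omega>))\<^sup>2) \<le> norm (C\<^sup>2 * (norm (X \<omega>))\<^sup>2)"
      using le
    proof eventually_elim
      case (elim \<omega>)
      then have "(norm (Y \<omega>))\<^sup>2 \<le> (C * norm (X \<omega>))\<^sup>2" by (intro power_mono) auto
      then show ?case by (simp add: power_mult_distrib)
    qed
  qed (use Y in measurable)
qed (rule Y)

lemma square_integrable_add:
  assumes "square_integrable M X" "square_integrable M Y"
  shows "square_integrable M (\<lambda>\<omega>. X \<omega> + Y \<omega>)"
  unfolding square_integrable_def
proof
  have [measurable]: "X \<in> borel_measurable M" "Y \<in> borel_measurable M" using assms by (auto simp: square_integrable_def)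
  show "(\<lambda>\<omega>. X \<omega> + Y \<omega>) \<in> borel_measurable M" by measurable
  show "integrable M (\<lambda>\<omega>. (norm (X \<omega> + Y \<omega>))\<^sup>2)"
  proof (rule Bochner_Integration.integrable_bound)
    show "integrable M (\<lambda>\<omega>. 2 * (norm (X \<omega>))\<^sup>2 + 2 * (norm (Y \<omega>))\<^sup>2)" using assms by (simp add: square_integrable_def)
    show "AE \<omega> in M. norm ((norm (X \<omega> + Y \<omega>))\<^sup>2) \<le> norm (2 * (norm (X \<omega>))\<^sup>2 + 2 * (norm (Y \<omega>))\<^sup>2)"
    proof (rule AE_I2)
      fix \<omega>
      have "(norm (X \<omega> + Y \<omega>))\<^sup>2 \<le> (norm (X \<omega>) + norm (Y \<omega>))\<^sup>2" by (intro power_mono norm_triangle_ineq) simp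
      also have "\<dots> \<le> 2 * (norm (X \<omega>))\<^sup>2 + 2 * (norm (Y \<omega>))\<^sup>2"
        using sum_squares_bound[of "norm (X \<omega>)" "norm (Y \<omega>)"] by (simp add: power2_sum)
      finally show "norm ((norm (X \<omega> + Y \<omega>))\<^sup>2) \<le> norm (2 * (norm (X \<omega>))\<^sup>2 + 2 * (norm (Y \<omega>))\<^sup>2)" by simp
    qed
  qed measurable
qed

lemma square_integrable_scaleR:
  assumes "square_integrable M X"
  shows "square_integrable M (\<lambda>\<omega>. c *\<^sub>R X \<omega>)"
  using assms by (auto simp: square_integrable_def power_mult_distrib)

lemma square_integrable_diff:
  assumes "square_integrable M X" "square_integrable M Y"
  shows "square_integrable M (\<lambda>\<omega>. X \<omega> - Y \<omega>)"
  using square_integrable_add[OF assms(1) square_integrable_scaleR[OF assms(2), of "-1"]] by simp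

lemma integrable_inner_square_integrable:
  assumes "square_integrable M X" "square_integrable M Y"
  shows "integrable M (\<lambda>\<omega>. X \<omega> \<bullet> Y \<omega>)"
proof (rule Bochner_Integration.integrable_bound)
  have [measurable]: "X \<in> borel_measurable M" "Y \<in> borel_measurable M" using assms by (auto simp: square_integrable_def)
  show "integrable M (\<lambda>\<omega>. (norm (X \<omega>))\<^sup>2 + (norm (Y \<omega>))\<^sup>2)" using assms by (simp add: square_integrable_def)
  show "AE \<omega> in M. norm (X \<omega> \<bullet> Y \<omega>) \<le> norm ((norm (X \<omega>))\<^sup>2 + (norm (Y \<omega>))\<^sup>2)"
  proof (rule AE_I2)
    fix \<omega>
    have "\<bar>X \<omega> \<bullet> Y \<omega>\<bar> \<le> norm (X \<omega>) * norm (Y \<omega>)" by (rule Cauchy_Schwarz_ineq2)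
    also have "\<dots> \<le> (norm (X \<omega>))\<^sup>2 + (norm (Y \<omega>))\<^sup>2"
    proof -
      have "0 \<le> norm (X \<omega>) * norm (Y \<omega>)" by simp
      then show ?thesis using sum_squares_bound[of "norm (X \<omega>)" "norm (Y \<omega>)"] by linarith
    qed
    finally show "norm (X \<omega> \<bullet> Y \<omega>) \<le> norm ((norm (X \<omega>))\<^sup>2 + (norm (Y \<omega>))\<^sup>2)" by simp
  qed
  show "(\<lambda>\<omega>. X \<omega> \<bullet> Y \<omega>) \<in> borel_measurable M" by measurable
qed

lemma (in prob_space) square_integrable_const: "square_integrable M (\<lambda>\<omega>. c)"
  by (simp add: square_integrable_def)

text \<open>One solver step seen from the errors, where \<open>q\<close> stands for the image of
  \<open>y\<close> under a contraction. Convex combinations do not expand, so growth comes only from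
  the term with \<open>c\<close>. The lemma serves the random recursion, with a sketched projection,
  and the mean recursion, with \<open>Z\<close>.\<close>

lemma solver_step_growth:
  fixes e v q :: "'a::real_normed_vector"
  assumes "norm e \<le> R" "norm v \<le> R" "0 \<le> a" "a \<le> 1" "0 \<le> b" "b \<le> 1" "0 \<le> c" "c \<le> C"
  defines "y \<equiv> a *\<^sub>R v + (1 - a) *\<^sub>R e"
  assumes q: "norm q \<le> norm y" "norm (y - q) \<le> norm y"
  shows "norm y \<le> R" "norm (y - q) \<le> (1 + C) * R" "norm (b *\<^sub>R v + (1 - b) *\<^sub>R y - c *\<^sub>R q) \<le> (1 + C) * R"
proof -
  have conv: "norm (k *\<^sub>R p + (1 - k) *\<^sub>R r) \<le> R" if "norm p \<le> R" "norm r \<le> R" "0 \<le> k" "k \<le> 1" for k and p r :: 'a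
  proof -
    have "norm (k *\<^sub>R p + (1 - k) *\<^sub>R r) \<le> k * norm p + (1 - k) * norm r"
      using norm_triangle_ineq[of "k *\<^sub>R p" "(1 - k) *\<^sub>R r"] that by simp
    also have "\<dots> \<le> k * R + (1 - k) * R" using that by (intro add_mono mult_left_mono) auto
    finally show ?thesis by (simp add: algebra_simps)
  qed
  show y: "norm y \<le> R" unfolding y_def using assms(1-4) by (intro conv) auto
  have R: "0 \<le> R" using assms(1) norm_ge_zero order_trans by blast
  have C: "0 \<le> C" using assms(7,8) by linarith
  have "0 \<le> C * R" using R C by simp
  then show "norm (y - q) \<le> (1 + C) * R" using q y unfolding distrib_right by linarith
  have "norm (b *\<^sub>R v + (1 - b) *\<^sub>R y - c *\<^sub>R q) \<le> norm (b *\<^sub>R v + (1 - b) *\<^sub>R y) + c * norm q"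
    using norm_triangle_ineq4[of "b *\<^sub>R v + (1 - b) *\<^sub>R y" "c *\<^sub>R q"] assms(7) by simp
  also have "\<dots> \<le> R + C * R"
  proof (intro add_mono conv mult_mono)
    show "norm q \<le> R" using q y by linarith
  qed (use assms(2,5-8) y R C in auto)
  finally show "norm (b *\<^sub>R v + (1 - b) *\<^sub>R y - c *\<^sub>R q) \<le> (1 + C) * R" by (simp add: algebra_simps)
qed

text \<open>From \<open>0 < Z <= I\<close> follows \<open>Z^2 <= Z\<close>, by applying
  \<open>Z^-1 >= I\<close> to the vector \<open>Z a\<close>; both bounds are consequences.\<close>

lemma psd_contraction:
  fixes Z :: "real^'n^'n"
  assumes sym: "transpose Z = Z" and lo: "\<And>a. m * (a \<bullet> a) \<le> a \<bullet> (Z *v a)" and up: "\<And>a. a \<bullet> (Z *v a) \<le> a \<bullet> a" and m: "0 < m"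
  shows "norm (Z *v a) \<le> norm a" "norm (a - Z *v a) \<le> norm a"
proof -
  have "matrix_inv Z *v (Z *v a) = a"
    using form_bounds_matrix_inv(2)[OF lo m] by (simp add: matrix_vector_mul_assoc)
  then have 1: "(norm (Z *v a))\<^sup>2 \<le> a \<bullet> (Z *v a)"
    using matrix_inv_form_lower[OF sym lo m, of 1 "Z *v a"] up by (simp add: inner_commute)
  also have "\<dots> \<le> (norm a)\<^sup>2" using up by (simp add: power2_norm_eq_inner)
  finally show "norm (Z *v a) \<le> norm a" by (rule power2_le_imp_le) simp
  have "0 \<le> a \<bullet> (Z *v a)" using 1 by (meson order_trans zero_le_power2)
  then have "(norm (a - Z *v a))\<^sup>2 \<le> (norm a)\<^sup>2"
    using 1 by (simp add: power2_norm_eq_inner inner_diff_left inner_diff_right inner_commute)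
  then show "norm (a - Z *v a) \<le> norm a" by (rule power2_le_imp_le) simp
qed

text \<open>A crude bound for every \<open>j\<close>, used for integrability only; the contraction
  that gives descent is that of \<open>mean_error_bound\<close> after the last step.\<close>

lemma mean_error_growth:
  fixes Z :: "real^'n^'n"
  assumes Z: "\<And>a. norm (Z *v a) \<le> norm a" "\<And>a. norm (a - Z *v a) \<le> norm a"
    and abc: "0 \<le> a" "a \<le> 1" "0 \<le> b" "b \<le> 1" "0 \<le> c" "c \<le> C"
  shows "norm (fst (mean_error a b c Z j) *v u) \<le> (1 + C) ^ j * norm u \<and>
    norm (snd (mean_error a b c Z j) *v u) \<le> (1 + C) ^ j * norm u"
proof (induction j)
  case (Suc j)
  define E V where "E = fst (mean_error a b c Z j)" and "V = snd (mean_error a b c Z j)"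
  let ?y = "a *\<^sub>R (V *v u) + (1 - a) *\<^sub>R (E *v u)"
  have W: "(a *\<^sub>R V + (1 - a) *\<^sub>R E) *v u = ?y"
    by (simp only: matrix_vector_mult_add_rdistrib scaleR_matrix_vector_assoc)
  have 1: "fst (mean_error a b c Z (Suc j)) *v u = ?y - Z *v ?y"
    by (simp only: mean_error.simps Let_def fst_conv matrix_vector_mult_diff_rdistrib
        matrix_vector_mul_assoc[symmetric] W flip: E_def V_def)
  have 2: "snd (mean_error a b c Z (Suc j)) *v u = b *\<^sub>R (V *v u) + (1 - b) *\<^sub>R ?y - c *\<^sub>R (Z *v ?y)"
    by (simp only: mean_error.simps Let_def snd_conv matrix_vector_mult_diff_rdistrib matrix_vector_mult_add_rdistrib
        scaleR_matrix_vector_assoc[symmetric] matrix_vector_mul_assoc[symmetric] flip: E_def V_def)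
  note IH = Suc.IH[folded E_def V_def]
  show ?case
    unfolding 1 2 using solver_step_growth[OF _ _ abc, of "E *v u" "(1 + C) ^ j * norm u" "V *v u" "Z *v ?y"] IH Z
    by (simp add: mult.assoc)
qed simp

text \<open>For at least two solver steps, \<open>b <= 1\<close> gives
  \<open>b ^ (\<tau> - 1) <= b ^ (\<tau> - 2)\<close>, and the factor 2 turns \<open>4 * C\<close>
  into \<open>2 * C\<close>. A single step contradicts the condition: its exponent is
  \<open>-1\<close>, so the power is at least 1 (infinite for \<open>b = 0\<close>), while the
  right-hand side is below 1.\<close>

lemma iteration_condition_bound:
  assumes tau: "1 \<le> \<tau>" and b: "0 \<le> b" "b \<le> 1" and c: "0 < c" "c < C"
    and cond: "ereal (real \<tau>) * epowi b (int \<tau> - 2) \<le> ereal (c / (4 * C))"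
  shows "2 * real \<tau> * b ^ (\<tau> - 1) \<le> c / (2 * C)"
proof (cases "\<tau> = 1")
  case True
  have lt: "c / (4 * C) < 1" using c by simp
  show ?thesis
  proof (cases "b = 0")
    case True
    then show ?thesis using cond \<open>\<tau> = 1\<close> by (simp add: epowi_def)
  next
    case False
    then have "1 \<le> inverse b" using b by (simp add: one_le_inverse_iff)
    moreover have "inverse b \<le> c / (4 * C)"
      using cond False \<open>\<tau> = 1\<close> by (simp add: epowi_def power_int_minus)
    ultimately show ?thesis using lt by linarith
  qed
next
  case False
  then obtain n where n: "\<tau> = Suc (Suc n)" using tau by (metis One_nat_def Suc_le_D le_0_eq not0_implies_Suc)
  have "epowi b (int n) = ereal (b ^ n)" by (simp add: epowi_def)
  then have "real \<tau> * b ^ n \<le> c / (4 * C)" using cond by (simp add: n)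
  moreover have "b ^ (\<tau> - 1) \<le> b ^ n" unfolding n using b by (intro power_decreasing) auto
  ultimately have "real \<tau> * b ^ (\<tau> - 1) \<le> c / (4 * C)" by (meson mult_left_mono of_nat_0_le_iff order_trans)
  then show ?thesis by simp
qed

section \<open>Filtrations and freezing\<close>

lemma space_gen_sigma [simp]: "space (gen_sigma M N X I) = space M"
  by (simp add: gen_sigma_def space_measure_of_conv)

lemma sets_gen_sigma: "sets (gen_sigma M N X I) = sigma_sets (space M) {X i -` A \<inter> space M | i A. i \<in> I \<and> A \<in> sets N}"
  unfolding gen_sigma_def by (rule sets_measure_of) auto

lemma sets_gen_sigma_mono: "I \<subseteq> J \<Longrightarrow> sets (gen_sigma M N X I) \<subseteq> sets (gen_sigma M N X J)"
  unfolding sets_gen_sigma by (rule sigma_sets_mono') auto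

lemma sets_gen_sigma_subset:
  assumes "\<And>i. i \<in> I \<Longrightarrow> X i \<in> M \<rightarrow>\<^sub>M N"
  shows "sets (gen_sigma M N X I) \<subseteq> sets M"
  unfolding sets_gen_sigma by (rule sets.sigma_sets_subset) (use assms in \<open>auto intro: measurable_sets\<close>)

lemma measurable_gen_sigma:
  assumes "i \<in> I" "X i \<in> space M \<rightarrow> space N" "sets (gen_sigma M N X I) \<subseteq> sets G" "space G = space M"
  shows "X i \<in> G \<rightarrow>\<^sub>M N"
proof (rule measurableI)
  show "X i \<omega> \<in> space N" if "\<omega> \<in> space G" for \<omega> using assms that by auto
  fix A assume A: "A \<in> sets N"
  have "X i -` A \<inter> space M \<in> sets (gen_sigma M N X I)"
    unfolding sets_gen_sigma by (rule sigma_sets.Basic) (use assms(1) A in blast)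
  then show "X i -` A \<inter> space G \<in> sets G" using assms(3,4) by auto
qed

lemma space_past [simp]: "space (past M P \<xi> S \<tau> t) = space M"
  by (simp add: past_def space_measure_of_conv)

lemma sets_sigma_Un:
  assumes "sets A \<subseteq> Pow \<Omega>" "sets B \<subseteq> Pow \<Omega>"
  shows "sets (sigma \<Omega> (sets A \<union> sets B)) = sigma_sets \<Omega> (sets A \<union> sets B)"
  by (rule sets_measure_of) (use assms in auto)

lemma sets_gen_sigma_Pow: "sets (gen_sigma M N X I) \<subseteq> Pow (space M)"
  using sets.space_closed[of "gen_sigma M N X I"] by simp

lemma sets_past: "sets (past M P \<xi> S \<tau> t) = sigma_sets (space M)
    (sets (gen_sigma M P \<xi> {..<t}) \<union> sets (gen_sigma M borel (\<lambda>(i, j). S i j) ({..<t} \<times> {..<\<tau>})))"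
  unfolding past_def by (rule sets_sigma_Un[OF sets_gen_sigma_Pow sets_gen_sigma_Pow])

lemma sets_past_mono: "t \<le> t' \<Longrightarrow> sets (past M P \<xi> S \<tau> t) \<subseteq> sets (past M P \<xi> S \<tau> t')"
  unfolding sets_past by (intro sigma_sets_mono' Un_mono sets_gen_sigma_mono Sigma_mono) auto

lemma measurable_mono_sets:
  assumes "f \<in> G \<rightarrow>\<^sub>M N" "sets G \<subseteq> sets G'" "space G' = space G"
  shows "f \<in> G' \<rightarrow>\<^sub>M N"
  using measurable_from_subalg[of G' G f N] assms by (simp add: subalgebra_def)

text \<open>All data are put into this \<open>\<sigma>\<close>-algebra at once: only the position of a sketch among
  the sketches matters for the conditional means of the inner solver.\<close>

definition data_sketches :: "'a measure \<Rightarrow> 'b measure \<Rightarrow> (nat \<Rightarrow> 'a \<Rightarrow> 'b) \<Rightarrow>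
    (nat \<Rightarrow> nat \<Rightarrow> 'a \<Rightarrow> real^'s^'d) \<Rightarrow> (nat \<times> nat) set \<Rightarrow> 'a measure" where
  "data_sketches M P \<xi> S J = sigma (space M)
     (sets (gen_sigma M P \<xi> UNIV) \<union> sets (gen_sigma M borel (\<lambda>(i, j). S i j) J))"

lemma space_data_sketches [simp]: "space (data_sketches M P \<xi> S J) = space M"
  by (simp add: data_sketches_def space_measure_of_conv)

lemma sets_data_sketches: "sets (data_sketches M P \<xi> S J) = sigma_sets (space M)
     (sets (gen_sigma M P \<xi> UNIV) \<union> sets (gen_sigma M borel (\<lambda>(i, j). S i j) J))"
  unfolding data_sketches_def by (rule sets_sigma_Un[OF sets_gen_sigma_Pow sets_gen_sigma_Pow])

lemma sets_past_subset_data_sketches: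
  assumes "{..<t} \<times> {..<\<tau>} \<subseteq> J"
  shows "sets (past M P \<xi> S \<tau> t) \<subseteq> sets (data_sketches M P \<xi> S J)"
  unfolding sets_past sets_data_sketches
  by (intro sigma_sets_mono' Un_mono sets_gen_sigma_mono assms) auto

text \<open>The data are independent of all sketches together, and \<open>S t j\<close> is
  independent of the sketches in \<open>J\<close>. Combined, these give the product rule for the
  events of \<open>S t j\<close> against intersections of a data event with a sketch event, and such
  intersections form a generating pi-system.\<close>

lemma (in prob_space) indep_set_data_sketches:
  fixes \<xi> :: "nat \<Rightarrow> 'a \<Rightarrow> 'b" and S :: "nat \<Rightarrow> nat \<Rightarrow> 'a \<Rightarrow> real^'s^'d"
  assumes xi: "\<And>i. \<xi> i \<in> M \<rightarrow>\<^sub>M P" and S: "indep_vars (\<lambda>_. borel) (\<lambda>(i, j). S i j) (UNIV \<times> {..<\<tau>})"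
    and xi_S: "indep_set (sets (gen_sigma M P \<xi> UNIV))
      (sets (gen_sigma M borel (\<lambda>(i, j). S i j) (UNIV \<times> {..<\<tau>})))"
    and J: "J \<subseteq> UNIV \<times> {..<\<tau>}" "(t, j) \<notin> J" "j < \<tau>"
    and sets_G: "sets G \<subseteq> sets (data_sketches M P \<xi> S J)"
  shows "indep_set (sets G) {S t j -` A \<inter> space M | A. A \<in> sets borel}"
proof -
  let ?X = "\<lambda>(i, j). S i j"
  let ?I = "UNIV \<times> {..<\<tau>}"
  let ?A = "sets (gen_sigma M P \<xi> UNIV)" and ?B = "sets (gen_sigma M borel ?X J)"
  let ?C = "{S t j -` A \<inter> space M | A. A \<in> sets borel}"
  define E where "E p = {?X p -` A \<inter> space M | A. A \<in> sets borel}" for p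
  have E: "indep_sets E ?I" and rv: "\<And>p. p \<in> ?I \<Longrightarrow> ?X p \<in> borel_measurable M"
    using S unfolding indep_vars_def2 E_def by auto
  have stable: "Int_stable (E p)" for p
  proof (rule Int_stableI)
    fix a b assume "a \<in> E p" "b \<in> E p"
    then obtain A B where "a = ?X p -` A \<inter> space M" "A \<in> sets borel" "b = ?X p -` B \<inter> space M" "B \<in> sets borel"
      unfolding E_def by blast
    then have "a \<inter> b = ?X p -` (A \<inter> B) \<inter> space M" "A \<inter> B \<in> sets borel" by auto
    then show "a \<inter> b \<in> E p" unfolding E_def by blast
  qed
  have gen: "sets (gen_sigma M borel ?X K) = sigma_sets (space M) (\<Union>p\<in>K. E p)" for K
    unfolding sets_gen_sigma by (intro arg_cong[of _ _ "sigma_sets (space M)"]) (unfold E_def, blast)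
  let ?K = "case_bool J {(t, j)}"
  have "indep_sets (\<lambda>b. sigma_sets (space M) (\<Union>p\<in>?K b. E p)) UNIV"
  proof (rule indep_sets_collect_sigma)
    have "(\<Union>b. ?K b) \<subseteq> ?I" using J by (auto split: bool.splits)
    then show "indep_sets E (\<Union>b. ?K b)" by (rule indep_sets_mono_index[OF _ E])
    show "disjoint_family_on ?K UNIV" using J by (auto simp: disjoint_family_on_def split: bool.splits)
  qed (rule stable)
  then have BC: "indep_set ?B (sigma_sets (space M) ?C)"
    unfolding indep_set_def gen
    by (rule indep_sets_mono_sets) (auto split: bool.split simp: E_def)
  have C_sub: "sigma_sets (space M) ?C \<subseteq> sets (gen_sigma M borel ?X ?I)"
  proof -
    have "?C = E (t, j)" by (simp add: E_def)
    moreover have "(t, j) \<in> ?I" using J by simp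
    ultimately have "?C \<subseteq> (\<Union>p\<in>?I. E p)" by blast
    then show ?thesis unfolding gen by (rule sigma_sets_mono')
  qed
  have B_sub: "?B \<subseteq> sets (gen_sigma M borel ?X ?I)" by (rule sets_gen_sigma_mono[OF J(1)])
  have I_sub: "sets (gen_sigma M borel ?X ?I) \<subseteq> events" by (rule sets_gen_sigma_subset[OF rv])
  have A_sub: "?A \<subseteq> events" by (rule sets_gen_sigma_subset[OF xi])
  let ?\<Pi> = "{a \<inter> b | a b. a \<in> ?A \<and> b \<in> ?B}"
  have "indep_set ?\<Pi> ?C"
  proof (rule indep_setI)
    show "?\<Pi> \<subseteq> events" using A_sub B_sub I_sub by blast
    show "?C \<subseteq> events" using C_sub I_sub by (auto intro: sigma_sets.Basic)
    fix d c assume "d \<in> ?\<Pi>" and c: "c \<in> ?C"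
    then obtain a b where d: "d = a \<inter> b" and a: "a \<in> ?A" and b: "b \<in> ?B" by blast
    have c': "c \<in> sigma_sets (space M) ?C" using c by (rule sigma_sets.Basic)
    then have bc: "b \<inter> c \<in> sets (gen_sigma M borel ?X ?I)" using b B_sub C_sub by (intro sets.Int) auto
    have "prob (d \<inter> c) = prob (a \<inter> (b \<inter> c))" by (simp add: d Int_assoc)
    also have "\<dots> = prob a * prob (b \<inter> c)" by (rule indep_setD[OF xi_S a bc])
    also have "prob (b \<inter> c) = prob b * prob c" by (rule indep_setD[OF BC b c'])
    also have "prob a * (prob b * prob c) = prob (a \<inter> b) * prob c"
      using indep_setD[OF xi_S a, of b] b B_sub by auto
    finally show "prob (d \<inter> c) = prob d * prob c" by (simp add: d)
  qed
  moreover have "Int_stable ?\<Pi>"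
  proof (rule Int_stableI)
    fix d d' assume "d \<in> ?\<Pi>" "d' \<in> ?\<Pi>"
    then obtain a b a' b' where "d = a \<inter> b" "d' = a' \<inter> b'" "a \<in> ?A" "a' \<in> ?A" "b \<in> ?B" "b' \<in> ?B" by blast
    then have "d \<inter> d' = (a \<inter> a') \<inter> (b \<inter> b')" "a \<inter> a' \<in> ?A" "b \<inter> b' \<in> ?B" by auto
    then show "d \<inter> d' \<in> ?\<Pi>" by blast
  qed
  moreover have "Int_stable ?C" using stable[of "(t, j)"] by (simp add: E_def)
  ultimately have indep: "indep_set (sigma_sets (space M) ?\<Pi>) (sigma_sets (space M) ?C)"
    by (rule indep_set_sigma_sets)
  have "?A \<union> ?B \<subseteq> ?\<Pi>"
  proof
    fix a assume a: "a \<in> ?A \<union> ?B"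
    have sp: "space M \<in> ?A" "space M \<in> ?B" by (metis sets.top space_gen_sigma)+
    have "a \<in> Pow (space M)"
      using a sets_gen_sigma_Pow[of M P \<xi> UNIV] sets_gen_sigma_Pow[of M borel ?X J] by (meson UnE subsetD)
    then have "a = a \<inter> space M" "a = space M \<inter> a" by auto
    then show "a \<in> ?\<Pi>" using a sp by blast
  qed
  then have sub: "sets (data_sketches M P \<xi> S J) \<subseteq> sigma_sets (space M) ?\<Pi>"
    unfolding sets_data_sketches by (rule sigma_sets_mono')
  show ?thesis
    using indep sets_G sub unfolding indep_sets2_eq by (meson sigma_sets.Basic subset_iff)
qed

text \<open>The identity map into the space equipped with \<open>G\<close> acts as a random variable
  carrying exactly the information of \<open>G\<close>. Independence makes its joint law with
  \<open>T\<close> a product measure, and Fubini's theorem integrates out \<open>T\<close> with the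
  first component frozen.\<close>

lemma (in prob_space) integral_freeze:
  fixes h :: "'a \<times> 'c \<Rightarrow> real"
  assumes sub: "subalgebra M G" and T [measurable]: "T \<in> M \<rightarrow>\<^sub>M N"
    and indep: "indep_set (sets G) {T -` A \<inter> space M | A. A \<in> sets N}" and D: "distr M N T = D"
    and h: "h \<in> borel_measurable (G \<Otimes>\<^sub>M N)" and int: "integrable M (\<lambda>\<omega>. h (\<omega>, T \<omega>))"
  shows "integrable M (\<lambda>\<omega>. \<integral>s. h (\<omega>, s) \<partial>D)"
    and "(\<integral>\<omega>. h (\<omega>, T \<omega>) \<partial>M) = (\<integral>\<omega>. (\<integral>s. h (\<omega>, s) \<partial>D) \<partial>M)"
proof -
  note [measurable] = h
  have id [measurable]: "(\<lambda>\<omega>. \<omega>) \<in> M \<rightarrow>\<^sub>M G" by (rule measurable_from_subalg[OF sub]) simp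
  let ?N = "distr M G (\<lambda>\<omega>. \<omega>)"
  interpret N: prob_space ?N by (rule prob_space_distr[OF id])
  interpret D: prob_space D unfolding D[symmetric] by (rule prob_space_distr[OF T])
  interpret P: pair_sigma_finite ?N D ..
  have sets_D [measurable_cong]: "sets D = sets N" using D by (metis sets_distr)
  have eq: "?N \<Otimes>\<^sub>M D = distr M (G \<Otimes>\<^sub>M N) (\<lambda>\<omega>. (\<omega>, T \<omega>))"
  proof (rule pair_measure_eqI)
    show "sigma_finite_measure ?N" "sigma_finite_measure D" ..
    show "sets (?N \<Otimes>\<^sub>M D) = sets (distr M (G \<Otimes>\<^sub>M N) (\<lambda>\<omega>. (\<omega>, T \<omega>)))" by (simp cong: sets_pair_measure_cong add: sets_D)
    fix A C assume A: "A \<in> sets ?N" and C: "C \<in> sets D"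
    then have [measurable]: "A \<in> sets G" "C \<in> sets N" by (simp_all add: sets_D)
    have AM: "A \<in> sets M" using sub A by (auto simp: subalgebra_def)
    then have Asp: "A \<inter> space M = A" using sets.sets_into_space by blast
    have "emeasure ?N A * emeasure D C = emeasure M A * emeasure M (T -` C \<inter> space M)"
      by (simp add: D[symmetric] emeasure_distr Asp)
    also have "\<dots> = emeasure M (A \<inter> (T -` C \<inter> space M))"
    proof -
      have "T -` C \<inter> space M \<in> {T -` A \<inter> space M | A. A \<in> sets N}" using \<open>C \<in> sets N\<close> by blast
      from indep_setD[OF indep \<open>A \<in> sets G\<close> this] show ?thesis by (simp add: emeasure_eq_measure ennreal_mult)
    qed
    also have "A \<inter> (T -` C \<inter> space M) = (\<lambda>\<omega>. (\<omega>, T \<omega>)) -` (A \<times> C) \<inter> space M" by auto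
    also have "emeasure M \<dots> = emeasure (distr M (G \<Otimes>\<^sub>M N) (\<lambda>\<omega>. (\<omega>, T \<omega>))) (A \<times> C)"
      by (rule emeasure_distr[symmetric]) auto
    finally show "emeasure ?N A * emeasure D C = emeasure (distr M (G \<Otimes>\<^sub>M N) (\<lambda>\<omega>. (\<omega>, T \<omega>))) (A \<times> C)" .
  qed
  have int': "integrable (?N \<Otimes>\<^sub>M D) h" unfolding eq using int by (subst integrable_distr_eq) auto
  have inner: "(\<lambda>x. \<integral>s. h (x, s) \<partial>D) \<in> borel_measurable G" by measurable
  show "integrable M (\<lambda>\<omega>. \<integral>s. h (\<omega>, s) \<partial>D)"
    using P.integrable_fst'[OF int'] inner by (simp add: integrable_distr_eq)
  have "(\<integral>\<omega>. h (\<omega>, T \<omega>) \<partial>M) = (\<integral>p. h p \<partial>(?N \<Otimes>\<^sub>M D))"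
    unfolding eq by (subst integral_distr) auto
  also have "\<dots> = (\<integral>x. (\<integral>s. h (x, s) \<partial>D) \<partial>?N)" using P.integral_fst'[OF int'] by simp
  also have "\<dots> = (\<integral>\<omega>. (\<integral>s. h (\<omega>, s) \<partial>D) \<partial>M)" using inner by (subst integral_distr) auto
  finally show "(\<integral>\<omega>. h (\<omega>, T \<omega>) \<partial>M) = (\<integral>\<omega>. (\<integral>s. h (\<omega>, s) \<partial>D) \<partial>M)" .
qed

text \<open>Multiplying \<open>h\<close> by the indicator of an event of \<open>G\<close> reduces
  the defining property of the conditional expectation to \<open>integral_freeze\<close>.\<close>

lemma (in prob_space) real_cond_exp_freeze:
  fixes h :: "'a \<times> 'c \<Rightarrow> real"
  assumes sub: "subalgebra M G" and T: "T \<in> M \<rightarrow>\<^sub>M N"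
    and indep: "indep_set (sets G) {T -` A \<inter> space M | A. A \<in> sets N}" and D: "distr M N T = D"
    and h: "h \<in> borel_measurable (G \<Otimes>\<^sub>M N)" and int: "integrable M (\<lambda>\<omega>. h (\<omega>, T \<omega>))"
  shows "AE \<omega> in M. real_cond_exp M G (\<lambda>\<omega>. h (\<omega>, T \<omega>)) \<omega> = (\<integral>s. h (\<omega>, s) \<partial>D)"
proof -
  interpret finite_measure_subalgebra M G by unfold_locales (rule sub)
  interpret D: prob_space D unfolding D[symmetric] by (rule prob_space_distr[OF T])
  have sets_D [measurable_cong]: "sets D = sets N" using D by (metis sets_distr)
  show ?thesis
  proof (rule real_cond_exp_charact)
    show "(\<lambda>\<omega>. \<integral>s. h (\<omega>, s) \<partial>D) \<in> borel_measurable G" using h by measurable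
    show "integrable M (\<lambda>\<omega>. \<integral>s. h (\<omega>, s) \<partial>D)" by (rule integral_freeze(1)[OF sub T indep D h int])
    fix A assume A: "A \<in> sets G"
    then have AM: "A \<in> sets M" using sub by (auto simp: subalgebra_def)
    let ?h = "\<lambda>p. indicator A (fst p) * h p"
    have "integrable M (\<lambda>\<omega>. ?h (\<omega>, T \<omega>))" using integrable_mult_indicator[OF AM int] by simp
    moreover have "?h \<in> borel_measurable (G \<Otimes>\<^sub>M N)" using h A by measurable
    ultimately have "(\<integral>\<omega>. ?h (\<omega>, T \<omega>) \<partial>M) = (\<integral>\<omega>. (\<integral>s. ?h (\<omega>, s) \<partial>D) \<partial>M)"
      using integral_freeze(2)[OF sub T indep D] by blast
    then show "(\<integral>\<omega>\<in>A. h (\<omega>, T \<omega>) \<partial>M) = (\<integral>\<omega>\<in>A. (\<integral>s. h (\<omega>, s) \<partial>D) \<partial>M)"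
      by (simp add: set_lebesgue_integral_def)
  qed (rule int)
qed

section \<open>The stochastic Newton iteration\<close>

locale sketched_newton = prob_space M + P: prob_space P
  for M :: "'a measure" and P :: "'b measure" +
  fixes D :: "(real^'s^'d) measure"
    and F :: "real^'d \<Rightarrow> 'b \<Rightarrow> real" and f :: "real^'d \<Rightarrow> real"
    and xstar x0 :: "real^'d" and B0 :: "real^'d^'d" and \<tau> :: nat
    and \<xi> :: "nat \<Rightarrow> 'a \<Rightarrow> 'b" and S :: "nat \<Rightarrow> nat \<Rightarrow> 'a \<Rightarrow> real^'s^'d"
    and x g :: "nat \<Rightarrow> 'a \<Rightarrow> real^'d" and H B :: "nat \<Rightarrow> 'a \<Rightarrow> real^'d^'d"
    and Zt Z Y :: "nat \<Rightarrow> 'a \<Rightarrow> real^'d^'d"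
    and \<mu> \<nu> \<gamma> \<alpha> \<beta> :: "nat \<Rightarrow> 'a \<Rightarrow> real"
    and z v y w :: "nat \<Rightarrow> nat \<Rightarrow> 'a \<Rightarrow> real^'d"
    and \<gamma>\<^sub>H \<Upsilon>\<^sub>H C\<^sub>1 C\<^sub>2 \<gamma>\<^sub>S C\<^sub>\<phi> \<phi> :: real
  assumes F_integrable: "\<And>u. integrable P (F u)"
    and f_eq: "\<And>u. f u = (\<integral>s. F u s \<partial>P)"
    and xstar: "is_arg_min f (\<lambda>_. True) xstar"
    and \<xi>_indep: "indep_vars (\<lambda>_. P) \<xi> UNIV"
    and \<tau>: "\<tau> \<ge> 1"
    and S_indep: "indep_vars (\<lambda>_. borel) (\<lambda>(t, j). S t j) (UNIV \<times> {..<\<tau>})"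
    and S_distr: "\<And>t j. j < \<tau> \<Longrightarrow> distr M borel (S t j) = D"
    and \<xi>_S_indep: "indep_set (sets (gen_sigma M P \<xi> UNIV))
           (sets (gen_sigma M borel (\<lambda>(t, j). S t j) (UNIV \<times> {..<\<tau>})))"
    and g_eq: "\<And>t \<omega>. g t \<omega> = grad (\<lambda>u. F u (\<xi> t \<omega>)) (x t \<omega>)"
    and H_eq: "\<And>t \<omega>. H t \<omega> = hessian (\<lambda>u. F u (\<xi> t \<omega>)) (x t \<omega>)"
    and B_0: "\<And>\<omega>. B 0 \<omega> = B0"
    and B_eq: "\<And>t \<omega>. t \<ge> 1 \<Longrightarrow> B t \<omega> = (1 / real t) *\<^sub>R (\<Sum>i<t. H i \<omega>)"
    and B0_symmetric: "transpose B0 = B0"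
    and B0_lower: "\<gamma>\<^sub>H *\<^sub>R mat 1 \<preceq>\<^sub>L B0" and B0_upper: "B0 \<preceq>\<^sub>L \<Upsilon>\<^sub>H *\<^sub>R mat 1"
    and Zt_eq: "\<And>t \<omega>. Zt t \<omega> = sketch_proj (B t \<omega>) (S t 0 \<omega>)"
    and Z_eq: "\<And>t \<omega>. Z t \<omega> = cond_exp_mat M (past M P \<xi> S \<tau> t) (Zt t) \<omega>"
    and Y_eq: "\<And>t \<omega>. Y t \<omega> = cond_exp_mat M (past M P \<xi> S \<tau> t)
                         (\<lambda>\<omega>'. Zt t \<omega>' ** matrix_inv (Z t \<omega>') ** Zt t \<omega>') \<omega>"
    and \<mu>_eq: "\<And>t \<omega>. \<mu> t \<omega> = sketch_mu (Z t \<omega>)"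
    and \<nu>_eq: "\<And>t \<omega>. \<nu> t \<omega> = sketch_nu (Z t \<omega>) (Y t \<omega>)"
    and \<gamma>_eq: "\<And>t \<omega>. \<gamma> t \<omega> = 1 / sqrt (\<mu> t \<omega> * \<nu> t \<omega>)"
    and \<alpha>_eq: "\<And>t \<omega>. \<alpha> t \<omega> = 1 / (1 + \<gamma> t \<omega> * \<nu> t \<omega>)"
    and \<beta>_eq: "\<And>t \<omega>. \<beta> t \<omega> = 1 - sqrt (\<mu> t \<omega> / \<nu> t \<omega>)"
    and z_0: "\<And>t \<omega>. z t 0 \<omega> = 0" and v_0: "\<And>t \<omega>. v t 0 \<omega> = 0"
    and y_eq: "\<And>t j \<omega>. j < \<tau> \<Longrightarrow> y t j \<omega> = \<alpha> t \<omega> *\<^sub>R v t j \<omega> + (1 - \<alpha> t \<omega>) *\<^sub>R z t j \<omega>"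
    and w_eq: "\<And>t j \<omega>. j < \<tau> \<Longrightarrow>
           w t j \<omega> = sketch_step (B t \<omega>) (S t j \<omega>) *v (B t \<omega> *v y t j \<omega> + g t \<omega>)"
    and z_Suc: "\<And>t j \<omega>. j < \<tau> \<Longrightarrow> z t (Suc j) \<omega> = y t j \<omega> - w t j \<omega>"
    and v_Suc: "\<And>t j \<omega>. j < \<tau> \<Longrightarrow>
           v t (Suc j) \<omega> = \<beta> t \<omega> *\<^sub>R v t j \<omega> + (1 - \<beta> t \<omega>) *\<^sub>R y t j \<omega> - \<gamma> t \<omega> *\<^sub>R w t j \<omega>"
    and C\<^sub>\<phi>: "C\<^sub>\<phi> > 0" and \<phi>_lower: "1 / 2 < \<phi>" and \<phi>_upper: "\<phi> \<le> 1"
    and x_0: "\<And>\<omega>. x 0 \<omega> = x0"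
    and x_Suc: "\<And>t \<omega>. x (Suc t) \<omega> = x t \<omega> + (C\<^sub>\<phi> / (real t + 1) powr \<phi>) *\<^sub>R z t \<tau> \<omega>"
    and f_C2: "twice_continuously_differentiable f"
    and F_C2: "\<And>s. s \<in> space P \<Longrightarrow> twice_continuously_differentiable (\<lambda>u. F u s)"
    and \<gamma>\<^sub>H: "0 < \<gamma>\<^sub>H" and \<gamma>\<^sub>H_less: "\<gamma>\<^sub>H < \<Upsilon>\<^sub>H"
    and hessian_lower: "\<And>u s. s \<in> space P \<Longrightarrow> \<gamma>\<^sub>H \<le> lambda_min (hessian (\<lambda>u. F u s) u)"
    and hessian_upper: "\<And>u s. s \<in> space P \<Longrightarrow> lambda_max (hessian (\<lambda>u. F u s) u) \<le> \<Upsilon>\<^sub>H"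
    and C\<^sub>1: "C\<^sub>1 > 0" and C\<^sub>2: "C\<^sub>2 > 0"
    and g_mean: "\<And>t. AE \<omega> in M. cond_exp_vec M (past M P \<xi> S \<tau> t) (g t) \<omega> = grad f (x t \<omega>)"
    and g_variance: "\<And>t. AE \<omega> in M.
           nn_cond_exp M (past M P \<xi> S \<tau> t) (\<lambda>\<omega>'. ennreal ((norm (g t \<omega>' - grad f (x t \<omega>')))\<^sup>2)) \<omega>
             \<le> ennreal (C\<^sub>1 * (norm (x t \<omega> - xstar))\<^sup>2 + C\<^sub>2)"
    and \<gamma>\<^sub>S: "\<gamma>\<^sub>S > 0"
    and Z_lower: "\<And>t. AE \<omega> in M. \<gamma>\<^sub>S *\<^sub>R mat 1 \<preceq>\<^sub>L Z t \<omega>"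
    and \<tau>_condition: "\<And>t. AE \<omega> in M.
           ereal (real \<tau>) * epowi (1 - sqrt (\<mu> t \<omega> / \<nu> t \<omega>)) (int \<tau> - 2) \<le> ereal (\<gamma>\<^sub>H / (4 * \<Upsilon>\<^sub>H))"
begin

section \<open>Filtrations of the iteration and measurability of its quantities\<close>

abbreviation \<F> :: "nat \<Rightarrow> 'a measure" where "\<F> \<equiv> past M P \<xi> S \<tau>"

text \<open>The information available just before \<open>S t j\<close> is drawn, enlarged by all
  data. It contains \<open>\<F> t\<close> and makes \<open>g t\<close> measurable, while
  \<open>S t j\<close> is still independent of it.\<close>

definition \<G> :: "nat \<Rightarrow> nat \<Rightarrow> 'a measure" where
  "\<G> t j = data_sketches M P \<xi> S ({..<t} \<times> {..<\<tau>} \<union> {t} \<times> {..<j})"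

lemma \<Upsilon>\<^sub>H: "0 < \<Upsilon>\<^sub>H"
  using \<gamma>\<^sub>H \<gamma>\<^sub>H_less by linarith

lemma \<xi>_measurable: "\<xi> i \<in> M \<rightarrow>\<^sub>M P"
  using \<xi>_indep unfolding indep_vars_def2 by auto

lemma S_measurable: "j < \<tau> \<Longrightarrow> S t j \<in> borel_measurable M"
  using S_indep unfolding indep_vars_def2 by auto

lemma space_\<G> [simp]: "space (\<G> t j) = space M"
  by (simp add: \<G>_def)

lemma sets_data_sketches_subset:
  assumes "J \<subseteq> UNIV \<times> {..<\<tau>}"
  shows "sets (data_sketches M P \<xi> S J) \<subseteq> sets M"
proof -
  have "sets (gen_sigma M P \<xi> UNIV) \<subseteq> sets M"
    by (rule sets_gen_sigma_subset) (rule \<xi>_measurable)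
  moreover have "sets (gen_sigma M borel (\<lambda>(i, j). S i j) J) \<subseteq> sets M"
    by (rule sets_gen_sigma_subset) (use assms S_measurable in auto)
  ultimately show ?thesis
    unfolding sets_data_sketches by (intro sets.sigma_sets_subset Un_least)
qed

lemma subalgebra_\<G>:
  assumes "j \<le> \<tau>"
  shows "subalgebra M (\<G> t j)"
proof -
  have "{..<t} \<times> {..<\<tau>} \<union> {t} \<times> {..<j} \<subseteq> UNIV \<times> {..<\<tau>}" using assms by auto
  then show ?thesis unfolding subalgebra_def \<G>_def by (simp add: sets_data_sketches_subset)
qed

lemma sets_\<F>_subset_\<G>: "sets (\<F> t) \<subseteq> sets (\<G> t j)"
  unfolding \<G>_def by (rule sets_past_subset_data_sketches) auto

lemma subalgebra_\<F>: "subalgebra M (\<F> t)"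
  using sets_\<F>_subset_\<G>[of t 0] subalgebra_\<G>[of 0 t] by (auto simp: subalgebra_def)

lemma finite_measure_subalgebra_\<F>: "finite_measure_subalgebra M (\<F> t)"
  by unfold_locales (rule subalgebra_\<F>)

lemma \<F>_mono: "t \<le> t' \<Longrightarrow> sets (\<F> t) \<subseteq> sets (\<F> t')"
  by (rule sets_past_mono)

lemma indep_\<G>:
  assumes "j < \<tau>"
  shows "indep_set (sets (\<G> t j)) {S t j -` A \<inter> space M | A. A \<in> sets borel}"
  unfolding \<G>_def
  by (rule indep_set_data_sketches[OF \<xi>_measurable S_indep \<xi>_S_indep _ _ assms order_refl]) (use assms in auto)

lemma indep_\<F>:
  shows "indep_set (sets (\<F> t)) {S t 0 -` A \<inter> space M | A. A \<in> sets borel}"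
proof -
  have "0 < \<tau>" using \<tau> by simp
  from indep_\<G>[OF this, of t] show ?thesis
    unfolding indep_sets2_eq using sets_\<F>_subset_\<G>[of t 0] by (meson subset_trans subsetD)
qed

lemma \<xi>_space: "\<xi> i \<in> space M \<rightarrow> space P"
  using measurable_space[OF \<xi>_measurable] by blast

lemma \<xi>_measurable_\<F>: "i < t \<Longrightarrow> \<xi> i \<in> \<F> t \<rightarrow>\<^sub>M P"
  by (rule measurable_gen_sigma[OF _ \<xi>_space, where I = "{..<t}"])
    (simp_all add: sets_past subset_trans[OF Un_upper1 sigma_sets_superset_generator])

lemma S_measurable_\<F>:
  assumes "i < t" "j < \<tau>"
  shows "S i j \<in> borel_measurable (\<F> t)"
proof -
  have "(\<lambda>(i, j). S i j) (i, j) \<in> borel_measurable (\<F> t)"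
    by (rule measurable_gen_sigma[where I = "{..<t} \<times> {..<\<tau>}"])
      (use assms in \<open>simp_all add: sets_past subset_trans[OF Un_upper2 sigma_sets_superset_generator]\<close>)
  then show ?thesis by simp
qed

lemma \<xi>_measurable_\<G>: "\<xi> i \<in> \<G> t j \<rightarrow>\<^sub>M P"
  by (rule measurable_gen_sigma[OF UNIV_I \<xi>_space])
    (simp_all add: \<G>_def sets_data_sketches subset_trans[OF Un_upper1 sigma_sets_superset_generator])

lemma S_measurable_\<G>:
  assumes "k < j"
  shows "S t k \<in> borel_measurable (\<G> t j)"
proof -
  have "(\<lambda>(i, j). S i j) (t, k) \<in> borel_measurable (\<G> t j)"
    by (rule measurable_gen_sigma[where I = "{..<t} \<times> {..<\<tau>} \<union> {t} \<times> {..<j}"])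
      (use assms in \<open>simp_all add: \<G>_def sets_data_sketches subset_trans[OF Un_upper2 sigma_sets_superset_generator]\<close>)
  then show ?thesis by simp
qed

lemma \<F>_to_M: "X \<in> \<F> t \<rightarrow>\<^sub>M N \<Longrightarrow> X \<in> M \<rightarrow>\<^sub>M N"
  by (rule measurable_from_subalg[OF subalgebra_\<F>])

lemma \<F>_to_\<G>: "X \<in> \<F> t \<rightarrow>\<^sub>M N \<Longrightarrow> X \<in> \<G> t j \<rightarrow>\<^sub>M N"
  by (rule measurable_mono_sets[OF _ sets_\<F>_subset_\<G>]) simp_all

lemma \<F>_to_\<F>: "X \<in> \<F> t \<rightarrow>\<^sub>M N \<Longrightarrow> t \<le> t' \<Longrightarrow> X \<in> \<F> t' \<rightarrow>\<^sub>M N"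
  by (rule measurable_mono_sets[OF _ \<F>_mono]) simp_all

lemma cond_exp_mat_measurable: "cond_exp_mat M (\<F> t) X \<in> borel_measurable (\<F> t)"
proof (rule borel_measurable_vecI, rule borel_measurable_vecI)
  fix i j
  have "(\<lambda>\<omega>. cond_exp_mat M (\<F> t) X \<omega> $ i $ j) = real_cond_exp M (\<F> t) (\<lambda>\<omega>. X \<omega> $ i $ j)"
    by (simp add: cond_exp_mat_def fun_eq_iff)
  then show "(\<lambda>\<omega>. cond_exp_mat M (\<F> t) X \<omega> $ i $ j) \<in> borel_measurable (\<F> t)"
    by (simp only: borel_measurable_cond_exp)
qed

lemma Z_measurable: "Z t \<in> borel_measurable (\<F> t)"
proof -
  have "Z t = cond_exp_mat M (\<F> t) (Zt t)" by (rule ext) (rule Z_eq)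
  then show ?thesis using cond_exp_mat_measurable by simp
qed

lemma Y_measurable: "Y t \<in> borel_measurable (\<F> t)"
proof -
  have "Y t = cond_exp_mat M (\<F> t) (\<lambda>\<omega>'. Zt t \<omega>' ** matrix_inv (Z t \<omega>') ** Zt t \<omega>')" by (rule ext) (rule Y_eq)
  then show ?thesis using cond_exp_mat_measurable by simp
qed

lemma \<mu>_measurable: "\<mu> t \<in> borel_measurable (\<F> t)"
proof -
  note [measurable] = Z_measurable
  have "\<mu> t = (\<lambda>\<omega>. sketch_mu (Z t \<omega>))" by (rule ext) (rule \<mu>_eq)
  then show ?thesis by simp
qed

lemma \<nu>_measurable: "\<nu> t \<in> borel_measurable (\<F> t)"
proof -
  note [measurable] = Z_measurable Y_measurable
  have "\<nu> t = (\<lambda>\<omega>. sketch_nu (Z t \<omega>) (Y t \<omega>))" by (rule ext) (rule \<nu>_eq)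
  then show ?thesis by simp
qed

lemma \<gamma>_measurable: "\<gamma> t \<in> borel_measurable (\<F> t)"
proof -
  note [measurable] = \<mu>_measurable \<nu>_measurable
  have "\<gamma> t = (\<lambda>\<omega>. 1 / sqrt (\<mu> t \<omega> * \<nu> t \<omega>))" by (rule ext) (rule \<gamma>_eq)
  then show ?thesis by simp
qed

lemma \<alpha>_measurable: "\<alpha> t \<in> borel_measurable (\<F> t)"
proof -
  note [measurable] = \<gamma>_measurable \<nu>_measurable
  have "\<alpha> t = (\<lambda>\<omega>. 1 / (1 + \<gamma> t \<omega> * \<nu> t \<omega>))" by (rule ext) (rule \<alpha>_eq)
  then show ?thesis by simp
qed

lemma \<beta>_measurable: "\<beta> t \<in> borel_measurable (\<F> t)"
proof -
  note [measurable] = \<mu>_measurable \<nu>_measurable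
  have "\<beta> t = (\<lambda>\<omega>. 1 - sqrt (\<mu> t \<omega> / \<nu> t \<omega>))" by (rule ext) (rule \<beta>_eq)
  then show ?thesis by simp
qed

text \<open>Stated for an arbitrary \<sigma>-algebra because it is applied to the past, to the
  larger \<open>\<G> t j\<close> and to \<open>M\<close> itself.\<close>

lemma oracle_measurable:
  assumes "x t \<in> borel_measurable \<A>" "\<xi> t \<in> \<A> \<rightarrow>\<^sub>M P"
  shows "g t \<in> borel_measurable \<A>" "H t \<in> borel_measurable \<A>"
proof -
  have pair: "(\<lambda>\<omega>. (x t \<omega>, \<xi> t \<omega>)) \<in> \<A> \<rightarrow>\<^sub>M borel \<Otimes>\<^sub>M P" using assms by measurable
  have Fm: "F u \<in> borel_measurable P" for u using F_integrable by (rule borel_measurable_integrable)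
  have "g t = (\<lambda>\<omega>. grad (\<lambda>u. F u (\<xi> t \<omega>)) (x t \<omega>))" by (rule ext) (rule g_eq)
  then show "g t \<in> borel_measurable \<A>"
    using measurable_compose[OF pair borel_measurable_grad_hessian(1)[OF Fm F_C2]] by simp
  have "H t = (\<lambda>\<omega>. hessian (\<lambda>u. F u (\<xi> t \<omega>)) (x t \<omega>))" by (rule ext) (rule H_eq)
  then show "H t \<in> borel_measurable \<A>"
    using measurable_compose[OF pair borel_measurable_grad_hessian(2)[OF Fm F_C2]] by simp
qed

lemma solver_measurable:
  assumes \<F>: "\<And>X :: 'a \<Rightarrow> real. X \<in> borel_measurable (\<F> t) \<Longrightarrow> X \<in> borel_measurable \<A>"
    and [measurable]: "B t \<in> borel_measurable \<A>" "g t \<in> borel_measurable \<A>"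
    and S: "\<And>k. k < j \<Longrightarrow> S t k \<in> borel_measurable \<A>" and j: "j \<le> \<tau>"
  shows "z t j \<in> borel_measurable \<A> \<and> v t j \<in> borel_measurable \<A>"
proof -
  note [measurable] = \<F>[OF \<alpha>_measurable] \<F>[OF \<beta>_measurable] \<F>[OF \<gamma>_measurable]
  have "i \<le> j \<Longrightarrow> z t i \<in> borel_measurable \<A> \<and> v t i \<in> borel_measurable \<A>" for i
  proof (induction i)
    case 0
    have "z t 0 = (\<lambda>_. 0)" "v t 0 = (\<lambda>_. 0)" using z_0 v_0 by auto
    then show ?case by simp
  next
    case (Suc i)
    then have i: "i < \<tau>" and [measurable]: "z t i \<in> borel_measurable \<A>" "v t i \<in> borel_measurable \<A>" "S t i \<in> borel_measurable \<A>"
      using S j by auto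
    have "y t i = (\<lambda>\<omega>. \<alpha> t \<omega> *\<^sub>R v t i \<omega> + (1 - \<alpha> t \<omega>) *\<^sub>R z t i \<omega>)" using y_eq[OF i] by auto
    then have [measurable]: "y t i \<in> borel_measurable \<A>" by simp
    have "w t i = (\<lambda>\<omega>. sketch_step (B t \<omega>) (S t i \<omega>) *v (B t \<omega> *v y t i \<omega> + g t \<omega>))" using w_eq[OF i] by auto
    then have [measurable]: "w t i \<in> borel_measurable \<A>" by simp
    have "z t (Suc i) = (\<lambda>\<omega>. y t i \<omega> - w t i \<omega>)" using z_Suc[OF i] by auto
    moreover have "v t (Suc i) = (\<lambda>\<omega>. \<beta> t \<omega> *\<^sub>R v t i \<omega> + (1 - \<beta> t \<omega>) *\<^sub>R y t i \<omega> - \<gamma> t \<omega> *\<^sub>R w t i \<omega>)"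
      using v_Suc[OF i] by auto
    ultimately show ?case by simp
  qed
  then show ?thesis by simp
qed

text \<open>Split off to break a circle: \<open>B t\<close> depends on all earlier iterates through
  the Hessians, and \<open>x (Suc t)\<close> depends on \<open>B t\<close>. That the average stops
  before \<open>t\<close> is what makes \<open>B t\<close> a function of the past.\<close>

lemma B_measurable_if:
  assumes "\<And>i. i < t \<Longrightarrow> x i \<in> borel_measurable (\<F> i)"
  shows "B t \<in> borel_measurable (\<F> t)"
proof (cases "t = 0")
  case True
  then have "B t = (\<lambda>_. B0)" using B_0 by auto
  then show ?thesis by simp
next
  case False
  have [measurable]: "H i \<in> borel_measurable (\<F> t)" if "i < t" for i
    using oracle_measurable(2)[OF \<F>_to_\<F>[OF assms[OF that] less_imp_le[OF that]] \<xi>_measurable_\<F>[OF that]] .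
  have "B t = (\<lambda>\<omega>. (1 / real t) *\<^sub>R (\<Sum>i<t. H i \<omega>))" using B_eq[of t] False by auto
  then show ?thesis by simp
qed

lemma x_measurable: "x t \<in> borel_measurable (\<F> t)"
proof (induction t rule: less_induct)
  case (less t)
  show ?case
  proof (cases t)
    case 0
    then have "x t = (\<lambda>_. x0)" using x_0 by auto
    then show ?thesis by simp
  next
    case (Suc k)
    have k: "k < t" using Suc by simp
    have x: "x k \<in> borel_measurable (\<F> t)" by (rule \<F>_to_\<F>[OF less[OF k] less_imp_le[OF k]])
    have "B k \<in> borel_measurable (\<F> k)" using less k by (intro B_measurable_if) auto
    then have "B k \<in> borel_measurable (\<F> t)" by (rule \<F>_to_\<F>) (simp add: Suc)
    moreover have "g k \<in> borel_measurable (\<F> t)" by (rule oracle_measurable(1)[OF x \<xi>_measurable_\<F>[OF k]])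
    ultimately have "z k \<tau> \<in> borel_measurable (\<F> t)"
      using solver_measurable[of k "\<F> t" \<tau>] \<F>_to_\<F>[of _ k borel t] S_measurable_\<F>[of k t] Suc by auto
    moreover have "x t = (\<lambda>\<omega>. x k \<omega> + (C\<^sub>\<phi> / (real k + 1) powr \<phi>) *\<^sub>R z k \<tau> \<omega>)" using x_Suc Suc by auto
    ultimately show ?thesis using x by simp
  qed
qed

lemma B_measurable: "B t \<in> borel_measurable (\<F> t)"
  by (rule B_measurable_if) (rule x_measurable)

lemma g_measurable_\<G>: "g t \<in> borel_measurable (\<G> t j)"
  by (rule oracle_measurable(1)[OF \<F>_to_\<G>[OF x_measurable] \<xi>_measurable_\<G>])

lemma g_measurable: "g t \<in> borel_measurable M"
  by (rule oracle_measurable(1)[OF \<F>_to_M[OF x_measurable] \<xi>_measurable])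

lemma solver_measurable_\<G>:
  assumes "j \<le> \<tau>"
  shows "z t j \<in> borel_measurable (\<G> t j)" "v t j \<in> borel_measurable (\<G> t j)"
  using solver_measurable[OF \<F>_to_\<G> \<F>_to_\<G>[OF B_measurable] g_measurable_\<G> S_measurable_\<G> assms] by blast+

section \<open>Curvature of the averaged Hessians and of the objective\<close>

lemma hessian_bounds:
  assumes "s \<in> space P"
  shows "transpose (hessian (\<lambda>u. F u s) u) = hessian (\<lambda>u. F u s) u"
    and "\<gamma>\<^sub>H * (a \<bullet> a) \<le> a \<bullet> (hessian (\<lambda>u. F u s) u *v a)"
    and "a \<bullet> (hessian (\<lambda>u. F u s) u *v a) \<le> \<Upsilon>\<^sub>H * (a \<bullet> a)"
proof -
  show sym: "transpose (hessian (\<lambda>u. F u s) u) = hessian (\<lambda>u. F u s) u"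
    by (rule hessian_symmetric[OF F_C2[OF assms]])
  show "\<gamma>\<^sub>H * (a \<bullet> a) \<le> a \<bullet> (hessian (\<lambda>u. F u s) u *v a)"
    using lambda_min_le_quadratic_form[OF sym] hessian_lower[OF assms]
    by (meson inner_ge_zero mult_right_mono order_trans)
  show "a \<bullet> (hessian (\<lambda>u. F u s) u *v a) \<le> \<Upsilon>\<^sub>H * (a \<bullet> a)"
    using quadratic_form_le_lambda_max[OF sym] hessian_upper[OF assms]
    by (meson inner_ge_zero mult_right_mono order_trans)
qed

lemma B_bounds:
  assumes \<omega>: "\<omega> \<in> space M"
  shows "transpose (B t \<omega>) = B t \<omega>" "\<gamma>\<^sub>H * (a \<bullet> a) \<le> a \<bullet> (B t \<omega> *v a)" "a \<bullet> (B t \<omega> *v a) \<le> \<Upsilon>\<^sub>H * (a \<bullet> a)"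
proof -
  have s: "\<xi> i \<omega> \<in> space P" for i using measurable_space[OF \<xi>_measurable \<omega>] .
  have Hb: "transpose (H i \<omega>) = H i \<omega>" "\<gamma>\<^sub>H * (a \<bullet> a) \<le> a \<bullet> (H i \<omega> *v a)"
    "a \<bullet> (H i \<omega> *v a) \<le> \<Upsilon>\<^sub>H * (a \<bullet> a)" for i a
    unfolding H_eq by (rule hessian_bounds[OF s])+
  have form: "a \<bullet> (((1 / real t) *\<^sub>R (\<Sum>i<t. H i \<omega>)) *v a) = (\<Sum>i<t. a \<bullet> (H i \<omega> *v a)) / real t" for t
  proof -
    have "(\<Sum>i<t. H i \<omega>) *v a = (\<Sum>i<t. H i \<omega> *v a)"
      by (induction t) (simp_all add: matrix_vector_mult_add_rdistrib)
    then show ?thesis by (simp add: inner_sum_right flip: scaleR_matrix_vector_assoc)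
  qed
  show "transpose (B t \<omega>) = B t \<omega>"
  proof (cases "t = 0")
    case False
    have "transpose (\<Sum>i<n. H i \<omega>) = (\<Sum>i<n. H i \<omega>)" for n
      by (induction n) (simp_all add: transpose_add Hb, simp add: transpose_def vec_eq_iff)
    then show ?thesis using B_eq[of t \<omega>] False by (simp add: transpose_scalar)
  qed (simp add: B_0 B0_symmetric)
  show "\<gamma>\<^sub>H * (a \<bullet> a) \<le> a \<bullet> (B t \<omega> *v a)"
  proof (cases "t = 0")
    case True
    then show ?thesis using loewner_le_form[OF B0_lower, of a] by (simp add: B_0 scaleR_mat_form)
  next
    case False
    have "(\<Sum>i<t. \<gamma>\<^sub>H * (a \<bullet> a)) \<le> (\<Sum>i<t. a \<bullet> (H i \<omega> *v a))" by (intro sum_mono Hb)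
    then show ?thesis using False B_eq[of t \<omega>] by (simp add: form pos_le_divide_eq mult.commute)
  qed
  show "a \<bullet> (B t \<omega> *v a) \<le> \<Upsilon>\<^sub>H * (a \<bullet> a)"
  proof (cases "t = 0")
    case True
    then show ?thesis using loewner_le_form[OF B0_upper, of a] by (simp add: B_0 scaleR_mat_form)
  next
    case False
    have "(\<Sum>i<t. a \<bullet> (H i \<omega> *v a)) \<le> (\<Sum>i<t. \<Upsilon>\<^sub>H * (a \<bullet> a))" by (intro sum_mono Hb)
    then show ?thesis using False B_eq[of t \<omega>] by (simp add: form pos_divide_le_eq mult.commute)
  qed
qed

text \<open>The upper bound is the curvature bound \<open>- \<Upsilon>\<^sub>H\<close> of
  \<open>- F\<close>. Both bounds pass to the expectation in derivative-free form and only then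
  become gradient inequalities of \<open>f\<close>.\<close>

lemma f_bounds:
  shows "f u + (u' - u) \<bullet> grad f u + \<gamma>\<^sub>H / 2 * (norm (u' - u))\<^sup>2 \<le> f u'"
    and "f u' \<le> f u + (u' - u) \<bullet> grad f u + \<Upsilon>\<^sub>H / 2 * (norm (u' - u))\<^sup>2"
proof -
  have f: "f = (\<lambda>u. \<integral>s. F u s \<partial>P)" using f_eq by auto
  have grad_f: "(f has_derivative (\<lambda>h. h \<bullet> grad f u)) (at u)" for u
    by (rule twice_continuously_differentiableD(1)[OF f_C2])
  have "curvature_ge \<gamma>\<^sub>H (\<lambda>u. \<integral>s. F u s \<partial>P)"
  proof (rule curvature_ge_integral[OF P.prob_space_axioms F_integrable])
    fix s assume s: "s \<in> space P"
    show "curvature_ge \<gamma>\<^sub>H (\<lambda>u. F u s)"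
      by (rule curvature_geI, rule gradient_inequality[OF twice_continuously_differentiableD[OF F_C2[OF s]]])
        (rule hessian_bounds[OF s])
  qed
  then have "curvature_ge \<gamma>\<^sub>H f" by (simp add: f)
  from curvature_ge_gradient[OF this grad_f]
  show "f u + (u' - u) \<bullet> grad f u + \<gamma>\<^sub>H / 2 * (norm (u' - u))\<^sup>2 \<le> f u'" .
  have "curvature_ge (- \<Upsilon>\<^sub>H) (\<lambda>u. \<integral>s. - F u s \<partial>P)"
  proof (rule curvature_ge_integral[OF P.prob_space_axioms])
    show "integrable P (\<lambda>s. - F u s)" for u using F_integrable by simp
    fix s assume s: "s \<in> space P"
    note d = twice_continuously_differentiableD[OF F_C2[OF s]]
    show "curvature_ge (- \<Upsilon>\<^sub>H) (\<lambda>u. - F u s)"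
    proof (rule curvature_geI, rule gradient_inequality)
      show "((\<lambda>u. - F u s) has_derivative (\<lambda>h. h \<bullet> - grad (\<lambda>u. F u s) y)) (at y)" for y
        using has_derivative_minus[OF d(1)] by simp
      show "((\<lambda>y. - grad (\<lambda>u. F u s) y) has_derivative (\<lambda>h. (- hessian (\<lambda>u. F u s) y) *v h)) (at y)" for y
        using has_derivative_minus[OF d(2)] by (simp add: uminus_matrix_vector)
      show "- \<Upsilon>\<^sub>H * (h \<bullet> h) \<le> h \<bullet> ((- hessian (\<lambda>u. F u s) y) *v h)" for y h
        using hessian_bounds(3)[OF s, of h y] by (simp add: uminus_matrix_vector)
    qed
  qed
  then have "curvature_ge (- \<Upsilon>\<^sub>H) (\<lambda>u. - f u)" by (simp add: f)
  moreover have "((\<lambda>u. - f u) has_derivative (\<lambda>h. h \<bullet> - grad f u)) (at u)"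
    using has_derivative_minus[OF grad_f] by simp
  ultimately have "- f u + (u' - u) \<bullet> - grad f u + - \<Upsilon>\<^sub>H / 2 * (norm (u' - u))\<^sup>2 \<le> - f u'"
    by (rule curvature_ge_gradient)
  then show "f u' \<le> f u + (u' - u) \<bullet> grad f u + \<Upsilon>\<^sub>H / 2 * (norm (u' - u))\<^sup>2" by simp
qed

lemma xstar_le: "f xstar \<le> f u"
  using xstar by (auto simp: is_arg_min_def not_less)

lemmas gap_bounds = minimizer_bounds[of f "grad f", OF f_bounds \<gamma>\<^sub>H \<Upsilon>\<^sub>H xstar_le]

end

lemma norm_transpose_bound:
  fixes A :: "real^'n^'m"
  assumes "\<And>a. norm (A *v a) \<le> C * norm a"
  shows "norm (transpose A *v v) \<le> C * norm v"
proof (cases "transpose A *v v = 0")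
  case True
  have "0 \<le> C"
    using assms[of "axis undefined 1"] norm_ge_zero[of "A *v axis undefined 1"] by (simp del: norm_ge_zero)
  then show ?thesis using True by simp
next
  case False
  let ?u = "transpose A *v v"
  have "norm ?u * norm ?u = (A *v ?u) \<bullet> v"
    by (simp only: dot_matrix_vector power2_norm_eq_inner[symmetric] power2_eq_square)
  also have "\<dots> \<le> (C * norm ?u) * norm v"
    using norm_cauchy_schwarz[of "A *v ?u" v] mult_right_mono[OF assms[of ?u], of "norm v"] by simp
  finally show ?thesis using False by simp
qed

lemma borel_measurable_mean_error:
  fixes Z :: "'a \<Rightarrow> real^'n^'n"
  assumes [measurable]: "a \<in> borel_measurable M" "b \<in> borel_measurable M" "c \<in> borel_measurable M" "Z \<in> borel_measurable M"
  shows "(\<lambda>\<omega>. fst (mean_error (a \<omega>) (b \<omega>) (c \<omega>) (Z \<omega>) j)) \<in> borel_measurable M \<and>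
    (\<lambda>\<omega>. snd (mean_error (a \<omega>) (b \<omega>) (c \<omega>) (Z \<omega>) j)) \<in> borel_measurable M"
proof (induction j)
  case (Suc j)
  then have [measurable]: "(\<lambda>\<omega>. fst (mean_error (a \<omega>) (b \<omega>) (c \<omega>) (Z \<omega>) j)) \<in> borel_measurable M"
    "(\<lambda>\<omega>. snd (mean_error (a \<omega>) (b \<omega>) (c \<omega>) (Z \<omega>) j)) \<in> borel_measurable M" by auto
  show ?case by (simp add: Let_def)
qed simp

context sketched_newton
begin

section \<open>Means over a fresh sketch and pathwise bounds for the solver errors\<close>

lemma prob_space_D: "prob_space D"
  using prob_space_distr[OF S_measurable[of 0 0]] S_distr[of 0 0] \<tau> by simp

lemma sets_D: "sets D = sets borel"
  using S_distr[of 0 0] \<tau> sets_distr[of M borel "S 0 0"] by simp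

lemma sketch_proj_projection:
  assumes "\<omega> \<in> space M"
  shows "transpose (sketch_proj (B t \<omega>) s) = sketch_proj (B t \<omega>) s"
    and "sketch_proj (B t \<omega>) s ** sketch_proj (B t \<omega>) s = sketch_proj (B t \<omega>) s"
  using sketch_proj_symmetric[OF B_bounds(1)[OF assms]] by auto

lemma sketch_proj_bound: "\<omega> \<in> space M \<Longrightarrow> norm (sketch_proj (B t \<omega>) s *v a) \<le> norm a"
  by (intro orthogonal_projection_bounds sketch_proj_projection)

lemma cond_exp_mat_freeze:
  fixes h :: "'a \<Rightarrow> real^'s^'d \<Rightarrow> real^'d^'d"
  assumes h: "(\<lambda>p. h (fst p) (snd p)) \<in> borel_measurable (\<F> t \<Otimes>\<^sub>M borel)"
    and bound: "AE \<omega> in M. \<forall>s a. norm (h \<omega> s *v a) \<le> C * norm a"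
  shows "AE \<omega> in M. cond_exp_mat M (\<F> t) (\<lambda>\<omega>. h \<omega> (S t 0 \<omega>)) \<omega> = (\<chi> i j. \<integral>s. h \<omega> s $ i $ j \<partial>D)"
proof -
  have [measurable]: "S t 0 \<in> borel_measurable M" using S_measurable \<tau> by simp
  have h1: "(\<lambda>p. h (fst p) (snd p) $ i $ j) \<in> borel_measurable (\<F> t \<Otimes>\<^sub>M borel)" for i j
    using h by measurable
  have "AE \<omega> in M. real_cond_exp M (\<F> t) (\<lambda>\<omega>. h \<omega> (S t 0 \<omega>) $ i $ j) \<omega> = (\<integral>s. h \<omega> s $ i $ j \<partial>D)" for i j
  proof -
    have id: "(\<lambda>\<omega>. (\<omega>, S t 0 \<omega>)) \<in> M \<rightarrow>\<^sub>M \<F> t \<Otimes>\<^sub>M borel"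
      by (intro measurable_Pair \<F>_to_M[OF measurable_ident_sets[OF refl]]) measurable
    have "integrable M (\<lambda>\<omega>. h \<omega> (S t 0 \<omega>) $ i $ j)"
    proof (rule integrable_const_bound)
      show "AE \<omega> in M. norm (h \<omega> (S t 0 \<omega>) $ i $ j) \<le> C"
        using bound by eventually_elim (simp add: matrix_entry_bound)
      show "(\<lambda>\<omega>. h \<omega> (S t 0 \<omega>) $ i $ j) \<in> borel_measurable M"
        using measurable_compose[OF id h1[of i j]] by simp
    qed
    then have int: "integrable M (\<lambda>\<omega>. (\<lambda>p. h (fst p) (snd p) $ i $ j) (\<omega>, S t 0 \<omega>))" by simp
    have tau0: "0 < \<tau>" using \<tau> by simp
    from real_cond_exp_freeze[OF subalgebra_\<F> S_measurable[OF tau0] indep_\<F> S_distr[OF tau0] h1[of i j] int]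
    show ?thesis by simp
  qed
  then have "AE \<omega> in M. \<forall>i j. real_cond_exp M (\<F> t) (\<lambda>\<omega>. h \<omega> (S t 0 \<omega>) $ i $ j) \<omega> = (\<integral>s. h \<omega> s $ i $ j \<partial>D)"
    by (simp add: AE_all_countable)
  then show ?thesis by eventually_elim (simp add: cond_exp_mat_def)
qed

text \<open>In this form only \<open>B t\<close> and the law \<open>D\<close> of a sketch remain,
  not the particular copy \<open>S t 0\<close> that defines \<open>Z t\<close>; hence the same
  matrix is the mean of the projections for every \<open>S t j\<close>.\<close>

lemma Z_freeze: "AE \<omega> in M. Z t \<omega> = (\<chi> i j. \<integral>s. sketch_proj (B t \<omega>) s $ i $ j \<partial>D)"
proof -
  note [measurable] = B_measurable
  have "Zt t = (\<lambda>\<omega>. sketch_proj (B t \<omega>) (S t 0 \<omega>))" by (rule ext) (rule Zt_eq)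
  moreover have "AE \<omega> in M. cond_exp_mat M (\<F> t) (\<lambda>\<omega>. sketch_proj (B t \<omega>) (S t 0 \<omega>)) \<omega> = (\<chi> i j. \<integral>s. sketch_proj (B t \<omega>) s $ i $ j \<partial>D)"
    by (rule cond_exp_mat_freeze[where C = 1]) (measurable, auto intro!: AE_I2 sketch_proj_bound)
  ultimately show ?thesis by (simp add: Z_eq)
qed

lemma Y_freeze: "AE \<omega> in M. Y t \<omega> =
    (\<chi> i j. \<integral>s. (sketch_proj (B t \<omega>) s ** matrix_inv (Z t \<omega>) ** sketch_proj (B t \<omega>) s) $ i $ j \<partial>D)"
proof -
  note [measurable] = B_measurable Z_measurable
  let ?h = "\<lambda>\<omega> s. sketch_proj (B t \<omega>) s ** matrix_inv (Z t \<omega>) ** sketch_proj (B t \<omega>) s"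
  have "AE \<omega> in M. cond_exp_mat M (\<F> t) (\<lambda>\<omega>. ?h \<omega> (S t 0 \<omega>)) \<omega> = (\<chi> i j. \<integral>s. ?h \<omega> s $ i $ j \<partial>D)"
  proof (rule cond_exp_mat_freeze[where C = "1 / \<gamma>\<^sub>S"])
    show "(\<lambda>p. ?h (fst p) (snd p)) \<in> borel_measurable (\<F> t \<Otimes>\<^sub>M borel)" by measurable
    show "AE \<omega> in M. \<forall>s a. norm (?h \<omega> s *v a) \<le> 1 / \<gamma>\<^sub>S * norm a"
      using Z_lower[of t] AE_space
    proof eventually_elim
      case (elim \<omega>)
      have "\<gamma>\<^sub>S * (a \<bullet> a) \<le> a \<bullet> (Z t \<omega> *v a)" for a
        using loewner_le_form[OF elim(1), of a] by (simp add: scaleR_mat_form)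
      then show ?case using projection_sandwich_bound[OF sketch_proj_projection[OF elim(2)] _ \<gamma>\<^sub>S] by blast
    qed
  qed
  then show ?thesis by (simp add: Y_eq Zt_eq)
qed

text \<open>Collects the pointwise facts that hold almost everywhere by (iv) and (v). The pathwise
  estimates of the solver are made at such points, without further appeal to conditional
  expectations.\<close>

definition regular :: "nat \<Rightarrow> 'a \<Rightarrow> bool" where
  "regular t \<omega> \<longleftrightarrow> transpose (Z t \<omega>) = Z t \<omega> \<and>
    (\<forall>a. \<mu> t \<omega> * (a \<bullet> a) \<le> a \<bullet> (Z t \<omega> *v a) \<and> a \<bullet> (Z t \<omega> *v a) \<le> a \<bullet> a) \<and>
    \<gamma>\<^sub>S \<le> \<mu> t \<omega> \<and> \<mu> t \<omega> \<le> 1 \<and> 1 \<le> \<nu> t \<omega> \<and> 2 * real \<tau> * \<beta> t \<omega> ^ (\<tau> - 1) \<le> \<gamma>\<^sub>H / (2 * \<Upsilon>\<^sub>H)"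

lemma \<beta>_bounds:
  assumes "\<gamma>\<^sub>S \<le> \<mu> t \<omega>" "\<mu> t \<omega> \<le> 1" "1 \<le> \<nu> t \<omega>"
  shows "0 \<le> \<beta> t \<omega>" "\<beta> t \<omega> \<le> 1"
proof -
  have "0 \<le> \<mu> t \<omega> / \<nu> t \<omega>" "\<mu> t \<omega> / \<nu> t \<omega> \<le> 1" using assms \<gamma>\<^sub>S by (auto simp: field_simps)
  then show "0 \<le> \<beta> t \<omega>" "\<beta> t \<omega> \<le> 1" by (auto simp: \<beta>_eq)
qed

lemma AE_regular: "AE \<omega> in M. regular t \<omega>"
  using Z_freeze[of t] Y_freeze[of t] Z_lower[of t] \<tau>_condition[of t] AE_space
proof eventually_elim
  case (elim \<omega>)
  have Qm: "(\<lambda>s. sketch_proj (B t \<omega>) s) \<in> borel_measurable D"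
    using sets_D by measurable
  note par = sketch_parameter_bounds[OF prob_space_D Qm _ elim(1) elim(2) elim(3) \<gamma>\<^sub>S, folded \<mu>_eq \<nu>_eq]
  have proj: "transpose (sketch_proj (B t \<omega>) s) = sketch_proj (B t \<omega>) s \<and>
      sketch_proj (B t \<omega>) s ** sketch_proj (B t \<omega>) s = sketch_proj (B t \<omega>) s" for s
    using sketch_proj_projection[OF elim(5)] by blast
  have mn: "\<gamma>\<^sub>S \<le> \<mu> t \<omega>" "\<mu> t \<omega> \<le> 1" "1 \<le> \<nu> t \<omega>" using par proj by blast+
  have "2 * real \<tau> * \<beta> t \<omega> ^ (\<tau> - 1) \<le> \<gamma>\<^sub>H / (2 * \<Upsilon>\<^sub>H)"
    by (rule iteration_condition_bound[OF \<tau> \<beta>_bounds[OF mn] \<gamma>\<^sub>H \<gamma>\<^sub>H_less]) (use elim(4) in \<open>simp add: \<beta>_eq\<close>)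
  then show ?case unfolding regular_def using par proj mn by blast
qed

text \<open>The bound on \<open>\<gamma> t\<close> comes from
  \<open>\<mu> t \<omega> * \<nu> t \<omega> >= \<gamma>\<^sub>S\<close> and is nonrandom. This
  makes the growth factor of the solver errors a constant, on which their square integrability
  rests.\<close>

lemma regularD:
  assumes "regular t \<omega>"
  shows "0 \<le> \<alpha> t \<omega>" "\<alpha> t \<omega> \<le> 1" "0 \<le> \<beta> t \<omega>" "\<beta> t \<omega> \<le> 1" "0 \<le> \<gamma> t \<omega>" "\<gamma> t \<omega> \<le> 1 / sqrt \<gamma>\<^sub>S"
    and "norm (Z t \<omega> *v a) \<le> norm a" "norm (a - Z t \<omega> *v a) \<le> norm a"
    and "norm (fst (mean_error (\<alpha> t \<omega>) (\<beta> t \<omega>) (\<gamma> t \<omega>) (Z t \<omega>) \<tau>) *v a) \<le> \<gamma>\<^sub>H / (2 * \<Upsilon>\<^sub>H) * norm a"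
proof -
  have sym: "transpose (Z t \<omega>) = Z t \<omega>" and lo: "\<And>a. \<mu> t \<omega> * (a \<bullet> a) \<le> a \<bullet> (Z t \<omega> *v a)"
    and up: "\<And>a. a \<bullet> (Z t \<omega> *v a) \<le> a \<bullet> a" and mu: "\<gamma>\<^sub>S \<le> \<mu> t \<omega>" "\<mu> t \<omega> \<le> 1" and nu: "1 \<le> \<nu> t \<omega>"
    and tau: "2 * real \<tau> * \<beta> t \<omega> ^ (\<tau> - 1) \<le> \<gamma>\<^sub>H / (2 * \<Upsilon>\<^sub>H)"
    using assms unfolding regular_def by blast+
  have mu0: "0 < \<mu> t \<omega>" using mu \<gamma>\<^sub>S by linarith
  show "0 \<le> \<beta> t \<omega>" "\<beta> t \<omega> \<le> 1" by (rule \<beta>_bounds[OF mu nu])+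
  have prod: "\<gamma>\<^sub>S \<le> \<mu> t \<omega> * \<nu> t \<omega>"
    using mult_mono[of \<gamma>\<^sub>S "\<mu> t \<omega>" 1 "\<nu> t \<omega>"] mu nu \<gamma>\<^sub>S by simp
  show g0: "0 \<le> \<gamma> t \<omega>" using mu0 nu by (simp add: \<gamma>_eq)
  show "\<gamma> t \<omega> \<le> 1 / sqrt \<gamma>\<^sub>S" unfolding \<gamma>_eq using prod \<gamma>\<^sub>S by (intro divide_left_mono) auto
  have "0 \<le> \<gamma> t \<omega> * \<nu> t \<omega>" using g0 nu by simp
  then show "0 \<le> \<alpha> t \<omega>" "\<alpha> t \<omega> \<le> 1" by (simp_all add: \<alpha>_eq)
  show "norm (Z t \<omega> *v a) \<le> norm a" "norm (a - Z t \<omega> *v a) \<le> norm a"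
    by (rule psd_contraction[OF sym lo up mu0])+
  obtain n where n: "\<tau> = Suc n" using \<tau> by (cases \<tau>) auto
  have "norm (fst (mean_error (\<alpha> t \<omega>) (\<beta> t \<omega>) (\<gamma> t \<omega>) (Z t \<omega>) (Suc n)) *v a) \<le> 2 * real (Suc n) * \<beta> t \<omega> ^ n * norm a"
    unfolding \<alpha>_eq \<beta>_eq \<gamma>_eq by (rule mean_error_bound[OF sym lo up mu0 nu])
  also have "\<dots> \<le> \<gamma>\<^sub>H / (2 * \<Upsilon>\<^sub>H) * norm a" using tau n by (intro mult_right_mono) auto
  finally show "norm (fst (mean_error (\<alpha> t \<omega>) (\<beta> t \<omega>) (\<gamma> t \<omega>) (Z t \<omega>) \<tau>) *v a) \<le> \<gamma>\<^sub>H / (2 * \<Upsilon>\<^sub>H) * norm a"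
    unfolding n .
qed

text \<open>\<open>- newton t\<close> solves the Newton system, so the following are the errors of the two solver sequences.\<close>

definition newton :: "nat \<Rightarrow> 'a \<Rightarrow> real^'d" where
  "newton t \<omega> = matrix_inv (B t \<omega>) *v g t \<omega>"

definition z_error :: "nat \<Rightarrow> nat \<Rightarrow> 'a \<Rightarrow> real^'d" where
  "z_error t j \<omega> = z t j \<omega> + newton t \<omega>"

definition v_error :: "nat \<Rightarrow> nat \<Rightarrow> 'a \<Rightarrow> real^'d" where
  "v_error t j \<omega> = v t j \<omega> + newton t \<omega>"

definition y_error :: "nat \<Rightarrow> nat \<Rightarrow> 'a \<Rightarrow> real^'d" where
  "y_error t j \<omega> = \<alpha> t \<omega> *\<^sub>R v_error t j \<omega> + (1 - \<alpha> t \<omega>) *\<^sub>R z_error t j \<omega>"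

lemma B_newton: "\<omega> \<in> space M \<Longrightarrow> B t \<omega> *v newton t \<omega> = g t \<omega>"
  using form_bounds_matrix_inv(1)[OF B_bounds(2) \<gamma>\<^sub>H] by (simp add: newton_def matrix_vector_mul_assoc)

lemma newton_bound: "\<omega> \<in> space M \<Longrightarrow> norm (newton t \<omega>) \<le> norm (g t \<omega>) / \<gamma>\<^sub>H"
  unfolding newton_def by (rule form_bounds_matrix_inv(3)[OF B_bounds(2) \<gamma>\<^sub>H])

text \<open>Since \<open>B y + g = B (y + newton)\<close>, the affine solver step becomes linear in
  the errors, with the projection \<open>sketch_proj\<close> as its only random matrix.\<close>

lemma error_Suc:
  assumes "\<omega> \<in> space M" "j < \<tau>"
  shows "z_error t (Suc j) \<omega> = y_error t j \<omega> - sketch_proj (B t \<omega>) (S t j \<omega>) *v y_error t j \<omega>"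
    and "v_error t (Suc j) \<omega> = \<beta> t \<omega> *\<^sub>R v_error t j \<omega> + (1 - \<beta> t \<omega>) *\<^sub>R y_error t j \<omega>
      - \<gamma> t \<omega> *\<^sub>R (sketch_proj (B t \<omega>) (S t j \<omega>) *v y_error t j \<omega>)"
proof -
  have y: "y_error t j \<omega> = y t j \<omega> + newton t \<omega>"
    by (simp add: y_error_def v_error_def z_error_def y_eq[OF assms(2)] algebra_simps)
  have w: "w t j \<omega> = sketch_proj (B t \<omega>) (S t j \<omega>) *v y_error t j \<omega>"
    unfolding y w_eq[OF assms(2)] sketch_proj_def
    by (simp only: B_newton[OF assms(1), symmetric] matrix_vector_right_distrib matrix_vector_mul_assoc)
  show "z_error t (Suc j) \<omega> = y_error t j \<omega> - sketch_proj (B t \<omega>) (S t j \<omega>) *v y_error t j \<omega>"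
    unfolding w[symmetric] by (simp add: y z_error_def z_Suc[OF assms(2)])
  show "v_error t (Suc j) \<omega> = \<beta> t \<omega> *\<^sub>R v_error t j \<omega> + (1 - \<beta> t \<omega>) *\<^sub>R y_error t j \<omega>
      - \<gamma> t \<omega> *\<^sub>R (sketch_proj (B t \<omega>) (S t j \<omega>) *v y_error t j \<omega>)"
    unfolding w[symmetric] by (simp add: y v_error_def v_Suc[OF assms(2)] algebra_simps)
qed

text \<open>The growth factor \<open>1 + C\<close> of \<open>solver_step_growth\<close> for the
  bound \<open>C = 1 / sqrt \<gamma>\<^sub>S\<close> on \<open>\<gamma> t\<close>.\<close>

abbreviation \<kappa> :: real where "\<kappa> \<equiv> 1 + 1 / sqrt \<gamma>\<^sub>S"

lemma error_growth:
  assumes "regular t \<omega>" "\<omega> \<in> space M" "j \<le> \<tau>"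
  shows "norm (z_error t j \<omega>) \<le> \<kappa> ^ j * norm (newton t \<omega>) \<and> norm (v_error t j \<omega>) \<le> \<kappa> ^ j * norm (newton t \<omega>)"
  using assms(3)
proof (induction j)
  case 0
  then show ?case by (simp add: z_error_def v_error_def z_0 v_0)
next
  case (Suc j)
  then have j: "j < \<tau>" by simp
  let ?y = "\<alpha> t \<omega> *\<^sub>R v_error t j \<omega> + (1 - \<alpha> t \<omega>) *\<^sub>R z_error t j \<omega>"
  let ?q = "sketch_proj (B t \<omega>) (S t j \<omega>) *v ?y"
  have "norm ?q \<le> norm ?y" "norm (?y - ?q) \<le> norm ?y"
    by (intro orthogonal_projection_bounds sketch_proj_projection assms)+
  then show ?case
    unfolding error_Suc[OF assms(2) j] y_error_def
    using solver_step_growth[of "z_error t j \<omega>" "\<kappa> ^ j * norm (newton t \<omega>)" "v_error t j \<omega>" "\<alpha> t \<omega>" "\<beta> t \<omega>" "\<gamma> t \<omega>" "1 / sqrt \<gamma>\<^sub>S" ?q]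
      regularD(1-6)[OF assms(1)] Suc
    by (simp add: mult.assoc)
qed

lemma y_error_growth:
  assumes "regular t \<omega>" "\<omega> \<in> space M" "j < \<tau>"
  shows "norm (y_error t j \<omega>) \<le> \<kappa> ^ j * norm (newton t \<omega>)"
  unfolding y_error_def
  using solver_step_growth(1)[of "z_error t j \<omega>" "\<kappa> ^ j * norm (newton t \<omega>)" "v_error t j \<omega>" "\<alpha> t \<omega>" "\<beta> t \<omega>" "\<gamma> t \<omega>" "1 / sqrt \<gamma>\<^sub>S" 0]
    regularD(1-6)[OF assms(1)] error_growth[OF assms(1,2), of j] assms(3)
  by simp

end

section \<open>Mean of the solver direction\<close>

context sketched_newton
begin

text \<open>Adjoint test functions: applying \<open>Z t\<close> to an error is moved to the test function \<open>X\<close>, which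
  stays in this class, so the mean errors can be computed against all \<open>X\<close> simultaneously.\<close>

definition test_function :: "nat \<Rightarrow> ('a \<Rightarrow> real^'d) \<Rightarrow> bool" where
  "test_function t X \<longleftrightarrow> X \<in> borel_measurable (\<F> t) \<and> square_integrable M X"

lemma test_function_bound:
  assumes "test_function t X" "U \<in> borel_measurable (\<F> t)" "AE \<omega> in M. norm (U \<omega>) \<le> C * norm (X \<omega>)"
  shows "test_function t U"
  unfolding test_function_def
  by (rule conjI[OF assms(2) square_integrable_bound[OF _ \<F>_to_M[OF assms(2)] assms(3)]])
    (use assms(1) in \<open>simp add: test_function_def\<close>)

lemma test_function_diff:
  assumes "test_function t X" "test_function t U"
  shows "test_function t (\<lambda>\<omega>. X \<omega> - U \<omega>)"
  unfolding test_function_def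
proof
  show "(\<lambda>\<omega>. X \<omega> - U \<omega>) \<in> borel_measurable (\<F> t)"
    by (rule borel_measurable_diff) (use assms in \<open>simp_all add: test_function_def\<close>)
  show "square_integrable M (\<lambda>\<omega>. X \<omega> - U \<omega>)"
    by (rule square_integrable_diff) (use assms in \<open>simp_all add: test_function_def\<close>)
qed

lemma test_function_scaleR:
  assumes X: "test_function t X" and c: "c \<in> borel_measurable (\<F> t)" and le: "AE \<omega> in M. \<bar>c \<omega>\<bar> \<le> C"
  shows "test_function t (\<lambda>\<omega>. c \<omega> *\<^sub>R X \<omega>)"
proof (rule test_function_bound[OF X])
  show "(\<lambda>\<omega>. c \<omega> *\<^sub>R X \<omega>) \<in> borel_measurable (\<F> t)"
    by (rule borel_measurable_scaleR[OF c]) (use X in \<open>simp add: test_function_def\<close>)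
  show "AE \<omega> in M. norm (c \<omega> *\<^sub>R X \<omega>) \<le> C * norm (X \<omega>)"
    using le by eventually_elim (simp add: mult_right_mono)
qed

lemma test_function_transpose:
  assumes X: "test_function t X" and A: "A \<in> borel_measurable (\<F> t)"
    and le: "AE \<omega> in M. \<forall>a. norm (A \<omega> *v a) \<le> C * norm a"
  shows "test_function t (\<lambda>\<omega>. transpose (A \<omega>) *v X \<omega>)"
proof (rule test_function_bound[OF X])
  have [measurable]: "X \<in> borel_measurable (\<F> t)" using X by (simp add: test_function_def)
  note [measurable] = A
  show "(\<lambda>\<omega>. transpose (A \<omega>) *v X \<omega>) \<in> borel_measurable (\<F> t)" by measurable
  show "AE \<omega> in M. norm (transpose (A \<omega>) *v X \<omega>) \<le> C * norm (X \<omega>)"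
    using le by eventually_elim (blast intro: norm_transpose_bound)
qed

lemma AE_regularI: "(\<And>\<omega>. regular t \<omega> \<Longrightarrow> \<omega> \<in> space M \<Longrightarrow> Q \<omega>) \<Longrightarrow> AE \<omega> in M. Q \<omega>"
  using AE_regular[of t] AE_space by eventually_elim blast

lemma test_function_Z:
  assumes "test_function t X"
  shows "test_function t (\<lambda>\<omega>. transpose (Z t \<omega>) *v X \<omega>)"
proof (rule test_function_transpose[OF assms Z_measurable])
  show "AE \<omega> in M. \<forall>a. norm (Z t \<omega> *v a) \<le> 1 * norm a"
    by (rule AE_regularI[of t]) (simp add: regularD)
qed

lemma AE_parameter_bounds:
  "AE \<omega> in M. \<bar>\<alpha> t \<omega>\<bar> \<le> 1" "AE \<omega> in M. \<bar>1 - \<alpha> t \<omega>\<bar> \<le> 1" "AE \<omega> in M. \<bar>\<beta> t \<omega>\<bar> \<le> 1"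
  "AE \<omega> in M. \<bar>1 - \<beta> t \<omega>\<bar> \<le> 1" "AE \<omega> in M. \<bar>\<gamma> t \<omega>\<bar> \<le> 1 / sqrt \<gamma>\<^sub>S"
proof -
  have b: "\<bar>\<alpha> t \<omega>\<bar> \<le> 1 \<and> \<bar>1 - \<alpha> t \<omega>\<bar> \<le> 1 \<and> \<bar>\<beta> t \<omega>\<bar> \<le> 1 \<and> \<bar>1 - \<beta> t \<omega>\<bar> \<le> 1 \<and> \<bar>\<gamma> t \<omega>\<bar> \<le> 1 / sqrt \<gamma>\<^sub>S"
    if "regular t \<omega>" for \<omega>
    using regularD(1-6)[OF that] by simp
  show "AE \<omega> in M. \<bar>\<alpha> t \<omega>\<bar> \<le> 1" "AE \<omega> in M. \<bar>1 - \<alpha> t \<omega>\<bar> \<le> 1" "AE \<omega> in M. \<bar>\<beta> t \<omega>\<bar> \<le> 1"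
    "AE \<omega> in M. \<bar>1 - \<beta> t \<omega>\<bar> \<le> 1" "AE \<omega> in M. \<bar>\<gamma> t \<omega>\<bar> \<le> 1 / sqrt \<gamma>\<^sub>S"
    by (rule AE_regularI, use b in blast)+
qed

lemma newton_measurable_\<G>: "newton t \<in> borel_measurable (\<G> t j)"
proof -
  note [measurable] = \<F>_to_\<G>[OF B_measurable] g_measurable_\<G>
  have "newton t = (\<lambda>\<omega>. matrix_inv (B t \<omega>) *v g t \<omega>)" by (rule ext) (rule newton_def)
  then show ?thesis by simp
qed

lemma error_measurable_\<G>:
  assumes "j \<le> \<tau>"
  shows "z_error t j \<in> borel_measurable (\<G> t j)" "v_error t j \<in> borel_measurable (\<G> t j)"
    "y_error t j \<in> borel_measurable (\<G> t j)"
proof -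
  note [measurable] = newton_measurable_\<G> solver_measurable_\<G>[OF assms] \<F>_to_\<G>[OF \<alpha>_measurable]
  have "z_error t j = (\<lambda>\<omega>. z t j \<omega> + newton t \<omega>)" by (rule ext) (rule z_error_def)
  then show [measurable]: "z_error t j \<in> borel_measurable (\<G> t j)" by simp
  have "v_error t j = (\<lambda>\<omega>. v t j \<omega> + newton t \<omega>)" by (rule ext) (rule v_error_def)
  then show [measurable]: "v_error t j \<in> borel_measurable (\<G> t j)" by simp
  have "y_error t j = (\<lambda>\<omega>. \<alpha> t \<omega> *\<^sub>R v_error t j \<omega> + (1 - \<alpha> t \<omega>) *\<^sub>R z_error t j \<omega>)" by (rule ext) (rule y_error_def)
  then show "y_error t j \<in> borel_measurable (\<G> t j)" by simp
qed

lemma \<G>_to_M: "X \<in> \<G> t j \<rightarrow>\<^sub>M N \<Longrightarrow> j \<le> \<tau> \<Longrightarrow> X \<in> M \<rightarrow>\<^sub>M N"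
  by (rule measurable_from_subalg[OF subalgebra_\<G>])

definition mean_z :: "nat \<Rightarrow> nat \<Rightarrow> 'a \<Rightarrow> real^'d^'d" where
  "mean_z t j \<omega> = fst (mean_error (\<alpha> t \<omega>) (\<beta> t \<omega>) (\<gamma> t \<omega>) (Z t \<omega>) j)"

definition mean_v :: "nat \<Rightarrow> nat \<Rightarrow> 'a \<Rightarrow> real^'d^'d" where
  "mean_v t j \<omega> = snd (mean_error (\<alpha> t \<omega>) (\<beta> t \<omega>) (\<gamma> t \<omega>) (Z t \<omega>) j)"

lemma mean_measurable: "mean_z t j \<in> borel_measurable (\<F> t)" "mean_v t j \<in> borel_measurable (\<F> t)"
  unfolding mean_z_def[abs_def] mean_v_def[abs_def]
  by (rule conjunct1[OF borel_measurable_mean_error[OF \<alpha>_measurable \<beta>_measurable \<gamma>_measurable Z_measurable]],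
      rule conjunct2[OF borel_measurable_mean_error[OF \<alpha>_measurable \<beta>_measurable \<gamma>_measurable Z_measurable]])

lemma mean_growth:
  assumes "regular t \<omega>"
  shows "norm (mean_z t j \<omega> *v u) \<le> \<kappa> ^ j * norm u" "norm (mean_v t j \<omega> *v u) \<le> \<kappa> ^ j * norm u"
  unfolding mean_z_def mean_v_def
  by (rule conjunct1[OF mean_error_growth[OF regularD(7,8,1-6)[OF assms]]],
      rule conjunct2[OF mean_error_growth[OF regularD(7,8,1-6)[OF assms]]])

context
  fixes t :: nat
  assumes g2: "square_integrable M (g t)"
begin

text \<open>Square integrability of \<open>g t\<close> is an assumption of this context: it comes
  from that of \<open>x t\<close>, which is established only later, by induction on
  \<open>t\<close>.\<close>

lemma newton_square_integrable: "square_integrable M (newton t)"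
proof (rule square_integrable_bound[OF g2])
  show "newton t \<in> borel_measurable M" by (rule \<G>_to_M[OF newton_measurable_\<G>, of 0]) simp
  show "AE \<omega> in M. norm (newton t \<omega>) \<le> (1 / \<gamma>\<^sub>H) * norm (g t \<omega>)"
    using newton_bound by (intro AE_I2) simp
qed

lemma error_square_integrable:
  assumes "j \<le> \<tau>"
  shows "square_integrable M (z_error t j)" "square_integrable M (v_error t j)"
proof -
  show "square_integrable M (z_error t j)"
    by (rule square_integrable_bound[OF newton_square_integrable \<G>_to_M[OF error_measurable_\<G>(1)[OF assms] assms]])
      (rule AE_regularI, use error_growth assms in blast)
  show "square_integrable M (v_error t j)"
    by (rule square_integrable_bound[OF newton_square_integrable \<G>_to_M[OF error_measurable_\<G>(2)[OF assms] assms]])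
      (rule AE_regularI, use error_growth assms in blast)
qed

lemma y_error_square_integrable:
  assumes "j < \<tau>"
  shows "square_integrable M (y_error t j)"
  by (rule square_integrable_bound[OF newton_square_integrable
        \<G>_to_M[OF error_measurable_\<G>(3)[OF less_imp_le[OF assms]] less_imp_le[OF assms]]])
    (rule AE_regularI, rule y_error_growth[OF _ _ assms])

lemma projected_error_measurable:
  assumes "j < \<tau>"
  shows "(\<lambda>\<omega>. sketch_proj (B t \<omega>) (S t j \<omega>) *v y_error t j \<omega>) \<in> borel_measurable M"
proof -
  have [measurable]: "y_error t j \<in> borel_measurable M" "B t \<in> borel_measurable M" "S t j \<in> borel_measurable M"
    using \<G>_to_M[OF error_measurable_\<G>(3)] \<F>_to_M[OF B_measurable] S_measurable assms by auto
  show ?thesis by measurable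
qed

lemma projected_error_square_integrable:
  assumes "j < \<tau>"
  shows "square_integrable M (\<lambda>\<omega>. sketch_proj (B t \<omega>) (S t j \<omega>) *v y_error t j \<omega>)"
  by (rule square_integrable_bound[OF y_error_square_integrable[OF assms] projected_error_measurable[OF assms], of 1])
    (rule AE_I2, simp add: sketch_proj_bound)

text \<open>Relative to \<open>\<G> t j\<close> the vectors \<open>X\<close> and
  \<open>y_error t j\<close> are frozen and the sketch is fresh. Integrating over the sketch
  replaces the projection by \<open>Z t\<close>, which is then transposed onto the test
  function.\<close>

lemma mean_projected_error:
  assumes X: "test_function t X" and j: "j < \<tau>"
  shows "(\<integral>\<omega>. X \<omega> \<bullet> (sketch_proj (B t \<omega>) (S t j \<omega>) *v y_error t j \<omega>) \<partial>M) =
    (\<integral>\<omega>. (transpose (Z t \<omega>) *v X \<omega>) \<bullet> y_error t j \<omega> \<partial>M)"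
proof -
  interpret D: prob_space D by (rule prob_space_D)
  let ?h = "\<lambda>p. X (fst p) \<bullet> (sketch_proj (B t (fst p)) (snd p) *v y_error t j (fst p))"
  have [measurable]: "X \<in> borel_measurable (\<G> t j)" using X by (auto simp: test_function_def intro: \<F>_to_\<G>)
  note [measurable] = \<F>_to_\<G>[OF B_measurable, of t j] error_measurable_\<G>(3)[OF less_imp_le[OF j], of t]
  have h: "?h \<in> borel_measurable (\<G> t j \<Otimes>\<^sub>M borel)" by measurable
  have X2: "square_integrable M X" using X by (simp add: test_function_def)
  have "integrable M (\<lambda>\<omega>. ?h (\<omega>, S t j \<omega>))"
    using integrable_inner_square_integrable[OF X2 projected_error_square_integrable[OF j]] by simp
  from integral_freeze(2)[OF subalgebra_\<G>[OF less_imp_le[OF j]] S_measurable[OF j] indep_\<G>[OF j] S_distr[OF j] h this]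
  have "(\<integral>\<omega>. X \<omega> \<bullet> (sketch_proj (B t \<omega>) (S t j \<omega>) *v y_error t j \<omega>) \<partial>M) =
      (\<integral>\<omega>. (\<integral>s. X \<omega> \<bullet> (sketch_proj (B t \<omega>) s *v y_error t j \<omega>) \<partial>D) \<partial>M)" by simp
  also have "\<dots> = (\<integral>\<omega>. (transpose (Z t \<omega>) *v X \<omega>) \<bullet> y_error t j \<omega> \<partial>M)"
  proof (rule integral_cong_AE)
    have [measurable]: "X \<in> borel_measurable M" "y_error t j \<in> borel_measurable M" "Z t \<in> borel_measurable M" "B t \<in> borel_measurable M"
      using X2 y_error_square_integrable[OF j] \<F>_to_M[OF Z_measurable] \<F>_to_M[OF B_measurable] by (auto simp: square_integrable_def)
    note [measurable_cong] = sets_D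
    show "(\<lambda>\<omega>. \<integral>s. X \<omega> \<bullet> (sketch_proj (B t \<omega>) s *v y_error t j \<omega>) \<partial>D) \<in> borel_measurable M" by measurable
    show "(\<lambda>\<omega>. (transpose (Z t \<omega>) *v X \<omega>) \<bullet> y_error t j \<omega>) \<in> borel_measurable M" by measurable
    show "AE \<omega> in M. (\<integral>s. X \<omega> \<bullet> (sketch_proj (B t \<omega>) s *v y_error t j \<omega>) \<partial>D) = (transpose (Z t \<omega>) *v X \<omega>) \<bullet> y_error t j \<omega>"
      using Z_freeze[of t] AE_space
    proof eventually_elim
      case (elim \<omega>)
      have "integrable D (\<lambda>s. sketch_proj (B t \<omega>) s $ i $ k)" for i k
      proof (rule D.integrable_const_bound[where B = 1])
        have "\<bar>sketch_proj (B t \<omega>) s $ i $ k\<bar> \<le> 1" for s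
          by (rule matrix_entry_bound) (use sketch_proj_bound[OF elim(2)] in simp)
        then show "AE s in D. norm (sketch_proj (B t \<omega>) s $ i $ k) \<le> 1" by (intro AE_I2) simp
        show "(\<lambda>s. sketch_proj (B t \<omega>) s $ i $ k) \<in> borel_measurable D" by measurable
      qed
      then have "X \<omega> \<bullet> (Z t \<omega> *v y_error t j \<omega>) = (\<integral>s. X \<omega> \<bullet> (sketch_proj (B t \<omega>) s *v y_error t j \<omega>) \<partial>D)"
        unfolding elim(1) by (rule bilinear_form_integral(2))
      then show ?case
        using dot_matrix_vector[of "transpose (Z t \<omega>)" "X \<omega>" "y_error t j \<omega>"] by (simp only: transpose_transpose)
    qed
  qed
  finally show ?thesis .
qed

text \<open>\<open>X\<close> is arbitrary in the induction because each step multiplies the weight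
  by \<open>\<alpha> t\<close>, \<open>\<beta> t\<close>, \<open>\<gamma> t\<close> or
  \<open>Z t\<close>. These depend on the past only and are bounded almost everywhere, so the new
  weights are again test functions.\<close>

lemma mean_solver_error:
  "j \<le> \<tau> \<Longrightarrow> test_function t X \<Longrightarrow>
    (\<integral>\<omega>. X \<omega> \<bullet> z_error t j \<omega> \<partial>M) = (\<integral>\<omega>. X \<omega> \<bullet> (mean_z t j \<omega> *v newton t \<omega>) \<partial>M) \<and>
    (\<integral>\<omega>. X \<omega> \<bullet> v_error t j \<omega> \<partial>M) = (\<integral>\<omega>. X \<omega> \<bullet> (mean_v t j \<omega> *v newton t \<omega>) \<partial>M)"
proof (induction j arbitrary: X)
  case 0
  then show ?case by (simp add: z_error_def v_error_def z_0 v_0 mean_z_def mean_v_def)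
next
  case (Suc j)
  then have j: "j < \<tau>" by simp
  note IH = Suc.IH[OF less_imp_le[OF j]]
  let ?b = "newton t"
  let ?y = "y_error t j" and ?Q = "\<lambda>\<omega>. sketch_proj (B t \<omega>) (S t j \<omega>) *v y_error t j \<omega>"
  let ?e = "z_error t j" and ?v = "v_error t j"
  \<comment> \<open>The mean counterpart of \<open>y_error t j\<close>, in the sense of
    \<open>Ey\<close> below.\<close>
  define u where "u \<omega> = \<alpha> t \<omega> *\<^sub>R (mean_v t j \<omega> *v ?b \<omega>) + (1 - \<alpha> t \<omega>) *\<^sub>R (mean_z t j \<omega> *v ?b \<omega>)" for \<omega>
  have [measurable]: "?b \<in> borel_measurable M" using newton_square_integrable by (rule square_integrable_measurable)
  note [measurable] = \<F>_to_M[OF mean_measurable(1)] \<F>_to_M[OF mean_measurable(2)] \<F>_to_M[OF Z_measurable]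
    \<F>_to_M[OF \<alpha>_measurable]
  have mz2: "square_integrable M (\<lambda>\<omega>. mean_z t j \<omega> *v ?b \<omega>)"
    by (rule square_integrable_bound[OF newton_square_integrable])
      (measurable, rule AE_regularI, rule mean_growth)
  have mv2: "square_integrable M (\<lambda>\<omega>. mean_v t j \<omega> *v ?b \<omega>)"
    by (rule square_integrable_bound[OF newton_square_integrable])
      (measurable, rule AE_regularI, rule mean_growth)
  have u2: "square_integrable M u"
  proof (rule square_integrable_bound[OF newton_square_integrable])
    show "u \<in> borel_measurable M" unfolding u_def by measurable
    show "AE \<omega> in M. norm (u \<omega>) \<le> \<kappa> ^ j * norm (?b \<omega>)"
    proof (rule AE_regularI)
      fix \<omega> assume elim: "regular t \<omega>"
      show "norm (u \<omega>) \<le> \<kappa> ^ j * norm (?b \<omega>)" unfolding u_def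
        using solver_step_growth(1)[of "mean_z t j \<omega> *v ?b \<omega>" "\<kappa> ^ j * norm (?b \<omega>)" "mean_v t j \<omega> *v ?b \<omega>" "\<alpha> t \<omega>" "\<beta> t \<omega>" "\<gamma> t \<omega>" "1 / sqrt \<gamma>\<^sub>S" 0]
          regularD(1-6)[OF elim] mean_growth[OF elim] by simp
    qed
  qed
  note e2 = error_square_integrable[OF less_imp_le[OF j]] and y2 = y_error_square_integrable[OF j]
    and Q2 = projected_error_square_integrable[OF j]
  note int = integrable_inner_square_integrable
  have X2: "square_integrable M X'" if "test_function t X'" for X' using that by (simp add: test_function_def)
  have scale: "test_function t (\<lambda>\<omega>. \<alpha> t \<omega> *\<^sub>R X' \<omega>)" "test_function t (\<lambda>\<omega>. (1 - \<alpha> t \<omega>) *\<^sub>R X' \<omega>)"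
    "test_function t (\<lambda>\<omega>. \<beta> t \<omega> *\<^sub>R X' \<omega>)" "test_function t (\<lambda>\<omega>. (1 - \<beta> t \<omega>) *\<^sub>R X' \<omega>)"
    "test_function t (\<lambda>\<omega>. \<gamma> t \<omega> *\<^sub>R X' \<omega>)" if "test_function t X'" for X'
    using test_function_scaleR[OF that _ AE_parameter_bounds(1)] test_function_scaleR[OF that _ AE_parameter_bounds(2)]
      test_function_scaleR[OF that _ AE_parameter_bounds(3)] test_function_scaleR[OF that _ AE_parameter_bounds(4)]
      test_function_scaleR[OF that _ AE_parameter_bounds(5)] \<alpha>_measurable[of t] \<beta>_measurable[of t] \<gamma>_measurable[of t]
    by auto
  have Ey: "(\<integral>\<omega>. X' \<omega> \<bullet> ?y \<omega> \<partial>M) = (\<integral>\<omega>. X' \<omega> \<bullet> u \<omega> \<partial>M)" if X': "test_function t X'" for X'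
  proof -
    note s = scale(1,2)[OF X']
    have "(\<integral>\<omega>. X' \<omega> \<bullet> ?y \<omega> \<partial>M) = (\<integral>\<omega>. (\<alpha> t \<omega> *\<^sub>R X' \<omega>) \<bullet> ?v \<omega> + ((1 - \<alpha> t \<omega>) *\<^sub>R X' \<omega>) \<bullet> ?e \<omega> \<partial>M)"
      by (simp add: y_error_def inner_add_right)
    also have "\<dots> = (\<integral>\<omega>. (\<alpha> t \<omega> *\<^sub>R X' \<omega>) \<bullet> ?v \<omega> \<partial>M) + (\<integral>\<omega>. ((1 - \<alpha> t \<omega>) *\<^sub>R X' \<omega>) \<bullet> ?e \<omega> \<partial>M)"
      by (intro Bochner_Integration.integral_add int X2 s e2)
    also have "\<dots> = (\<integral>\<omega>. (\<alpha> t \<omega> *\<^sub>R X' \<omega>) \<bullet> (mean_v t j \<omega> *v ?b \<omega>) \<partial>M) + (\<integral>\<omega>. ((1 - \<alpha> t \<omega>) *\<^sub>R X' \<omega>) \<bullet> (mean_z t j \<omega> *v ?b \<omega>) \<partial>M)"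
      using IH[OF s(1)] IH[OF s(2)] by presburger
    also have "\<dots> = (\<integral>\<omega>. (\<alpha> t \<omega> *\<^sub>R X' \<omega>) \<bullet> (mean_v t j \<omega> *v ?b \<omega>) + ((1 - \<alpha> t \<omega>) *\<^sub>R X' \<omega>) \<bullet> (mean_z t j \<omega> *v ?b \<omega>) \<partial>M)"
      by (intro Bochner_Integration.integral_add[symmetric] int X2 s mz2 mv2)
    also have "\<dots> = (\<integral>\<omega>. X' \<omega> \<bullet> u \<omega> \<partial>M)" by (simp add: u_def inner_add_right)
    finally show ?thesis .
  qed
  have mean_Suc: "mean_z t (Suc j) \<omega> *v ?b \<omega> = u \<omega> - Z t \<omega> *v u \<omega>"
    "mean_v t (Suc j) \<omega> *v ?b \<omega> = \<beta> t \<omega> *\<^sub>R (mean_v t j \<omega> *v ?b \<omega>) + (1 - \<beta> t \<omega>) *\<^sub>R u \<omega> - \<gamma> t \<omega> *\<^sub>R (Z t \<omega> *v u \<omega>)" for \<omega>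
    by (simp_all only: u_def mean_z_def mean_v_def mean_error.simps Let_def fst_conv snd_conv matrix_vector_mult_diff_rdistrib matrix_vector_mult_add_rdistrib
        scaleR_matrix_vector_assoc[symmetric] matrix_vector_mul_assoc[symmetric])
  have tr: "(transpose (Z t \<omega>) *v a) \<bullet> c = a \<bullet> (Z t \<omega> *v c)" for \<omega> a c
    using dot_matrix_vector[of "transpose (Z t \<omega>)" a c] by simp
  note X = Suc.prems(2)
  show ?case
  proof
    have "(\<integral>\<omega>. X \<omega> \<bullet> z_error t (Suc j) \<omega> \<partial>M) = (\<integral>\<omega>. X \<omega> \<bullet> ?y \<omega> - X \<omega> \<bullet> ?Q \<omega> \<partial>M)"
      by (intro Bochner_Integration.integral_cong refl) (simp add: error_Suc[OF _ j] inner_diff_right)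
    also have "\<dots> = (\<integral>\<omega>. X \<omega> \<bullet> ?y \<omega> \<partial>M) - (\<integral>\<omega>. X \<omega> \<bullet> ?Q \<omega> \<partial>M)"
      by (intro Bochner_Integration.integral_diff int X2 X y2 Q2)
    also have "\<dots> = (\<integral>\<omega>. X \<omega> \<bullet> u \<omega> \<partial>M) - (\<integral>\<omega>. (transpose (Z t \<omega>) *v X \<omega>) \<bullet> u \<omega> \<partial>M)"
      by (simp only: mean_projected_error[OF X j] Ey[OF X] Ey[OF test_function_Z[OF X]])
    also have "\<dots> = (\<integral>\<omega>. X \<omega> \<bullet> u \<omega> - (transpose (Z t \<omega>) *v X \<omega>) \<bullet> u \<omega> \<partial>M)"
      by (intro Bochner_Integration.integral_diff[symmetric] int X2 X test_function_Z u2)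
    also have "\<dots> = (\<integral>\<omega>. X \<omega> \<bullet> (mean_z t (Suc j) \<omega> *v ?b \<omega>) \<partial>M)"
      by (simp only: mean_Suc tr inner_diff_right)
    finally show "(\<integral>\<omega>. X \<omega> \<bullet> z_error t (Suc j) \<omega> \<partial>M) = (\<integral>\<omega>. X \<omega> \<bullet> (mean_z t (Suc j) \<omega> *v ?b \<omega>) \<partial>M)" .
    note s = scale(3-5)[OF X]
    let ?X1 = "\<lambda>\<omega>. \<beta> t \<omega> *\<^sub>R X \<omega>" and ?X2 = "\<lambda>\<omega>. (1 - \<beta> t \<omega>) *\<^sub>R X \<omega>" and ?X3 = "\<lambda>\<omega>. \<gamma> t \<omega> *\<^sub>R X \<omega>"
    have "(\<integral>\<omega>. X \<omega> \<bullet> v_error t (Suc j) \<omega> \<partial>M) = (\<integral>\<omega>. ?X1 \<omega> \<bullet> ?v \<omega> + ?X2 \<omega> \<bullet> ?y \<omega> - ?X3 \<omega> \<bullet> ?Q \<omega> \<partial>M)"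
      by (intro Bochner_Integration.integral_cong refl) (simp add: error_Suc[OF _ j] inner_diff_right inner_add_right)
    also have "\<dots> = (\<integral>\<omega>. ?X1 \<omega> \<bullet> ?v \<omega> + ?X2 \<omega> \<bullet> ?y \<omega> \<partial>M) - (\<integral>\<omega>. ?X3 \<omega> \<bullet> ?Q \<omega> \<partial>M)"
      by (intro Bochner_Integration.integral_diff Bochner_Integration.integrable_add int X2 s e2 y2 Q2)
    also have "(\<integral>\<omega>. ?X1 \<omega> \<bullet> ?v \<omega> + ?X2 \<omega> \<bullet> ?y \<omega> \<partial>M) = (\<integral>\<omega>. ?X1 \<omega> \<bullet> ?v \<omega> \<partial>M) + (\<integral>\<omega>. ?X2 \<omega> \<bullet> ?y \<omega> \<partial>M)"
      by (intro Bochner_Integration.integral_add int X2 s e2 y2)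
    also have "(\<integral>\<omega>. ?X1 \<omega> \<bullet> ?v \<omega> \<partial>M) = (\<integral>\<omega>. ?X1 \<omega> \<bullet> (mean_v t j \<omega> *v ?b \<omega>) \<partial>M)" using IH[OF s(1)] by blast
    also have "(\<integral>\<omega>. ?X2 \<omega> \<bullet> ?y \<omega> \<partial>M) = (\<integral>\<omega>. ?X2 \<omega> \<bullet> u \<omega> \<partial>M)" by (rule Ey[OF s(2)])
    also have "(\<integral>\<omega>. ?X3 \<omega> \<bullet> ?Q \<omega> \<partial>M) = (\<integral>\<omega>. (transpose (Z t \<omega>) *v ?X3 \<omega>) \<bullet> u \<omega> \<partial>M)"
      by (simp only: mean_projected_error[OF s(3) j] Ey[OF test_function_Z[OF s(3)]])
    also have "(\<integral>\<omega>. ?X1 \<omega> \<bullet> (mean_v t j \<omega> *v ?b \<omega>) \<partial>M) + (\<integral>\<omega>. ?X2 \<omega> \<bullet> u \<omega> \<partial>M) =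
        (\<integral>\<omega>. ?X1 \<omega> \<bullet> (mean_v t j \<omega> *v ?b \<omega>) + ?X2 \<omega> \<bullet> u \<omega> \<partial>M)"
      by (intro Bochner_Integration.integral_add[symmetric] int X2 s mv2 u2)
    also have "(\<integral>\<omega>. ?X1 \<omega> \<bullet> (mean_v t j \<omega> *v ?b \<omega>) + ?X2 \<omega> \<bullet> u \<omega> \<partial>M) - (\<integral>\<omega>. (transpose (Z t \<omega>) *v ?X3 \<omega>) \<bullet> u \<omega> \<partial>M) =
        (\<integral>\<omega>. ?X1 \<omega> \<bullet> (mean_v t j \<omega> *v ?b \<omega>) + ?X2 \<omega> \<bullet> u \<omega> - (transpose (Z t \<omega>) *v ?X3 \<omega>) \<bullet> u \<omega> \<partial>M)"
      by (intro Bochner_Integration.integral_diff[symmetric] Bochner_Integration.integrable_add int X2 s test_function_Z mv2 u2)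
    also have "\<dots> = (\<integral>\<omega>. X \<omega> \<bullet> (mean_v t (Suc j) \<omega> *v ?b \<omega>) \<partial>M)"
      by (simp only: mean_Suc tr inner_diff_right inner_add_right inner_scaleR_left inner_scaleR_right)
    finally show "(\<integral>\<omega>. X \<omega> \<bullet> v_error t (Suc j) \<omega> \<partial>M) = (\<integral>\<omega>. X \<omega> \<bullet> (mean_v t (Suc j) \<omega> *v ?b \<omega>) \<partial>M)" .
  qed
qed

text \<open>Replacing \<open>g t\<close> by its conditional mean is legitimate under weights known
  from the past; this is why every other factor has to be moved onto the test function
  first.\<close>

lemma mean_gradient:
  assumes X: "test_function t X" and grad2: "square_integrable M (\<lambda>\<omega>. grad f (x t \<omega>))"
  shows "(\<integral>\<omega>. X \<omega> \<bullet> g t \<omega> \<partial>M) = (\<integral>\<omega>. X \<omega> \<bullet> grad f (x t \<omega>) \<partial>M)"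
proof -
  interpret \<F>: finite_measure_subalgebra M "\<F> t" by (rule finite_measure_subalgebra_\<F>)
  have Xi: "(\<lambda>\<omega>. X \<omega> $ i) \<in> borel_measurable (\<F> t)" for i
    using X by (auto simp: test_function_def intro: borel_measurable_vec_nth)
  have X2: "square_integrable M X" using X by (simp add: test_function_def)
  have comp2: "square_integrable M (\<lambda>\<omega>. U \<omega> $ i)" if "square_integrable M U" for U :: "'a \<Rightarrow> real^'d" and i
    by (rule square_integrable_bound[OF that, where C = 1])
      (use square_integrable_measurable[OF that] component_le_norm_cart in \<open>auto intro: borel_measurable_vec_nth\<close>)
  have int: "integrable M (\<lambda>\<omega>. X \<omega> $ i * U \<omega> $ i)" if "square_integrable M U" for U :: "'a \<Rightarrow> real^'d" and i
    using integrable_inner_square_integrable[OF comp2[OF X2] comp2[OF that]] by simp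
  have gm: "(\<lambda>\<omega>. g t \<omega> $ i) \<in> borel_measurable M" for i
    using square_integrable_measurable[OF g2] by (rule borel_measurable_vec_nth)
  have gr: "(\<lambda>\<omega>. grad f (x t \<omega>) $ i) \<in> borel_measurable M" for i
    using square_integrable_measurable[OF grad2] by (rule borel_measurable_vec_nth)
  have "(\<integral>\<omega>. X \<omega> $ i * g t \<omega> $ i \<partial>M) = (\<integral>\<omega>. X \<omega> $ i * grad f (x t \<omega>) $ i \<partial>M)" for i
  proof -
    have "(\<integral>\<omega>. X \<omega> $ i * g t \<omega> $ i \<partial>M) = (\<integral>\<omega>. X \<omega> $ i * real_cond_exp M (\<F> t) (\<lambda>\<omega>. g t \<omega> $ i) \<omega> \<partial>M)"
      by (rule \<F>.real_cond_exp_intg(2)[OF int[OF g2] Xi gm, symmetric])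
    also have "\<dots> = (\<integral>\<omega>. X \<omega> $ i * grad f (x t \<omega>) $ i \<partial>M)"
    proof (rule integral_cong_AE)
      have "(\<lambda>\<omega>. X \<omega> $ i) \<in> borel_measurable M" using Xi by (rule \<F>_to_M)
      then show "(\<lambda>\<omega>. X \<omega> $ i * real_cond_exp M (\<F> t) (\<lambda>\<omega>. g t \<omega> $ i) \<omega>) \<in> borel_measurable M"
        "(\<lambda>\<omega>. X \<omega> $ i * grad f (x t \<omega>) $ i) \<in> borel_measurable M" using gr by (auto intro: borel_measurable_times)
      show "AE \<omega> in M. X \<omega> $ i * real_cond_exp M (\<F> t) (\<lambda>\<omega>. g t \<omega> $ i) \<omega> = X \<omega> $ i * grad f (x t \<omega>) $ i"
        using g_mean[of t]
      proof eventually_elim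
        case (elim \<omega>)
        show ?case unfolding elim[symmetric] by (simp add: cond_exp_vec_def)
      qed
    qed
    finally show ?thesis .
  qed
  then show ?thesis
    by (simp add: inner_vec_def Bochner_Integration.integral_sum int[OF g2] int[OF grad2])
qed

text \<open>The inverse of \<open>B t\<close> and the matrix \<open>mean_z t \<tau>\<close> minus
  the identity are known from the past and are transposed onto \<open>X\<close>, leaving
  \<open>g t\<close> alone. It is replaced by the true gradient, and the matrices are moved
  back.\<close>

lemma mean_direction:
  assumes X: "test_function t X" and grad2: "square_integrable M (\<lambda>\<omega>. grad f (x t \<omega>))"
  shows "(\<integral>\<omega>. X \<omega> \<bullet> z t \<tau> \<omega> \<partial>M) =
    (\<integral>\<omega>. X \<omega> \<bullet> (mean_z t \<tau> \<omega> *v (matrix_inv (B t \<omega>) *v grad f (x t \<omega>)) - matrix_inv (B t \<omega>) *v grad f (x t \<omega>)) \<partial>M)"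
proof -
  let ?b = "newton t"
  have X2: "square_integrable M X'" if "test_function t X'" for X' using that by (simp add: test_function_def)
  note int = integrable_inner_square_integrable
  note e2 = error_square_integrable(1)[OF order_refl]
  define X1 where "X1 \<omega> = transpose (mean_z t \<tau> \<omega>) *v X \<omega>" for \<omega>
  have X1: "test_function t X1"
    unfolding X1_def
  proof (rule test_function_transpose[OF X mean_measurable(1)])
    show "AE \<omega> in M. \<forall>a. norm (mean_z t \<tau> \<omega> *v a) \<le> \<kappa> ^ \<tau> * norm a"
      by (rule AE_regularI) (blast intro: mean_growth)
  qed
  define X3 where "X3 \<omega> = transpose (matrix_inv (B t \<omega>)) *v (X1 \<omega> - X \<omega>)" for \<omega>
  have X3: "test_function t X3"
    unfolding X3_def
  proof (rule test_function_transpose[OF test_function_diff[OF X1 X]])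
    show "(\<lambda>\<omega>. matrix_inv (B t \<omega>)) \<in> borel_measurable (\<F> t)" using B_measurable by (rule borel_measurable_matrix_inv)
    show "AE \<omega> in M. \<forall>a. norm (matrix_inv (B t \<omega>) *v a) \<le> (1 / \<gamma>\<^sub>H) * norm a"
      using form_bounds_matrix_inv(3)[OF B_bounds(2) \<gamma>\<^sub>H] by (intro AE_I2) auto
  qed
  have X3_dot: "X3 \<omega> \<bullet> c = X \<omega> \<bullet> (mean_z t \<tau> \<omega> *v (matrix_inv (B t \<omega>) *v c) - matrix_inv (B t \<omega>) *v c)" for \<omega> c
  proof -
    have "X3 \<omega> \<bullet> c = (X1 \<omega> - X \<omega>) \<bullet> (matrix_inv (B t \<omega>) *v c)"
      unfolding X3_def using dot_matrix_vector[of "transpose (matrix_inv (B t \<omega>))"] by (metis transpose_transpose)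
    also have "X1 \<omega> \<bullet> (matrix_inv (B t \<omega>) *v c) = X \<omega> \<bullet> (mean_z t \<tau> \<omega> *v (matrix_inv (B t \<omega>) *v c))"
      unfolding X1_def using dot_matrix_vector[of "transpose (mean_z t \<tau> \<omega>)"] by (metis transpose_transpose)
    then have "(X1 \<omega> - X \<omega>) \<bullet> (matrix_inv (B t \<omega>) *v c) =
        X \<omega> \<bullet> (mean_z t \<tau> \<omega> *v (matrix_inv (B t \<omega>) *v c) - matrix_inv (B t \<omega>) *v c)"
      by (simp add: inner_diff_left inner_diff_right)
    finally show ?thesis .
  qed
  have "(\<integral>\<omega>. X \<omega> \<bullet> z t \<tau> \<omega> \<partial>M) = (\<integral>\<omega>. X \<omega> \<bullet> z_error t \<tau> \<omega> - X \<omega> \<bullet> ?b \<omega> \<partial>M)"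
    by (simp add: z_error_def inner_add_right)
  also have "\<dots> = (\<integral>\<omega>. X \<omega> \<bullet> z_error t \<tau> \<omega> \<partial>M) - (\<integral>\<omega>. X \<omega> \<bullet> ?b \<omega> \<partial>M)"
    by (intro Bochner_Integration.integral_diff int X2 X e2 newton_square_integrable)
  also have "(\<integral>\<omega>. X \<omega> \<bullet> z_error t \<tau> \<omega> \<partial>M) = (\<integral>\<omega>. X \<omega> \<bullet> (mean_z t \<tau> \<omega> *v ?b \<omega>) \<partial>M)"
    using mean_solver_error[OF order_refl X] by blast
  also have "\<dots> = (\<integral>\<omega>. X1 \<omega> \<bullet> ?b \<omega> \<partial>M)"
    unfolding X1_def using dot_matrix_vector[of "transpose (mean_z t \<tau> _)"] by (simp only: transpose_transpose)
  also have "(\<integral>\<omega>. X1 \<omega> \<bullet> ?b \<omega> \<partial>M) - (\<integral>\<omega>. X \<omega> \<bullet> ?b \<omega> \<partial>M) = (\<integral>\<omega>. X1 \<omega> \<bullet> ?b \<omega> - X \<omega> \<bullet> ?b \<omega> \<partial>M)"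
    by (intro Bochner_Integration.integral_diff[symmetric] int X2 X X1 newton_square_integrable)
  also have "\<dots> = (\<integral>\<omega>. X3 \<omega> \<bullet> g t \<omega> \<partial>M)"
    unfolding X3_def newton_def using dot_matrix_vector[of "transpose (matrix_inv (B t _))"]
    by (simp only: transpose_transpose inner_diff_left)
  also have "\<dots> = (\<integral>\<omega>. X3 \<omega> \<bullet> grad f (x t \<omega>) \<partial>M)" by (rule mean_gradient[OF X3 grad2])
  finally show ?thesis by (simp only: X3_dot)
qed

end

end

section \<open>Descent and convergence\<close>

lemma step_size_summable:
  fixes C p :: real
  assumes "1 / 2 < p"
  shows "summable (\<lambda>n. (C / (real n + 1) powr p)\<^sup>2)"
proof -
  have "summable (\<lambda>n. real n powr (- (2 * p)))" using assms by (subst summable_real_powr_iff) simp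
  then have "summable (\<lambda>n. real (Suc n) powr (- (2 * p)))" by (subst summable_Suc_iff)
  then have "summable (\<lambda>n. C\<^sup>2 * real (Suc n) powr (- (2 * p)))" by (rule summable_mult)
  moreover have "C\<^sup>2 * real (Suc n) powr (- (2 * p)) = (C / (real n + 1) powr p)\<^sup>2" for n
  proof -
    have "((real n + 1) powr p)\<^sup>2 = (real n + 1) powr (2 * p)"
      by (simp add: power2_eq_square flip: powr_add)
    then show ?thesis by (simp add: power_divide powr_minus add.commute field_simps)
  qed
  ultimately show ?thesis by (simp only:)
qed

lemma step_size_not_summable:
  fixes C p :: real
  assumes "p \<le> 1" "0 < C"
  shows "\<not> summable (\<lambda>n. C / (real n + 1) powr p)"
proof
  assume "summable (\<lambda>n. C / (real n + 1) powr p)"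
  then have "summable (\<lambda>n. inverse C * (C / (real n + 1) powr p))" by (rule summable_mult)
  moreover have "inverse C * (C / (real n + 1) powr p) = real (Suc n) powr (- p)" for n
    using assms by (simp add: powr_minus field_simps)
  ultimately have "summable (\<lambda>n. real (Suc n) powr (- p))" by simp
  then have "summable (\<lambda>n. real n powr (- p))" by (subst (asm) summable_Suc_iff)
  then show False using assms by (subst (asm) summable_real_powr_iff) simp
qed

context sketched_newton
begin

definition gap :: "nat \<Rightarrow> 'a \<Rightarrow> real" where
  "gap t \<omega> = f (x t \<omega>) - f xstar"

lemma gap_facts:
  shows "0 \<le> gap t \<omega>" "(norm (grad f (x t \<omega>)))\<^sup>2 \<le> 2 * \<Upsilon>\<^sub>H * gap t \<omega>"
    and "2 * \<gamma>\<^sub>H * gap t \<omega> \<le> (norm (grad f (x t \<omega>)))\<^sup>2"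
    and "(norm (x t \<omega> - xstar))\<^sup>2 \<le> 2 / \<gamma>\<^sub>H * gap t \<omega>"
    and "gap t \<omega> \<le> \<Upsilon>\<^sub>H / 2 * (norm (x t \<omega> - xstar))\<^sup>2"
  using gap_bounds[of "x t \<omega>"] xstar_le[of "x t \<omega>"] \<gamma>\<^sub>H by (simp_all add: gap_def field_simps)

lemma grad_norm_le: "norm (grad f (x t \<omega>)) \<le> \<Upsilon>\<^sub>H * norm (x t \<omega> - xstar)"
proof (rule power2_le_imp_le)
  have "(norm (grad f (x t \<omega>)))\<^sup>2 \<le> 2 * \<Upsilon>\<^sub>H * (\<Upsilon>\<^sub>H / 2 * (norm (x t \<omega> - xstar))\<^sup>2)"
    by (rule order_trans[OF gap_facts(2) mult_left_mono[OF gap_facts(5)]]) (use \<Upsilon>\<^sub>H in simp)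
  then show "(norm (grad f (x t \<omega>)))\<^sup>2 \<le> (\<Upsilon>\<^sub>H * norm (x t \<omega> - xstar))\<^sup>2" by (simp add: power2_eq_square algebra_simps)
qed (use \<Upsilon>\<^sub>H in simp)

lemma gap_measurable: "gap t \<in> borel_measurable (\<F> t)"
proof -
  have "continuous_on UNIV f"
    using twice_continuously_differentiableD(1)[OF f_C2] by (meson continuous_at_imp_continuous_on has_derivative_continuous)
  then have "(\<lambda>\<omega>. f (x t \<omega>)) \<in> borel_measurable (\<F> t)" by (rule borel_measurable_continuous_on[OF _ x_measurable])
  then show ?thesis unfolding gap_def[abs_def] by simp
qed

lemma grad_measurable: "(\<lambda>\<omega>. grad f (x t \<omega>)) \<in> borel_measurable (\<F> t)"
proof -
  have "continuous_on UNIV (grad f)"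
    using twice_continuously_differentiableD(2)[OF f_C2] by (meson continuous_at_imp_continuous_on has_derivative_continuous)
  then show ?thesis by (rule borel_measurable_continuous_on[OF _ x_measurable])
qed

context
  fixes t :: nat
  assumes x2: "square_integrable M (x t)"
begin

lemma deviation_square_integrable: "square_integrable M (\<lambda>\<omega>. x t \<omega> - xstar)"
  by (rule square_integrable_diff[OF x2 square_integrable_const])

lemma grad_square_integrable: "square_integrable M (\<lambda>\<omega>. grad f (x t \<omega>))"
  by (rule square_integrable_bound[OF deviation_square_integrable \<F>_to_M[OF grad_measurable]])
    (rule AE_I2, rule grad_norm_le)

lemma gap_integrable: "integrable M (gap t)"
proof (rule Bochner_Integration.integrable_bound)
  show "integrable M (\<lambda>\<omega>. \<Upsilon>\<^sub>H / 2 * (norm (x t \<omega> - xstar))\<^sup>2)"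
    using deviation_square_integrable by (simp add: square_integrable_def)
  show "gap t \<in> borel_measurable M" by (rule \<F>_to_M[OF gap_measurable])
  have "norm (gap t \<omega>) \<le> norm (\<Upsilon>\<^sub>H / 2 * (norm (x t \<omega> - xstar))\<^sup>2)" for \<omega>
    using gap_facts(1,5)[of t \<omega>] by simp
  then show "AE \<omega> in M. norm (gap t \<omega>) \<le> norm (\<Upsilon>\<^sub>H / 2 * (norm (x t \<omega> - xstar))\<^sup>2)" by simp
qed

text \<open>The variance assumption compares extended nonnegative functions and so presupposes no
  integrability. Integrated over the whole space it shows that the noise is square integrable; after
  that it can be restated for real integrals.\<close>

lemma noise_bound:
  shows "square_integrable M (\<lambda>\<omega>. g t \<omega> - grad f (x t \<omega>))"
    and "A \<in> sets (\<F> t) \<Longrightarrow> (\<integral>\<omega>. indicator A \<omega> * (norm (g t \<omega> - grad f (x t \<omega>)))\<^sup>2 \<partial>M) \<le>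
      (\<integral>\<omega>. indicator A \<omega> * (C\<^sub>1 * (norm (x t \<omega> - xstar))\<^sup>2 + C\<^sub>2) \<partial>M)"
proof -
  interpret \<F>: finite_measure_subalgebra M "\<F> t" by (rule finite_measure_subalgebra_\<F>)
  have [measurable]: "g t \<in> borel_measurable M" "(\<lambda>\<omega>. grad f (x t \<omega>)) \<in> borel_measurable M"
    by (rule g_measurable, rule \<F>_to_M[OF grad_measurable])
  let ?n = "\<lambda>\<omega>. (norm (g t \<omega> - grad f (x t \<omega>)))\<^sup>2" and ?c = "\<lambda>\<omega>. C\<^sub>1 * (norm (x t \<omega> - xstar))\<^sup>2 + C\<^sub>2"
  have c0: "0 \<le> ?c \<omega>" for \<omega> using C\<^sub>1 C\<^sub>2 by simp
  have cint: "integrable M ?c" using deviation_square_integrable by (simp add: square_integrable_def)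
  have nn: "(\<integral>\<^sup>+\<omega>. ennreal (indicator A \<omega> * ?n \<omega>) \<partial>M) \<le> (\<integral>\<^sup>+\<omega>. ennreal (indicator A \<omega> * ?c \<omega>) \<partial>M)" if A: "A \<in> sets (\<F> t)" for A
  proof -
    have "(\<integral>\<^sup>+\<omega>. ennreal (indicator A \<omega> * ?n \<omega>) \<partial>M) = (\<integral>\<^sup>+\<omega>. indicator A \<omega> * ennreal (?n \<omega>) \<partial>M)"
      by (intro nn_integral_cong) (simp split: split_indicator)
    also have "\<dots> = (\<integral>\<^sup>+\<omega>. indicator A \<omega> * nn_cond_exp M (\<F> t) (\<lambda>\<omega>. ennreal (?n \<omega>)) \<omega> \<partial>M)"
      by (rule \<F>.nn_cond_exp_intg[symmetric]) (use A in measurable)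
    also have "\<dots> \<le> (\<integral>\<^sup>+\<omega>. ennreal (indicator A \<omega> * ?c \<omega>) \<partial>M)"
    proof (rule nn_integral_mono_AE)
      show "AE \<omega> in M. indicator A \<omega> * nn_cond_exp M (\<F> t) (\<lambda>\<omega>. ennreal (?n \<omega>)) \<omega> \<le> ennreal (indicator A \<omega> * ?c \<omega>)"
        using g_variance[of t] by eventually_elim (simp split: split_indicator)
    qed
    finally show ?thesis .
  qed
  have nint: "integrable M ?n"
  proof (rule integrableI_bounded)
    have "(\<integral>\<^sup>+\<omega>. ennreal (norm (?n \<omega>)) \<partial>M) = (\<integral>\<^sup>+\<omega>. ennreal (indicator (space M) \<omega> * ?n \<omega>) \<partial>M)"
      by (intro nn_integral_cong) simp
    also have "\<dots> \<le> (\<integral>\<^sup>+\<omega>. ennreal (indicator (space M) \<omega> * ?c \<omega>) \<partial>M)"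
      by (rule nn) (metis sets.top space_past)
    also have "\<dots> = (\<integral>\<^sup>+\<omega>. ennreal (?c \<omega>) \<partial>M)" by (intro nn_integral_cong) simp
    also have "\<dots> = ennreal (\<integral>\<omega>. ?c \<omega> \<partial>M)" by (rule nn_integral_eq_integral[OF cint]) (use c0 in simp)
    also have "\<dots> < \<infinity>" by simp
    finally show "(\<integral>\<^sup>+\<omega>. ennreal (norm (?n \<omega>)) \<partial>M) < \<infinity>" .
  qed measurable
  then show "square_integrable M (\<lambda>\<omega>. g t \<omega> - grad f (x t \<omega>))" by (simp add: square_integrable_def)
  assume A: "A \<in> sets (\<F> t)"
  then have AM: "A \<in> sets M" using subalgebra_\<F>[of t] by (auto simp: subalgebra_def)
  have i: "integrable M (\<lambda>\<omega>. indicator A \<omega> * ?n \<omega>)" "integrable M (\<lambda>\<omega>. indicator A \<omega> * ?c \<omega>)"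
    using integrable_mult_indicator[OF AM nint] integrable_mult_indicator[OF AM cint] by simp_all
  have "ennreal (\<integral>\<omega>. indicator A \<omega> * ?n \<omega> \<partial>M) = (\<integral>\<^sup>+\<omega>. ennreal (indicator A \<omega> * ?n \<omega>) \<partial>M)"
    by (rule nn_integral_eq_integral[OF i(1), symmetric]) simp
  also have "\<dots> \<le> (\<integral>\<^sup>+\<omega>. ennreal (indicator A \<omega> * ?c \<omega>) \<partial>M)" by (rule nn[OF A])
  also have "\<dots> = ennreal (\<integral>\<omega>. indicator A \<omega> * ?c \<omega> \<partial>M)"
    by (rule nn_integral_eq_integral[OF i(2)]) (use c0 in simp)
  finally show "(\<integral>\<omega>. indicator A \<omega> * ?n \<omega> \<partial>M) \<le> (\<integral>\<omega>. indicator A \<omega> * ?c \<omega> \<partial>M)"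
    by (subst (asm) ennreal_le_iff) (use c0 in \<open>auto intro!: integral_nonneg_AE\<close>)
qed

lemma g_square_integrable: "square_integrable M (g t)"
  using square_integrable_add[OF noise_bound(1) grad_square_integrable] by simp

text \<open>\<open>z\<close> is \<open>z_error\<close> minus the Newton vector; the error is at most
  \<open>\<kappa> ^ \<tau>\<close> times the Newton vector, whose norm is at most
  \<open>norm (g t \<omega>) / \<gamma>\<^sub>H\<close>.\<close>

abbreviation (input) K\<^sub>z :: real where "K\<^sub>z \<equiv> (\<kappa> ^ \<tau> + 1) / \<gamma>\<^sub>H"

lemma direction_bound: "AE \<omega> in M. norm (z t \<tau> \<omega>) \<le> K\<^sub>z * norm (g t \<omega>)"
proof (rule AE_regularI[of t])
  fix \<omega> assume r: "regular t \<omega>" and s: "\<omega> \<in> space M"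
  have "norm (z t \<tau> \<omega>) = norm (z_error t \<tau> \<omega> - newton t \<omega>)" by (simp add: z_error_def)
  also have "\<dots> \<le> \<kappa> ^ \<tau> * norm (newton t \<omega>) + norm (newton t \<omega>)"
    using norm_triangle_ineq4[of "z_error t \<tau> \<omega>" "newton t \<omega>"] error_growth[OF r s order_refl] by linarith
  also have "\<dots> = (\<kappa> ^ \<tau> + 1) * norm (newton t \<omega>)" by (simp add: distrib_right)
  also have "\<dots> \<le> (\<kappa> ^ \<tau> + 1) * (norm (g t \<omega>) / \<gamma>\<^sub>H)"
    using newton_bound[OF s, of t] \<gamma>\<^sub>S by (intro mult_left_mono) auto
  finally show "norm (z t \<tau> \<omega>) \<le> K\<^sub>z * norm (g t \<omega>)" by simp
qed

lemma direction_square_integrable: "square_integrable M (z t \<tau>)"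
  by (rule square_integrable_bound[OF g_square_integrable \<G>_to_M[OF solver_measurable_\<G>(1)[OF order_refl] order_refl] direction_bound])

end

lemma x_square_integrable: "square_integrable M (x t)"
proof (induction t)
  case 0
  have "x 0 = (\<lambda>_. x0)" using x_0 by auto
  then show ?case by (simp add: square_integrable_const)
next
  case (Suc t)
  have "x (Suc t) = (\<lambda>\<omega>. x t \<omega> + (C\<^sub>\<phi> / (real t + 1) powr \<phi>) *\<^sub>R z t \<tau> \<omega>)" using x_Suc by auto
  then show ?case
    using square_integrable_add[OF Suc square_integrable_scaleR[OF direction_square_integrable[OF Suc]]] by simp
qed

lemma integrable_indicator:
  assumes "A \<in> sets (\<F> t)" "integrable M U"
  shows "integrable M (\<lambda>\<omega>. indicator A \<omega> * U \<omega> :: real)"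
proof -
  have "A \<in> sets M" using assms(1) subalgebra_\<F>[of t] by (auto simp: subalgebra_def)
  from integrable_mult_indicator[OF this assms(2)] show ?thesis by simp
qed

text \<open>With \<open>d\<close> the gradient, \<open><d, B^-1 d>\<close> is at least
  \<open>|d|^2 / \<Upsilon>\<^sub>H\<close>. The error part is at most half of this, by the bounds
  \<open>\<gamma>\<^sub>H / (2 * \<Upsilon>\<^sub>H)\<close> on the mean error matrix and
  \<open>1 / \<gamma>\<^sub>H\<close> on \<open>B^-1\<close>. The Polyak-Lojasiewicz inequality
  converts the remaining half into \<open>gap t\<close>.\<close>

lemma descent_direction:
  assumes A: "A \<in> sets (\<F> t)"
  shows "(\<integral>\<omega>. indicator A \<omega> * (grad f (x t \<omega>) \<bullet> z t \<tau> \<omega>) \<partial>M) \<le> - (\<gamma>\<^sub>H / \<Upsilon>\<^sub>H) * (\<integral>\<omega>. indicator A \<omega> * gap t \<omega> \<partial>M)"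
proof -
  note x2 = x_square_integrable[of t]
  note grad2 = grad_square_integrable[OF x2] and g2 = g_square_integrable[OF x2]
  let ?d = "\<lambda>\<omega>. grad f (x t \<omega>)"
  let ?b = "\<lambda>\<omega>. matrix_inv (B t \<omega>) *v ?d \<omega>"
  \<comment> \<open>The gradient, cut off to an event of the past, is the test function that turns
    the vector identity \<open>mean_direction\<close> into a statement about descent on
    \<open>A\<close>.\<close>
  let ?X = "\<lambda>\<omega>. (indicator A \<omega> :: real) *\<^sub>R ?d \<omega>"
  have X: "test_function t ?X"
  proof (rule test_function_scaleR[where C = 1])
    show "test_function t ?d" using grad2 grad_measurable by (simp add: test_function_def)
    show "(\<lambda>\<omega>. indicator A \<omega> :: real) \<in> borel_measurable (\<F> t)" using A by measurable
    show "AE \<omega> in M. \<bar>indicator A \<omega> :: real\<bar> \<le> 1" by (simp add: indicator_def)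
  qed
  have b2: "square_integrable M (\<lambda>\<omega>. mean_z t \<tau> \<omega> *v ?b \<omega> - ?b \<omega>)"
  proof (rule square_integrable_bound[OF grad2])
    note [measurable] = \<F>_to_M[OF mean_measurable(1)] \<F>_to_M[OF B_measurable] \<F>_to_M[OF grad_measurable]
    show "(\<lambda>\<omega>. mean_z t \<tau> \<omega> *v ?b \<omega> - ?b \<omega>) \<in> borel_measurable M" by measurable
    show "AE \<omega> in M. norm (mean_z t \<tau> \<omega> *v ?b \<omega> - ?b \<omega>) \<le> ((\<kappa> ^ \<tau> + 1) / \<gamma>\<^sub>H) * norm (?d \<omega>)"
    proof (rule AE_regularI[of t])
      fix \<omega> assume r: "regular t \<omega>" and s: "\<omega> \<in> space M"
      have "norm (mean_z t \<tau> \<omega> *v ?b \<omega> - ?b \<omega>) \<le> \<kappa> ^ \<tau> * norm (?b \<omega>) + norm (?b \<omega>)"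
        using norm_triangle_ineq4[of "mean_z t \<tau> \<omega> *v ?b \<omega>" "?b \<omega>"] mean_growth(1)[OF r, of \<tau> "?b \<omega>"] by linarith
      also have "\<dots> = (\<kappa> ^ \<tau> + 1) * norm (?b \<omega>)" by (simp add: distrib_right)
      also have "\<dots> \<le> (\<kappa> ^ \<tau> + 1) * (norm (?d \<omega>) / \<gamma>\<^sub>H)"
        using form_bounds_matrix_inv(3)[OF B_bounds(2)[OF s] \<gamma>\<^sub>H] \<gamma>\<^sub>S by (intro mult_left_mono) auto
      finally show "norm (mean_z t \<tau> \<omega> *v ?b \<omega> - ?b \<omega>) \<le> ((\<kappa> ^ \<tau> + 1) / \<gamma>\<^sub>H) * norm (?d \<omega>)" by simp
    qed
  qed
  have "(\<integral>\<omega>. indicator A \<omega> * (?d \<omega> \<bullet> z t \<tau> \<omega>) \<partial>M) = (\<integral>\<omega>. ?X \<omega> \<bullet> z t \<tau> \<omega> \<partial>M)" by simp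
  also have "\<dots> = (\<integral>\<omega>. ?X \<omega> \<bullet> (mean_z t \<tau> \<omega> *v ?b \<omega> - ?b \<omega>) \<partial>M)"
    by (rule mean_direction[OF g2 X grad2])
  also have "\<dots> \<le> (\<integral>\<omega>. - (\<gamma>\<^sub>H / \<Upsilon>\<^sub>H) * (indicator A \<omega> * gap t \<omega>) \<partial>M)"
  proof (rule integral_mono_AE)
    show "integrable M (\<lambda>\<omega>. ?X \<omega> \<bullet> (mean_z t \<tau> \<omega> *v ?b \<omega> - ?b \<omega>))"
      using X b2 by (intro integrable_inner_square_integrable) (simp_all add: test_function_def)
    show "integrable M (\<lambda>\<omega>. - (\<gamma>\<^sub>H / \<Upsilon>\<^sub>H) * (indicator A \<omega> * gap t \<omega>))"
      by (intro integrable_mult_right integrable_indicator[OF A] gap_integrable x2)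
    show "AE \<omega> in M. ?X \<omega> \<bullet> (mean_z t \<tau> \<omega> *v ?b \<omega> - ?b \<omega>) \<le> - (\<gamma>\<^sub>H / \<Upsilon>\<^sub>H) * (indicator A \<omega> * gap t \<omega>)"
    proof (rule AE_regularI[of t])
      fix \<omega> assume r: "regular t \<omega>" and s: "\<omega> \<in> space M"
      note Bb = B_bounds[where t = t, OF s]
      let ?n = "norm (?d \<omega>)"
      have "?d \<omega> \<bullet> (mean_z t \<tau> \<omega> *v ?b \<omega>) \<le> ?n * norm (mean_z t \<tau> \<omega> *v ?b \<omega>)" by (rule norm_cauchy_schwarz)
      also have "\<dots> \<le> ?n * (\<gamma>\<^sub>H / (2 * \<Upsilon>\<^sub>H) * norm (?b \<omega>))"
        using regularD(9)[OF r] by (intro mult_left_mono) (auto simp: mean_z_def)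
      also have "\<dots> \<le> ?n * (\<gamma>\<^sub>H / (2 * \<Upsilon>\<^sub>H) * (?n / \<gamma>\<^sub>H))"
        using form_bounds_matrix_inv(3)[OF Bb(2) \<gamma>\<^sub>H] \<gamma>\<^sub>H \<Upsilon>\<^sub>H by (intro mult_left_mono) auto
      also have "\<dots> = ?n\<^sup>2 / (2 * \<Upsilon>\<^sub>H)" using \<gamma>\<^sub>H by (simp add: power2_eq_square)
      finally have 1: "?d \<omega> \<bullet> (mean_z t \<tau> \<omega> *v ?b \<omega>) \<le> ?n\<^sup>2 / (2 * \<Upsilon>\<^sub>H)" .
      have "?n\<^sup>2 \<le> \<Upsilon>\<^sub>H * (?d \<omega> \<bullet> ?b \<omega>)" by (rule matrix_inv_form_lower[OF Bb(1,2) \<gamma>\<^sub>H Bb(3)])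
      then have 2: "?n\<^sup>2 / \<Upsilon>\<^sub>H \<le> ?d \<omega> \<bullet> ?b \<omega>" using \<Upsilon>\<^sub>H by (simp add: pos_divide_le_eq mult.commute)
      have "?n\<^sup>2 / (2 * \<Upsilon>\<^sub>H) - ?n\<^sup>2 / \<Upsilon>\<^sub>H = - (?n\<^sup>2 / (2 * \<Upsilon>\<^sub>H))" by simp
      then have "?d \<omega> \<bullet> (mean_z t \<tau> \<omega> *v ?b \<omega> - ?b \<omega>) \<le> - (?n\<^sup>2 / (2 * \<Upsilon>\<^sub>H))"
        using 1 2 by (simp add: inner_diff_right)
      also have "?n\<^sup>2 / (2 * \<Upsilon>\<^sub>H) \<ge> (2 * \<gamma>\<^sub>H * gap t \<omega>) / (2 * \<Upsilon>\<^sub>H)"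
        using gap_facts(3)[of t \<omega>] \<Upsilon>\<^sub>H by (intro divide_right_mono) auto
      then have "- (?n\<^sup>2 / (2 * \<Upsilon>\<^sub>H)) \<le> - (\<gamma>\<^sub>H / \<Upsilon>\<^sub>H) * gap t \<omega>" by simp
      finally show "?X \<omega> \<bullet> (mean_z t \<tau> \<omega> *v ?b \<omega> - ?b \<omega>) \<le> - (\<gamma>\<^sub>H / \<Upsilon>\<^sub>H) * (indicator A \<omega> * gap t \<omega>)"
        by (simp add: indicator_def)
    qed
  qed
  also have "\<dots> = - (\<gamma>\<^sub>H / \<Upsilon>\<^sub>H) * (\<integral>\<omega>. indicator A \<omega> * gap t \<omega> \<partial>M)"
    by (rule integral_mult_right_zero)
  finally show ?thesis .
qed

text \<open>From \<open>|z| <= K |g|\<close> with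
  \<open>K = (\<kappa> ^ \<tau> + 1) / \<gamma>\<^sub>H\<close> and
  \<open>|g|^2 <= 2 |noise|^2 + 2 |grad|^2\<close>: the noise contributes
  \<open>4 * C\<^sub>1 / \<gamma>\<^sub>H\<close> times the gap and the constant
  \<open>2 * C\<^sub>2\<close>, the gradient \<open>4 * \<Upsilon>\<^sub>H\<close> times the gap.
  One number serves for both coefficients.\<close>

definition K\<^sub>2 :: real where
  "K\<^sub>2 = ((\<kappa> ^ \<tau> + 1) / \<gamma>\<^sub>H)\<^sup>2 * (4 * C\<^sub>1 / \<gamma>\<^sub>H + 4 * \<Upsilon>\<^sub>H + 2 * C\<^sub>2)"

lemma K\<^sub>2: "0 \<le> K\<^sub>2"
  using C\<^sub>1 C\<^sub>2 \<gamma>\<^sub>H \<Upsilon>\<^sub>H by (simp add: K\<^sub>2_def)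

lemma direction_second_moment:
  assumes A: "A \<in> sets (\<F> t)"
  shows "(\<integral>\<omega>. indicator A \<omega> * (norm (z t \<tau> \<omega>))\<^sup>2 \<partial>M) \<le> K\<^sub>2 * (\<integral>\<omega>. indicator A \<omega> * gap t \<omega> \<partial>M) + K\<^sub>2 * prob A"
proof -
  note x2 = x_square_integrable[of t]
  have AM: "A \<in> sets M" using A subalgebra_\<F>[of t] by (auto simp: subalgebra_def)
  let ?K = "((\<kappa> ^ \<tau> + 1) / \<gamma>\<^sub>H)\<^sup>2"
  let ?n = "\<lambda>\<omega>. (norm (g t \<omega> - grad f (x t \<omega>)))\<^sup>2" and ?d = "\<lambda>\<omega>. (norm (grad f (x t \<omega>)))\<^sup>2"
  let ?I = "\<integral>\<omega>. indicator A \<omega> * gap t \<omega> \<partial>M"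
  have I0: "0 \<le> ?I" using gap_facts(1) by simp
  note iA = integrable_indicator[OF A]
  have ints: "integrable M (\<lambda>\<omega>. indicator A \<omega> * ?n \<omega>)" "integrable M (\<lambda>\<omega>. indicator A \<omega> * ?d \<omega>)" "integrable M (\<lambda>\<omega>. indicator A \<omega> * gap t \<omega>)"
    using noise_bound(1)[OF x2] grad_square_integrable[OF x2] gap_integrable[OF x2] iA by (simp_all add: square_integrable_def)
  have "(\<integral>\<omega>. indicator A \<omega> * (norm (z t \<tau> \<omega>))\<^sup>2 \<partial>M) \<le> (\<integral>\<omega>. 2 * ?K * (indicator A \<omega> * ?n \<omega>) + 2 * ?K * (indicator A \<omega> * ?d \<omega>) \<partial>M)"
  proof (rule integral_mono_AE)
    show "integrable M (\<lambda>\<omega>. indicator A \<omega> * (norm (z t \<tau> \<omega>))\<^sup>2)"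
      using iA direction_square_integrable[OF x2] by (simp add: square_integrable_def)
    show "integrable M (\<lambda>\<omega>. 2 * ?K * (indicator A \<omega> * ?n \<omega>) + 2 * ?K * (indicator A \<omega> * ?d \<omega>))"
      by (intro Bochner_Integration.integrable_add integrable_mult_right ints)
    show "AE \<omega> in M. indicator A \<omega> * (norm (z t \<tau> \<omega>))\<^sup>2 \<le> 2 * ?K * (indicator A \<omega> * ?n \<omega>) + 2 * ?K * (indicator A \<omega> * ?d \<omega>)"
      using direction_bound[OF x2]
    proof eventually_elim
      case (elim \<omega>)
      let ?p = "norm (g t \<omega> - grad f (x t \<omega>))" and ?q = "norm (grad f (x t \<omega>))"
      have "(norm (z t \<tau> \<omega>))\<^sup>2 \<le> (((\<kappa> ^ \<tau> + 1) / \<gamma>\<^sub>H) * norm (g t \<omega>))\<^sup>2" using elim by (intro power_mono) auto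
      also have "\<dots> = ?K * (norm (g t \<omega>))\<^sup>2" by (rule power_mult_distrib)
      also have "\<dots> \<le> ?K * (2 * ?n \<omega> + 2 * ?d \<omega>)"
      proof (rule mult_left_mono)
        have "norm (g t \<omega>) \<le> ?p + ?q" using norm_triangle_ineq[of "g t \<omega> - grad f (x t \<omega>)" "grad f (x t \<omega>)"] by simp
        then have "(norm (g t \<omega>))\<^sup>2 \<le> (?p + ?q)\<^sup>2" by (intro power_mono) auto
        also have "\<dots> \<le> 2 * ?p\<^sup>2 + 2 * ?q\<^sup>2" using sum_squares_bound[of ?p ?q] by (simp add: power2_sum)
        finally show "(norm (g t \<omega>))\<^sup>2 \<le> 2 * ?n \<omega> + 2 * ?d \<omega>" .
      qed simp
      finally show ?case by (simp add: indicator_def algebra_simps)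
    qed
  qed
  also have "\<dots> = 2 * ?K * (\<integral>\<omega>. indicator A \<omega> * ?n \<omega> \<partial>M) + 2 * ?K * (\<integral>\<omega>. indicator A \<omega> * ?d \<omega> \<partial>M)"
    by (subst Bochner_Integration.integral_add) (intro integrable_mult_right ints, intro integrable_mult_right ints, simp only: integral_mult_right_zero)
  also have "\<dots> \<le> 2 * ?K * (2 * C\<^sub>1 / \<gamma>\<^sub>H * ?I + C\<^sub>2 * prob A) + 2 * ?K * (2 * \<Upsilon>\<^sub>H * ?I)"
  proof (intro add_mono mult_left_mono)
    have "(\<integral>\<omega>. indicator A \<omega> * ?n \<omega> \<partial>M) \<le> (\<integral>\<omega>. indicator A \<omega> * (C\<^sub>1 * (norm (x t \<omega> - xstar))\<^sup>2 + C\<^sub>2) \<partial>M)"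
      by (rule noise_bound(2)[OF x2 A])
    also have "\<dots> \<le> (\<integral>\<omega>. C\<^sub>2 * indicator A \<omega> + 2 * C\<^sub>1 / \<gamma>\<^sub>H * (indicator A \<omega> * gap t \<omega>) \<partial>M)"
    proof (rule integral_mono)
      show "integrable M (\<lambda>\<omega>. indicator A \<omega> * (C\<^sub>1 * (norm (x t \<omega> - xstar))\<^sup>2 + C\<^sub>2))"
        using deviation_square_integrable[OF x2] by (intro iA) (simp add: square_integrable_def)
      show "integrable M (\<lambda>\<omega>. C\<^sub>2 * indicator A \<omega> + 2 * C\<^sub>1 / \<gamma>\<^sub>H * (indicator A \<omega> * gap t \<omega>))"
        by (rule integral_add_const_indicator(1)[OF integrable_mult_right[OF ints(3)] AM])
      fix \<omega>
      have "C\<^sub>1 * (norm (x t \<omega> - xstar))\<^sup>2 \<le> C\<^sub>1 * (2 / \<gamma>\<^sub>H * gap t \<omega>)"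
        using gap_facts(4)[of t \<omega>] C\<^sub>1 by (intro mult_left_mono) auto
      then show "indicator A \<omega> * (C\<^sub>1 * (norm (x t \<omega> - xstar))\<^sup>2 + C\<^sub>2) \<le> C\<^sub>2 * indicator A \<omega> + 2 * C\<^sub>1 / \<gamma>\<^sub>H * (indicator A \<omega> * gap t \<omega>)"
        by (simp add: indicator_def ac_simps)
    qed
    also have "\<dots> = C\<^sub>2 * prob A + (\<integral>\<omega>. 2 * C\<^sub>1 / \<gamma>\<^sub>H * (indicator A \<omega> * gap t \<omega>) \<partial>M)"
      by (rule integral_add_const_indicator(2)[OF integrable_mult_right[OF ints(3)] AM])
    also have "\<dots> = 2 * C\<^sub>1 / \<gamma>\<^sub>H * ?I + C\<^sub>2 * prob A" by (simp only: integral_mult_right_zero add.commute)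
    finally show "(\<integral>\<omega>. indicator A \<omega> * ?n \<omega> \<partial>M) \<le> 2 * C\<^sub>1 / \<gamma>\<^sub>H * ?I + C\<^sub>2 * prob A" .
    have "(\<integral>\<omega>. indicator A \<omega> * ?d \<omega> \<partial>M) \<le> (\<integral>\<omega>. 2 * \<Upsilon>\<^sub>H * (indicator A \<omega> * gap t \<omega>) \<partial>M)"
    proof (rule integral_mono[OF ints(2) integrable_mult_right[OF ints(3)]])
      show "indicator A \<omega> * ?d \<omega> \<le> 2 * \<Upsilon>\<^sub>H * (indicator A \<omega> * gap t \<omega>)" for \<omega>
        using gap_facts(2)[of t \<omega>] by (simp add: indicator_def)
    qed
    then show "(\<integral>\<omega>. indicator A \<omega> * ?d \<omega> \<partial>M) \<le> 2 * \<Upsilon>\<^sub>H * ?I" by (simp only: integral_mult_right_zero)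
  qed simp_all
  also have "\<dots> = ?K * (4 * C\<^sub>1 / \<gamma>\<^sub>H + 4 * \<Upsilon>\<^sub>H) * ?I + ?K * (2 * C\<^sub>2) * prob A"
    by (simp add: algebra_simps)
  also have "\<dots> \<le> K\<^sub>2 * ?I + K\<^sub>2 * prob A"
  proof (intro add_mono mult_right_mono I0)
    show "?K * (4 * C\<^sub>1 / \<gamma>\<^sub>H + 4 * \<Upsilon>\<^sub>H) \<le> K\<^sub>2" "?K * (2 * C\<^sub>2) \<le> K\<^sub>2"
      unfolding K\<^sub>2_def using C\<^sub>1 C\<^sub>2 \<gamma>\<^sub>H \<Upsilon>\<^sub>H by (auto intro!: mult_left_mono)
  qed simp
  finally show ?thesis .
qed

text \<open>The quadratic upper bound on \<open>f\<close> along the step, integrated over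
  \<open>A\<close>. Letting \<open>A\<close> range over the events of the past takes the place of a
  conditional expectation of \<open>gap (Suc t)\<close>.\<close>

lemma gap_step:
  assumes A: "A \<in> sets (\<F> t)"
  defines "a \<equiv> C\<^sub>\<phi> / (real t + 1) powr \<phi>"
  shows "(\<integral>\<omega>. indicator A \<omega> * gap (Suc t) \<omega> \<partial>M) \<le>
    (1 - \<gamma>\<^sub>H / \<Upsilon>\<^sub>H * a + \<Upsilon>\<^sub>H / 2 * K\<^sub>2 * a\<^sup>2) * (\<integral>\<omega>. indicator A \<omega> * gap t \<omega> \<partial>M) + \<Upsilon>\<^sub>H / 2 * K\<^sub>2 * a\<^sup>2 * prob A"
proof -
  note x2 = x_square_integrable
  have a0: "0 \<le> a" using C\<^sub>\<phi> by (simp add: a_def)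
  let ?I = "\<integral>\<omega>. indicator A \<omega> * gap t \<omega> \<partial>M"
  let ?p = "\<lambda>\<omega>. indicator A \<omega> * (grad f (x t \<omega>) \<bullet> z t \<tau> \<omega>)" and ?q = "\<lambda>\<omega>. indicator A \<omega> * (norm (z t \<tau> \<omega>))\<^sup>2"
  note iA = integrable_indicator[OF A]
  have ints: "integrable M (\<lambda>\<omega>. indicator A \<omega> * gap t \<omega>)" "integrable M ?p" "integrable M ?q"
    using iA gap_integrable[OF x2] direction_square_integrable[OF x2]
      integrable_inner_square_integrable[OF grad_square_integrable[OF x2] direction_square_integrable[OF x2]]
    by (simp_all add: square_integrable_def)
  have "(\<integral>\<omega>. indicator A \<omega> * gap (Suc t) \<omega> \<partial>M) \<le>
      (\<integral>\<omega>. indicator A \<omega> * gap t \<omega> + a * ?p \<omega> + \<Upsilon>\<^sub>H / 2 * a\<^sup>2 * ?q \<omega> \<partial>M)"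
  proof (rule integral_mono)
    show "integrable M (\<lambda>\<omega>. indicator A \<omega> * gap (Suc t) \<omega>)" by (rule iA[OF gap_integrable[OF x2]])
    show "integrable M (\<lambda>\<omega>. indicator A \<omega> * gap t \<omega> + a * ?p \<omega> + \<Upsilon>\<^sub>H / 2 * a\<^sup>2 * ?q \<omega>)"
      by (intro Bochner_Integration.integrable_add integrable_mult_right ints)
    fix \<omega>
    have step: "x (Suc t) \<omega> - x t \<omega> = a *\<^sub>R z t \<tau> \<omega>" by (simp add: x_Suc a_def)
    have "gap (Suc t) \<omega> \<le> gap t \<omega> + a * (grad f (x t \<omega>) \<bullet> z t \<tau> \<omega>) + \<Upsilon>\<^sub>H / 2 * a\<^sup>2 * (norm (z t \<tau> \<omega>))\<^sup>2"
      using f_bounds(2)[of "x (Suc t) \<omega>" "x t \<omega>"] a0 unfolding step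
      by (simp add: gap_def power_mult_distrib inner_commute)
    then show "indicator A \<omega> * gap (Suc t) \<omega> \<le> indicator A \<omega> * gap t \<omega> + a * ?p \<omega> + \<Upsilon>\<^sub>H / 2 * a\<^sup>2 * ?q \<omega>"
      by (simp add: indicator_def)
  qed
  also have "\<dots> = ?I + a * (\<integral>\<omega>. ?p \<omega> \<partial>M) + \<Upsilon>\<^sub>H / 2 * a\<^sup>2 * (\<integral>\<omega>. ?q \<omega> \<partial>M)"
    using ints by (simp only: Bochner_Integration.integral_add Bochner_Integration.integrable_add integrable_mult_right integral_mult_right_zero)
  also have "\<dots> \<le> ?I + a * (- (\<gamma>\<^sub>H / \<Upsilon>\<^sub>H) * ?I) + \<Upsilon>\<^sub>H / 2 * a\<^sup>2 * (K\<^sub>2 * ?I + K\<^sub>2 * prob A)"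
    using a0 \<Upsilon>\<^sub>H by (intro add_mono mult_left_mono order_refl descent_direction[OF A] direction_second_moment[OF A]) auto
  finally show ?thesis by (simp add: algebra_simps)
qed

text \<open>By strong convexity the gap dominates the squared distance to the minimiser, so it is
  enough that the gap tends to zero.\<close>

theorem iterates_converge: "AE \<omega> in M. (\<lambda>t. x t \<omega>) \<longlonglongrightarrow> xstar"
proof -
  have "AE \<omega> in M. (\<lambda>t. gap t \<omega>) \<longlonglongrightarrow> 0"
  proof (rule almost_supermartingale_tendsto_0[where G = \<F> and V = gap and a = "\<lambda>t. C\<^sub>\<phi> / (real t + 1) powr \<phi>"
        and c = "\<gamma>\<^sub>H / \<Upsilon>\<^sub>H" and C = "\<Upsilon>\<^sub>H / 2 * K\<^sub>2"])
    show "subalgebra M (\<F> n)" for n by (rule subalgebra_\<F>)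
    show "sets (\<F> n) \<subseteq> sets (\<F> (Suc n))" for n by (rule \<F>_mono) simp
    show "gap n \<in> borel_measurable (\<F> n)" for n by (rule gap_measurable)
    show "integrable M (gap n)" for n by (rule gap_integrable[OF x_square_integrable])
    show "0 \<le> gap n \<omega>" for n \<omega> by (rule gap_facts)
    show "0 \<le> C\<^sub>\<phi> / (real n + 1) powr \<phi>" for n using C\<^sub>\<phi> by simp
    show "0 < \<gamma>\<^sub>H / \<Upsilon>\<^sub>H" using \<gamma>\<^sub>H \<Upsilon>\<^sub>H by simp
    show "0 \<le> \<Upsilon>\<^sub>H / 2 * K\<^sub>2" using \<Upsilon>\<^sub>H K\<^sub>2 by simp
    show "summable (\<lambda>n. (C\<^sub>\<phi> / (real n + 1) powr \<phi>)\<^sup>2)" by (rule step_size_summable[OF \<phi>_lower])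
    show "\<not> summable (\<lambda>n. C\<^sub>\<phi> / (real n + 1) powr \<phi>)" by (rule step_size_not_summable[OF \<phi>_upper C\<^sub>\<phi>])
  qed (rule gap_step)
  then show ?thesis
  proof eventually_elim
    case (elim \<omega>)
    have "(\<lambda>t. (norm (x t \<omega> - xstar))\<^sup>2) \<longlonglongrightarrow> 0"
    proof (rule tendsto_sandwich[OF _ _ tendsto_const])
      show "(\<lambda>t. 2 / \<gamma>\<^sub>H * gap t \<omega>) \<longlonglongrightarrow> 0" using tendsto_mult_right_zero[OF elim, of "2 / \<gamma>\<^sub>H"] by simp
    qed (use gap_facts(4) in auto)
    then have "(\<lambda>t. sqrt ((norm (x t \<omega> - xstar))\<^sup>2)) \<longlonglongrightarrow> sqrt 0" by (rule tendsto_real_sqrt)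
    then have "(\<lambda>t. norm (x t \<omega> - xstar)) \<longlonglongrightarrow> 0" by simp
    then show ?case by (simp add: tendsto_norm_zero_iff LIM_zero_iff)
  qed
qed

end

theorem theorem3p8:
  fixes M :: "'a measure" and P :: "'b measure" and D :: "(real^'s^'d) measure"
    and F :: "real^'d \<Rightarrow> 'b \<Rightarrow> real" and f :: "real^'d \<Rightarrow> real"
    and xstar x0 :: "real^'d" and B0 :: "real^'d^'d" and \<tau> :: nat
    and \<xi> :: "nat \<Rightarrow> 'a \<Rightarrow> 'b" and S :: "nat \<Rightarrow> nat \<Rightarrow> 'a \<Rightarrow> real^'s^'d"
    and x g :: "nat \<Rightarrow> 'a \<Rightarrow> real^'d" and H B :: "nat \<Rightarrow> 'a \<Rightarrow> real^'d^'d"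
    and Zt Z Y :: "nat \<Rightarrow> 'a \<Rightarrow> real^'d^'d"
    and \<mu> \<nu> \<gamma> \<alpha> \<beta> :: "nat \<Rightarrow> 'a \<Rightarrow> real"
    and z v y w :: "nat \<Rightarrow> nat \<Rightarrow> 'a \<Rightarrow> real^'d"
    and \<gamma>\<^sub>H \<Upsilon>\<^sub>H \<Upsilon>\<^sub>L C\<^sub>1 C\<^sub>2 \<gamma>\<^sub>S C\<^sub>\<phi> \<phi> :: real
  \<comment> \<open>the problem\<close>
  assumes "prob_space M" and "prob_space P"
    and "\<And>u. integrable P (F u)"
    and "\<And>u. f u = (\<integral>s. F u s \<partial>P)"
    and "is_arg_min f (\<lambda>_. True) xstar"
  \<comment> \<open>data and sketches\<close>
    and "prob_space.indep_vars M (\<lambda>_. P) \<xi> UNIV"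
    and "\<And>t. distr M P (\<xi> t) = P"
    and "\<tau> \<ge> 1"
    and "prob_space.indep_vars M (\<lambda>_. borel) (\<lambda>(t, j). S t j) (UNIV \<times> {..<\<tau>})"
    and "\<And>t j. j < \<tau> \<Longrightarrow> distr M borel (S t j) = D"
    and "prob_space.indep_set M (sets (gen_sigma M P \<xi> UNIV))
           (sets (gen_sigma M borel (\<lambda>(t, j). S t j) (UNIV \<times> {..<\<tau>})))"
  \<comment> \<open>gradients, Hessians and their average\<close>
    and "\<And>t \<omega>. g t \<omega> = grad (\<lambda>u. F u (\<xi> t \<omega>)) (x t \<omega>)"
    and "\<And>t \<omega>. H t \<omega> = hessian (\<lambda>u. F u (\<xi> t \<omega>)) (x t \<omega>)"
    and "\<And>\<omega>. B 0 \<omega> = B0"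
    and "\<And>t \<omega>. t \<ge> 1 \<Longrightarrow> B t \<omega> = (1 / real t) *\<^sub>R (\<Sum>i<t. H i \<omega>)"
    and "transpose B0 = B0"
    and "\<gamma>\<^sub>H *\<^sub>R mat 1 \<preceq>\<^sub>L B0" and "B0 \<preceq>\<^sub>L \<Upsilon>\<^sub>H *\<^sub>R mat 1"
  \<comment> \<open>solver parameters; \<open>S t 0\<close> is the copy of the sketch independent of the past\<close>
    and "\<And>t \<omega>. Zt t \<omega> = sketch_proj (B t \<omega>) (S t 0 \<omega>)"
    and "\<And>t \<omega>. Z t \<omega> = cond_exp_mat M (past M P \<xi> S \<tau> t) (Zt t) \<omega>"
    and "\<And>t \<omega>. Y t \<omega> = cond_exp_mat M (past M P \<xi> S \<tau> t)
                         (\<lambda>\<omega>'. Zt t \<omega>' ** matrix_inv (Z t \<omega>') ** Zt t \<omega>') \<omega>"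
    and "\<And>t \<omega>. \<mu> t \<omega> = sketch_mu (Z t \<omega>)"
    and "\<And>t \<omega>. \<nu> t \<omega> = sketch_nu (Z t \<omega>) (Y t \<omega>)"
    and "\<And>t \<omega>. \<gamma> t \<omega> = 1 / sqrt (\<mu> t \<omega> * \<nu> t \<omega>)"
    and "\<And>t \<omega>. \<alpha> t \<omega> = 1 / (1 + \<gamma> t \<omega> * \<nu> t \<omega>)"
    and "\<And>t \<omega>. \<beta> t \<omega> = 1 - sqrt (\<mu> t \<omega> / \<nu> t \<omega>)"
  \<comment> \<open>the solver\<close>
    and "\<And>t \<omega>. z t 0 \<omega> = 0" and "\<And>t \<omega>. v t 0 \<omega> = 0"
    and "\<And>t j \<omega>. j < \<tau> \<Longrightarrow> y t j \<omega> = \<alpha> t \<omega> *\<^sub>R v t j \<omega> + (1 - \<alpha> t \<omega>) *\<^sub>R z t j \<omega>"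
    and "\<And>t j \<omega>. j < \<tau> \<Longrightarrow>
           w t j \<omega> = sketch_step (B t \<omega>) (S t j \<omega>) *v (B t \<omega> *v y t j \<omega> + g t \<omega>)"
    and "\<And>t j \<omega>. j < \<tau> \<Longrightarrow> z t (Suc j) \<omega> = y t j \<omega> - w t j \<omega>"
    and "\<And>t j \<omega>. j < \<tau> \<Longrightarrow>
           v t (Suc j) \<omega> = \<beta> t \<omega> *\<^sub>R v t j \<omega> + (1 - \<beta> t \<omega>) *\<^sub>R y t j \<omega> - \<gamma> t \<omega> *\<^sub>R w t j \<omega>"
  \<comment> \<open>the outer iteration\<close>
    and "C\<^sub>\<phi> > 0" and "1 / 2 < \<phi>" and "\<phi> \<le> 1"
    and "\<And>\<omega>. x 0 \<omega> = x0"
    and "\<And>t \<omega>. x (Suc t) \<omega> = x t \<omega> + (C\<^sub>\<phi> / (real t + 1) powr \<phi>) *\<^sub>R z t \<tau> \<omega>"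
  \<comment> \<open>(i)\<close>
    and "twice_continuously_differentiable f"
    and "\<And>s. s \<in> space P \<Longrightarrow> twice_continuously_differentiable (\<lambda>u. F u s)"
    and "0 < \<gamma>\<^sub>H" and "\<gamma>\<^sub>H < \<Upsilon>\<^sub>H"
    and "\<And>u s. s \<in> space P \<Longrightarrow> \<gamma>\<^sub>H \<le> lambda_min (hessian (\<lambda>u. F u s) u)"
    and "\<And>u s. s \<in> space P \<Longrightarrow>
           lambda_min (hessian (\<lambda>u. F u s) u) \<le> lambda_max (hessian (\<lambda>u. F u s) u)"
    and "\<And>u s. s \<in> space P \<Longrightarrow> lambda_max (hessian (\<lambda>u. F u s) u) \<le> \<Upsilon>\<^sub>H"
    and "\<Upsilon>\<^sub>L > 0"
    and "\<And>u u'. spectral_norm (hessian f u - hessian f u') \<le> \<Upsilon>\<^sub>L * norm (u - u')"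
  \<comment> \<open>(ii)\<close>
    and "C\<^sub>1 > 0" and "C\<^sub>2 > 0"
    and "\<And>t. AE \<omega> in M. cond_exp_vec M (past M P \<xi> S \<tau> t) (g t) \<omega> = grad f (x t \<omega>)"
    and "\<And>t. AE \<omega> in M.
           nn_cond_exp M (past M P \<xi> S \<tau> t) (\<lambda>\<omega>'. ennreal ((norm (g t \<omega>' - grad f (x t \<omega>')))\<^sup>2)) \<omega>
             \<le> ennreal (C\<^sub>1 * (norm (x t \<omega> - xstar))\<^sup>2 + C\<^sub>2)"
  \<comment> \<open>(iii)\<close>
    and "\<And>t. AE \<omega> in M. cond_exp_mat M (past M P \<xi> S \<tau> t) (H t) \<omega> = hessian f (x t \<omega>)"
  \<comment> \<open>(iv)\<close>
    and "\<gamma>\<^sub>S > 0"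
    and "\<And>t. AE \<omega> in M. \<gamma>\<^sub>S *\<^sub>R mat 1 \<preceq>\<^sub>L Z t \<omega>"
  \<comment> \<open>(v)\<close>
    and "\<And>t. AE \<omega> in M.
           ereal (real \<tau>) * epowi (1 - sqrt (\<mu> t \<omega> / \<nu> t \<omega>)) (int \<tau> - 2) \<le> ereal (\<gamma>\<^sub>H / (4 * \<Upsilon>\<^sub>H))"
  shows "AE \<omega> in M. (\<lambda>t. x t \<omega>) \<longlonglongrightarrow> xstar"
proof -
  interpret sketched_newton M P D F f xstar x0 B0 \<tau> \<xi> S x g H B Zt Z Y \<mu> \<nu> \<gamma> \<alpha> \<beta> z v y w
    \<gamma>\<^sub>H \<Upsilon>\<^sub>H C\<^sub>1 C\<^sub>2 \<gamma>\<^sub>S C\<^sub>\<phi> \<phi>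
    by (intro sketched_newton.intro sketched_newton_axioms.intro) (fact assms)+
  show ?thesis by (rule iterates_converge)
qed

end
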